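(* Let $\Omega\subset\mathbb{R}^d$ be open, let $(\Omega_n)_{n\in\mathbb{N}}$ be a family of non-empty Lebesgue measurable sets with $\Omega_n\subset\Omega_{n+1}$ for all $n$ and $\Omega=\bigcup_{n\in\mathbb{N}}\Omega_n$, and let $\mathcal{V}=(\nu_n)_{n\in\mathbb{N}}$ be a family of continuous functions $\nu_n\colon\Omega\to(0,\infty)$ with $\nu_n\le\nu_{n+1}$ for all $n\in\mathbb{N}$. Suppose that for every $k\in\mathbb{N}$ there is a function $r_k\colon\Omega_k\to(0,1]$ with $0<r_k(x)<\mathrm{d}^{\infty}_{k+1}(x)$ for all $x\in\Omega_k$ such that for every $n\in\mathbb{N}$ there exist $\psi_n\in L^1(\Omega_k)$ with $\psi_n>0$, natural numbers $I_j(n)\ge n$ and constants $A_j(n)>0$ ($j=1,2,3$) such that for every $x\in\Omega_k$: $(\omega.1)$ $\displaystyle\sup_{\zeta\in\mathbb{R}^d,\ \|\zeta\|_\infty\le r_k(x)}\nu_n(x+\zeta)\le A_1(n)\inf_{\zeta\in\mathbb{R}^d,\ \|\zeta\|_\infty\le r_k(x)}\nu_{I_1(n)}(x+\zeta)$, $(\omega.2)$ $\nu_n(x)\le A_2(n)\,\psi_n(x)\,\nu_{I_2(n)}(x)$, $(\omega.3)$ $\nu_n(x)\le A_3(n)\,r_k(x)\,\nu_{I_3(n)}(x)$. Suppose moreover that, for these functions $r_k$, at least one of the following holds: (s.1) for every $n\in\mathbb{N}$, $r_n$ is bounded away from zero on $\Omega_n$, i.e. $\inf_{x\in\Omega_n}r_n(x)>0$;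 (s.2) for every $n\in\mathbb{N}$, $\Omega_n$ is closed in $\mathbb{R}^d$; (s.3) for every $n\in\mathbb{N}$, $\Omega_n=\Omega$ and $r_n$ is continuous. Then the locally convex space $\mathcal{EV}(\Omega)$ is nuclear.
   Context: $d\in\mathbb{N}=\{1,2,\dots\}$, $\mathbb{N}_0=\mathbb{N}\cup\{0\}$, $\mathbb{K}=\mathbb{R}$ or $\mathbb{C}$. For $x=(x_i)\in\mathbb{R}^d$, $\|x\|_\infty=\max_{1\le i\le d}|x_i|$. For $k\in\mathbb{N}$ and $x\in\Omega_k$, $$\mathrm{d}^{\infty}_{k+1}(x):=\inf\{\|x-\zeta\|_\infty : \zeta\in\partial\Omega_{k+1}\}\in[0,\infty],$$ where $\partial\Omega_{k+1}$ is the boundary in $\mathbb{R}^d$ and $\inf\varnothing:=\infty$. The space is $$\mathcal{EV}(\Omega):=\{f\in\mathcal{C}^\infty(\Omega,\mathbb{K}) : |f|_{n,m}<\infty\ \text{ for all } n\in\mathbb{N},\ m\in\mathbb{N}_0\},\qquad |f|_{n,m}:=\sup_{x\in\Omega_n,\ \alpha\in\mathbb{N}_0^d,\ |\alpha|\le m}|\partial^\alpha f(x)|\,\nu_n(x),$$ where $\mathcal{C}^\infty(\Omega,\mathbb{K})$ is the space of infinitely continuously partially differentiable $\mathbb{K}$-valued functions on $\Omega$. It is equipped with the locally convex topology generated by the seminorms $|\cdot|_{n,m}$, $n\in\mathbb{N}$, $m\in\mathbb{N}_0$. "Nuclear" is in the usual sense of nuclear locally convex spaces. *)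

theory Defs
  imports "HOL-Analysis.Analysis" "HOL-Library.Function_Algebras"
begin

section \<open>Locally convex and nuclear spaces\<close>

text \<open>
  Vector spaces over a normed field \<open>'k\<close> (below: the reals or the complex numbers) are given by a
  scalar multiplication \<open>smul\<close> on a type of class \<open>ab_group_add\<close> and a carrier set that is a
  linear subspace.
\<close>

definition pointwise_scale :: "('k \<Rightarrow> 'v \<Rightarrow> 'v) \<Rightarrow> 'k \<Rightarrow> ('i \<Rightarrow> 'v) \<Rightarrow> 'i \<Rightarrow> 'v" where
  "pointwise_scale smul c f = (\<lambda>i. smul c (f i))"

definition seminorm_on ::
  "('k::real_normed_field \<Rightarrow> 'v::ab_group_add \<Rightarrow> 'v) \<Rightarrow> 'v set \<Rightarrow> ('v \<Rightarrow> real) \<Rightarrow> bool" where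
  "seminorm_on smul E p \<longleftrightarrow>
     (\<forall>x\<in>E. 0 \<le> p x) \<and>
     (\<forall>x\<in>E. \<forall>y\<in>E. p (x + y) \<le> p x + p y) \<and>
     (\<forall>c. \<forall>x\<in>E. p (smul c x) = norm c * p x)"

definition linear_functional_on ::
  "('k::real_normed_field \<Rightarrow> 'v::ab_group_add \<Rightarrow> 'v) \<Rightarrow> 'v set \<Rightarrow> ('v \<Rightarrow> 'k) \<Rightarrow> bool" where
  "linear_functional_on smul E a \<longleftrightarrow>
     (\<forall>x\<in>E. \<forall>y\<in>E. a (x + y) = a x + a y) \<and>
     (\<forall>c. \<forall>x\<in>E. a (smul c x) = c * a x)"

definition seminorm_topology :: "'v::ab_group_add set \<Rightarrow> ('v \<Rightarrow> real) set \<Rightarrow> 'v topology" where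
  "seminorm_topology E P =
     topology_generated_by {{y \<in> E. p (y - x) < e} | p x e. p \<in> P \<and> x \<in> E \<and> 0 < e}"

definition locally_convex_space ::
  "('k::real_normed_field \<Rightarrow> 'v::ab_group_add \<Rightarrow> 'v) \<Rightarrow> 'v topology \<Rightarrow> bool" where
  "locally_convex_space smul T \<longleftrightarrow>
     vector_space smul \<and> module.subspace smul (topspace T) \<and>
     continuous_map (prod_topology T T) T (\<lambda>(x, y). x + y) \<and>
     continuous_map (prod_topology euclidean T) T (\<lambda>(c, x). smul c x) \<and>
     Hausdorff_space T \<and>
     (\<forall>U. openin T U \<and> 0 \<in> U \<longrightarrow>
        (\<exists>V. openin T V \<and> 0 \<in> V \<and> V \<subseteq> U \<and>
           (\<forall>x\<in>V. \<forall>y\<in>V. \<forall>t\<in>{0..1::real}.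
              smul (of_real (1 - t)) x + smul (of_real t) y \<in> V)))"

text \<open>
  Nuclear operators \<open>L\<close> from \<open>(X, q)\<close> to \<open>(Y, p)\<close>: \<open>L\<close> has a representation
  \<open>L x = (\<Sum>j. a j x \<cdot> y j)\<close> with bounded functionals \<open>a j\<close> and summable
  \<open>\<parallel>a j\<parallel> * \<parallel>y j\<parallel>\<close>; the numbers \<open>c j\<close> are bounds for the dual norms of \<open>a j\<close>. \<open>X\<close> and \<open>Y\<close> carry
  seminorms; elements at distance \<open>0\<close> are thereby identified, so no quotient is formed.
\<close>

definition nuclear_map ::
  "('k::real_normed_field \<Rightarrow> 'v::ab_group_add \<Rightarrow> 'v) \<Rightarrow> 'v set \<Rightarrow> ('v \<Rightarrow> real) \<Rightarrow>
   ('k \<Rightarrow> 'w::ab_group_add \<Rightarrow> 'w) \<Rightarrow> 'w set \<Rightarrow> ('w \<Rightarrow> real) \<Rightarrow> ('v \<Rightarrow> 'w) \<Rightarrow> bool" where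
  "nuclear_map smulX X q smulY Y p L \<longleftrightarrow>
     (\<exists>(a :: nat \<Rightarrow> 'v \<Rightarrow> 'k) (c :: nat \<Rightarrow> real) (y :: nat \<Rightarrow> 'w).
        (\<forall>j. linear_functional_on smulX X (a j)) \<and>
        (\<forall>j. 0 \<le> c j \<and> (\<forall>x\<in>X. norm (a j x) \<le> c j * q x)) \<and>
        (\<forall>j. y j \<in> Y) \<and>
        summable (\<lambda>j. c j * p (y j)) \<and>
        (\<forall>x\<in>X. (\<lambda>N. p (L x - (\<Sum>j<N. smulY (a j x) (y j)))) \<longlonglongrightarrow> 0))"

text \<open>
  The local Banach space of a seminorm \<open>p\<close> on \<open>E\<close>, i.e. the completion of \<open>E / ker p\<close>: its elements
  are represented by \<open>p\<close>-Cauchy sequences in \<open>E\<close>, with pointwise operations, and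
  \<open>local_banach_norm p\<close> as norm. Sequences whose difference has norm \<open>0\<close> represent the same element.
\<close>

definition local_banach :: "'v::ab_group_add set \<Rightarrow> ('v \<Rightarrow> real) \<Rightarrow> (nat \<Rightarrow> 'v) set" where
  "local_banach E p =
     {u. (\<forall>i. u i \<in> E) \<and> (\<forall>e>0. \<exists>M. \<forall>i\<ge>M. \<forall>j\<ge>M. p (u i - u j) < e)}"

definition local_banach_norm :: "('v \<Rightarrow> real) \<Rightarrow> (nat \<Rightarrow> 'v) \<Rightarrow> real" where
  "local_banach_norm p u = lim (\<lambda>i. p (u i))"

definition continuous_seminorm ::
  "('k::real_normed_field \<Rightarrow> 'v::ab_group_add \<Rightarrow> 'v) \<Rightarrow> 'v topology \<Rightarrow> ('v \<Rightarrow> real) \<Rightarrow> bool" where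
  "continuous_seminorm smul T p \<longleftrightarrow>
     seminorm_on smul (topspace T) p \<and> continuous_map T euclideanreal p"

text \<open>
  For \<open>p \<le> q\<close> every \<open>q\<close>-Cauchy sequence is \<open>p\<close>-Cauchy, and on representatives the canonical map
  from the local Banach space of \<open>q\<close> to that of \<open>p\<close> is the identity.
\<close>

definition nuclear_space ::
  "('k::real_normed_field \<Rightarrow> 'v::ab_group_add \<Rightarrow> 'v) \<Rightarrow> 'v topology \<Rightarrow> bool" where
  "nuclear_space smul T \<longleftrightarrow>
     locally_convex_space smul T \<and>
     (\<forall>p. continuous_seminorm smul T p \<longrightarrow>
        (\<exists>q. continuous_seminorm smul T q \<and> (\<forall>x\<in>topspace T. p x \<le> q x) \<and>
           nuclear_map
             (pointwise_scale smul) (local_banach (topspace T) q) (local_banach_norm q)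
             (pointwise_scale smul) (local_banach (topspace T) p) (local_banach_norm p)
             (\<lambda>u. u)))"

section \<open>Partial derivatives and smooth functions\<close>

definition partial :: "'d::finite \<Rightarrow> (real^'d \<Rightarrow> 'k::real_normed_vector) \<Rightarrow> real^'d \<Rightarrow> 'k" where
  "partial i f x = vector_derivative (\<lambda>t. f (x + t *\<^sub>R axis i 1)) (at 0)"

definition iterated_partial ::
  "'d::finite list \<Rightarrow> (real^'d \<Rightarrow> 'k::real_normed_vector) \<Rightarrow> real^'d \<Rightarrow> 'k" where
  "iterated_partial js f = foldr partial js f"

text \<open>
  A function on \<open>\<Omega>\<close> is represented by its extension by \<open>0\<close>. As \<open>\<Omega>\<close> is open, the partial
  derivatives at points of \<open>\<Omega>\<close> do not depend on the extension.
\<close>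

definition smooth_functions :: "(real^'d::finite) set \<Rightarrow> (real^'d \<Rightarrow> 'k::real_normed_vector) set" where
  "smooth_functions \<Omega> =
     {f. (\<forall>x. x \<notin> \<Omega> \<longrightarrow> f x = 0) \<and>
         (\<forall>js. continuous_on \<Omega> (iterated_partial js f) \<and>
            (\<forall>i. \<forall>x\<in>\<Omega>. (\<lambda>t. iterated_partial js f (x + t *\<^sub>R axis i 1)) differentiable (at 0)))}"

text \<open>
  Multi-indices are functions \<open>\<alpha> :: 'd \<Rightarrow> nat\<close>. The coordinates are enumerated in some fixed order;
  by Schwarz's theorem the order does not matter for smooth functions.
\<close>

definition coordinate_list :: "'d::finite list" where
  "coordinate_list = (SOME js. distinct js \<and> set js = UNIV)"

definition multi_partial ::
  "('d::finite \<Rightarrow> nat) \<Rightarrow> (real^'d \<Rightarrow> 'k::real_normed_vector) \<Rightarrow> real^'d \<Rightarrow> 'k" where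
  "multi_partial \<alpha> f = foldr (\<lambda>i. partial i ^^ \<alpha> i) coordinate_list f"

section \<open>The weighted space\<close>

text \<open>
  The families \<open>\<Omega>n\<close> and \<open>\<nu>\<close> are indexed by the positive natural numbers; their values at index
  \<open>0\<close> are never used.
\<close>

definition ev_sup ::
  "(nat \<Rightarrow> (real^'d::finite) set) \<Rightarrow> (nat \<Rightarrow> real^'d \<Rightarrow> real) \<Rightarrow> nat \<Rightarrow> nat \<Rightarrow>
   (real^'d \<Rightarrow> 'k::real_normed_field) \<Rightarrow> ereal" where
  "ev_sup \<Omega>n \<nu> n m f =
     (SUP (x, \<alpha>) \<in> \<Omega>n n \<times> {\<alpha>. (\<Sum>i\<in>UNIV. \<alpha> i) \<le> m}. ereal (norm (multi_partial \<alpha> f x) * \<nu> n x))"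

definition ev_seminorm ::
  "(nat \<Rightarrow> (real^'d::finite) set) \<Rightarrow> (nat \<Rightarrow> real^'d \<Rightarrow> real) \<Rightarrow> nat \<Rightarrow> nat \<Rightarrow>
   (real^'d \<Rightarrow> 'k::real_normed_field) \<Rightarrow> real" where
  "ev_seminorm \<Omega>n \<nu> n m f = real_of_ereal (ev_sup \<Omega>n \<nu> n m f)"

definition ev_space ::
  "(real^'d::finite) set \<Rightarrow> (nat \<Rightarrow> (real^'d) set) \<Rightarrow> (nat \<Rightarrow> real^'d \<Rightarrow> real) \<Rightarrow>
   (real^'d \<Rightarrow> 'k::real_normed_field) set" where
  "ev_space \<Omega> \<Omega>n \<nu> = {f \<in> smooth_functions \<Omega>. \<forall>n\<ge>1. \<forall>m. ev_sup \<Omega>n \<nu> n m f < \<infinity>}"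

definition ev_topology ::
  "(real^'d::finite) set \<Rightarrow> (nat \<Rightarrow> (real^'d) set) \<Rightarrow> (nat \<Rightarrow> real^'d \<Rightarrow> real) \<Rightarrow>
   (real^'d \<Rightarrow> 'k::real_normed_field) topology" where
  "ev_topology \<Omega> \<Omega>n \<nu> =
     seminorm_topology (ev_space \<Omega> \<Omega>n \<nu>) {ev_seminorm \<Omega>n \<nu> n m | n m. 1 \<le> n}"

text \<open>
  \<open>boundary_dist S x\<close> is the distance of \<open>x\<close> to the boundary of \<open>S\<close> in the maximum norm
  (\<open>infnorm\<close>); it is \<open>\<infinity>\<close> if the boundary is empty.
\<close>

definition boundary_dist :: "(real^'d::finite) set \<Rightarrow> real^'d \<Rightarrow> ereal" where
  "boundary_dist S x = (INF \<zeta>\<in>frontier S. ereal (infnorm (x - \<zeta>)))"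

end

theory Submission
  imports Defs
begin

text \<open>
  A seminormed space is nuclear if each of its seminorms has a bound \<open>p x \<le> \<integral> \<bar>b t x\<bar> \<partial>\<mu>\<close> with a finite measure \<open>\<mu>\<close> and
  functionals \<open>b t\<close> that are uniformly bounded by a further seminorm \<open>q\<close> of the system. Indeed, by the Cauchy-Schwarz
  inequality \<open>p\<close> is then dominated by the Hermitian seminorm \<open>h x = sqrt (\<integral> \<bar>b t x\<bar>\<^sup>2 \<partial>\<mu>)\<close>. If \<open>q\<close> is in turn dominated by a
  Hermitian seminorm \<open>h'\<close>, then Bessel's inequality, applied to each functional \<open>b t\<close>, bounds the sum of the
  \<open>(h (e i))\<^sup>2\<close> over any \<open>h'\<close>-orthonormal system by a multiple of the total mass of \<open>\<mu>\<close>. So the canonical map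
  from \<open>h'\<close> to \<open>h\<close> is Hilbert-Schmidt, and the composition of two such maps is nuclear. These are the lemmas
  \<open>form_norm_hilbert_schmidt\<close>, \<open>nuclear_of_hilbert_schmidt\<close> and \<open>nuclear_space_criterion\<close>. The
  Hilbert-Schmidt property also implies that \<open>h\<close> is separable (\<open>hilbert_schmidt_separable\<close>), so that the Gram-Schmidt
  process yields orthonormal bases that consist of vectors of the space itself. The nuclear representation
  obtained on the space is transferred to the completions at the end (\<open>nuclear_map_local_banach\<close>).

  For the weighted spaces of smooth functions the functionals are the weighted derivatives at the points of
  \<open>\<Omega>n (n + 1)\<close>, and \<open>\<mu>\<close> has the density \<open>\<psi>\<close>. The required bound is an \<open>L\<^sup>1\<close> Sobolev inequality on the cube of radius
  \<open>r n x\<close> around \<open>x\<close>: the value at \<open>x\<close> is at most \<open>(2 / r n x) ^ d\<close> times the integral of the sum of the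
  derivatives of order up to \<open>d\<close> (\<open>sobolev_inequality\<close>). The three growth conditions turn it into the bound sought:
  the third one, used \<open>d\<close> times, compensates the power of the radius, the first one transports the weight from
  the centre \<open>x\<close> to the points of the cube, and the second one produces the integrable factor
  (\<open>weighted_sobolev_inequality\<close>). Since this inequality differentiates in arbitrary order whereas the seminorms
  are built from multi-indices, the symmetry of mixed derivatives enters (\<open>partial_commute\<close>).
\<close>

section \<open>Locally convex topologies given by seminorms\<close>

locale carrier_space = vector_space smul
  for smul :: "'k::{real_normed_field, banach} \<Rightarrow> 'v::ab_group_add \<Rightarrow> 'v" +
  fixes E :: "'v set"
  assumes subspace_E: "subspace E"
begin

lemmas E_closed [simp, intro] =
  subspace_0[OF subspace_E] subspace_add[OF subspace_E] subspace_scale[OF subspace_E]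
  subspace_diff[OF subspace_E] subspace_neg[OF subspace_E] subspace_sum[OF subspace_E]

lemma seminorm_facts:
  assumes "seminorm_on smul E p"
  shows seminorm_nonneg: "x \<in> E \<Longrightarrow> 0 \<le> p x"
    and seminorm_add: "x \<in> E \<Longrightarrow> y \<in> E \<Longrightarrow> p (x + y) \<le> p x + p y"
    and seminorm_smul: "x \<in> E \<Longrightarrow> p (smul c x) = norm c * p x"
    and seminorm_zero: "p 0 = 0"
    and seminorm_diff: "x \<in> E \<Longrightarrow> y \<in> E \<Longrightarrow> p (x - y) \<le> p x + p y"
    and seminorm_minus_commute: "x \<in> E \<Longrightarrow> y \<in> E \<Longrightarrow> p (x - y) = p (y - x)"
    and seminorm_abs_diff: "x \<in> E \<Longrightarrow> y \<in> E \<Longrightarrow> \<bar>p x - p y\<bar> \<le> p (x - y)"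
proof -
  show nn: "x \<in> E \<Longrightarrow> 0 \<le> p x" for x using assms by (auto simp: seminorm_on_def)
  show ad: "x \<in> E \<Longrightarrow> y \<in> E \<Longrightarrow> p (x + y) \<le> p x + p y" for x y
    using assms by (auto simp: seminorm_on_def)
  show sm: "x \<in> E \<Longrightarrow> p (smul c x) = norm c * p x" for x c
    using assms by (auto simp: seminorm_on_def)
  show "p 0 = 0" using sm[of 0 0] by simp
  have neg: "p (- x) = p x" if "x \<in> E" for x using sm[OF that, of "- 1"] by simp
  show "x \<in> E \<Longrightarrow> y \<in> E \<Longrightarrow> p (x - y) \<le> p x + p y" for x y
    using ad[of x "- y"] neg[of y] by simp
  show co: "x \<in> E \<Longrightarrow> y \<in> E \<Longrightarrow> p (x - y) = p (y - x)" for x y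
    using neg[of "x - y"] by simp
  show "x \<in> E \<Longrightarrow> y \<in> E \<Longrightarrow> \<bar>p x - p y\<bar> \<le> p (x - y)" for x y
    using ad[of "x - y" y] ad[of "y - x" x] co[of x y] by auto
qed

lemma seminorm_sum:
  assumes p: "seminorm_on smul E p" and x: "\<And>i. i \<in> I \<Longrightarrow> x i \<in> E"
  shows "p (\<Sum>i\<in>I. x i) \<le> (\<Sum>i\<in>I. p (x i))"
  using x
proof (induction I rule: infinite_finite_induct)
  case (insert i I)
  have "p (x i + (\<Sum>i\<in>I. x i)) \<le> p (x i) + p (\<Sum>i\<in>I. x i)"
    by (rule seminorm_add[OF p]) (use insert.prems in auto)
  then show ?case using insert by force
qed (auto simp: seminorm_zero[OF p])

lemma seminorm_scaled:
  assumes "seminorm_on smul E p" "0 \<le> K"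
  shows "seminorm_on smul E (\<lambda>x. K * p x)"
  using assms unfolding seminorm_on_def
  by (auto simp: mult.left_commute simp flip: distrib_left intro: mult_left_mono)

end

text \<open>Directedness makes the translated semiballs a basis of the topology and not merely a subbasis.\<close>

locale seminorm_system = carrier_space smul E
  for smul :: "'k::{real_normed_field, banach} \<Rightarrow> 'v::ab_group_add \<Rightarrow> 'v" and E :: "'v set" +
  fixes P :: "('v \<Rightarrow> real) set"
  assumes seminorms: "p \<in> P \<Longrightarrow> seminorm_on smul E p"
    and nonempty: "P \<noteq> {}"
    and directed: "p \<in> P \<Longrightarrow> q \<in> P \<Longrightarrow> \<exists>s\<in>P. \<forall>x\<in>E. p x \<le> s x \<and> q x \<le> s x"
    and separating: "x \<in> E \<Longrightarrow> (\<And>p. p \<in> P \<Longrightarrow> p x = 0) \<Longrightarrow> x = 0"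
begin

abbreviation "T \<equiv> seminorm_topology E P"

definition "semiball p x e = {y \<in> E. p (y - x) < e}"

lemma semiball_subset: "semiball p x e \<subseteq> E"
  by (auto simp: semiball_def)

lemma semiball_in_semiball:
  assumes "p \<in> P" "x \<in> E" "y \<in> semiball p x e"
  shows "semiball p y (e - p (y - x)) \<subseteq> semiball p x e"
proof
  fix z assume z: "z \<in> semiball p y (e - p (y - x))"
  have "p (z - x) \<le> p (z - y) + p (y - x)"
    using seminorm_add[OF seminorms[OF assms(1)], of "z - y" "y - x"] z assms
    by (auto simp: semiball_def)
  then show "z \<in> semiball p x e" using z by (auto simp: semiball_def)
qed

lemma openin_T_iff:
  "openin T U \<longleftrightarrow> U \<subseteq> E \<and> (\<forall>x\<in>U. \<exists>p\<in>P. \<exists>e>0. semiball p x e \<subseteq> U)" (is "_ \<longleftrightarrow> ?R U")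
proof
  assume "openin T U"
  then have "generate_topology_on {{y \<in> E. p (y - x) < e} | p x e. p \<in> P \<and> x \<in> E \<and> 0 < e} U"
    by (simp add: seminorm_topology_def openin_topology_generated_by_iff)
  then show "?R U"
  proof induction
    case (Int a b)
    have "\<exists>p\<in>P. \<exists>e>0. semiball p x e \<subseteq> a \<inter> b" if x: "x \<in> a \<inter> b" for x
    proof -
      obtain p e where p: "p \<in> P" "0 < e" "semiball p x e \<subseteq> a" using Int x by blast
      obtain q d where q: "q \<in> P" "0 < d" "semiball q x d \<subseteq> b" using Int x by blast
      obtain s where s: "s \<in> P" "\<forall>x\<in>E. p x \<le> s x \<and> q x \<le> s x"
        using directed[OF p(1) q(1)] by blast
      have "x \<in> E" using x Int by auto
      then have "semiball s x (min e d) \<subseteq> semiball p x e \<inter> semiball q x d"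
        using s(2) by (force simp: semiball_def dest: bspec[of _ _ "_ - _"])
      then show ?thesis
        using p q s by (intro bexI[of _ s] exI[of _ "min e d"]) auto
    qed
    then show ?case using Int by auto
  next
    case (UN K)
    then show ?case by (meson Sup_le_iff UnionE Union_upper dual_order.trans)
  next
    case (Basis s)
    then obtain p x e where s: "s = semiball p x e" "p \<in> P" "x \<in> E" "0 < e"
      by (auto simp: semiball_def)
    have "\<exists>p\<in>P. \<exists>e>0. semiball p y e \<subseteq> s" if "y \<in> s" for y
      using semiball_in_semiball[OF s(2,3)] that s
      by (intro bexI[of _ p] exI[of _ "e - p (y - x)"]) (auto simp: semiball_def)
    then show ?case using s by (auto simp: semiball_def)
  qed auto
next
  assume R: "?R U"
  have basic: "openin T (semiball p x e)" if "p \<in> P" "x \<in> E" "0 < e" for p x e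
    unfolding seminorm_topology_def semiball_def
    by (rule topology_generated_by_Basis) (use that in blast)
  have "\<exists>V. openin T V \<and> x \<in> V \<and> V \<subseteq> U" if x: "x \<in> U" for x
  proof -
    obtain p e where "p \<in> P" "0 < e" "semiball p x e \<subseteq> U" using R x by blast
    moreover have "x \<in> E" using R x by auto
    moreover have "x \<in> semiball p x e"
      using calculation seminorm_zero[OF seminorms[of p]] by (simp add: semiball_def)
    ultimately show ?thesis using basic by blast
  qed
  then show "openin T U" using openin_subopen[of T U] by blast
qed

lemma openin_T_E:
  assumes "openin T U" "x \<in> U"
  obtains p e where "p \<in> P" "0 < e" "semiball p x e \<subseteq> U"
proof -
  from assms(1) have "\<forall>x\<in>U. \<exists>p\<in>P. \<exists>e>0. semiball p x e \<subseteq> U"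
    unfolding openin_T_iff by (rule conjunct2)
  from bspec[OF this assms(2)] show ?thesis using that by (elim bexE exE conjE)
qed

lemma openin_semiball:
  assumes p: "p \<in> P" "x \<in> E"
  shows "openin T (semiball p x e)"
  unfolding openin_T_iff
proof (intro conjI ballI)
  fix y assume y: "y \<in> semiball p x e"
  show "\<exists>q\<in>P. \<exists>d>0. semiball q y d \<subseteq> semiball p x e"
    using semiball_in_semiball[OF p y] p y
    by (intro bexI[of _ p] exI[of _ "e - p (y - x)"]) (auto simp: semiball_def)
qed (auto simp: semiball_def)

lemma topspace_T [simp]: "topspace T = E"
proof -
  have "openin T E" unfolding openin_T_iff using nonempty
    by (auto simp: semiball_def intro!: exI[of _ "1::real"])
  moreover have "topspace T \<subseteq> E" using openin_T_iff openin_topspace by blast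
  ultimately show ?thesis using openin_subset by blast
qed

lemma center_in_semiball: "p \<in> P \<Longrightarrow> x \<in> E \<Longrightarrow> 0 < e \<Longrightarrow> x \<in> semiball p x e"
  using seminorm_zero[OF seminorms[of p]] by (simp add: semiball_def)

lemma continuous_add: "continuous_map (prod_topology T T) T (\<lambda>(x, y). x + y)"
  unfolding continuous_map_def
proof (intro conjI allI impI)
  fix U assume U: "openin T U"
  show "openin (prod_topology T T)
      {z \<in> topspace (prod_topology T T). (case z of (x, y) \<Rightarrow> x + y) \<in> U}"
    unfolding openin_prod_topology_alt
  proof (intro allI impI)
    fix x y assume "(x, y) \<in> {z \<in> topspace (prod_topology T T). (case z of (x, y) \<Rightarrow> x + y) \<in> U}"
    then have xy: "x \<in> E" "y \<in> E" "x + y \<in> U" by auto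
    then obtain p e where p: "p \<in> P" "0 < e" "semiball p (x + y) e \<subseteq> U"
      using openin_T_E[OF U] by metis
    have "u + v \<in> U" if "u \<in> semiball p x (e/2)" "v \<in> semiball p y (e/2)" for u v
    proof -
      have "p ((u - x) + (v - y)) \<le> p (u - x) + p (v - y)"
        using that xy by (intro seminorm_add[OF seminorms[OF p(1)]]) (auto simp: semiball_def)
      then have "u + v \<in> semiball p (x + y) e"
        using that by (auto simp: semiball_def add_diff_add)
      then show ?thesis using p by blast
    qed
    then have "semiball p x (e/2) \<times> semiball p y (e/2) \<subseteq>
        {z \<in> topspace (prod_topology T T). (case z of (x, y) \<Rightarrow> x + y) \<in> U}"
      using semiball_subset[of p x "e/2"] semiball_subset[of p y "e/2"] by (auto simp del: less_divide_eq_numeral1)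
    moreover have "openin T (semiball p x (e/2))" "openin T (semiball p y (e/2))"
      "x \<in> semiball p x (e/2)" "y \<in> semiball p y (e/2)"
      using p xy by (auto intro!: openin_semiball center_in_semiball)
    ultimately show "\<exists>V W. openin T V \<and> openin T W \<and> x \<in> V \<and> y \<in> W \<and>
        V \<times> W \<subseteq> {z \<in> topspace (prod_topology T T). (case z of (x, y) \<Rightarrow> x + y) \<in> U}"
      by blast
  qed
qed auto

lemma continuous_smul: "continuous_map (prod_topology euclidean T) T (\<lambda>(c, x). smul c x)"
  unfolding continuous_map_def
proof (intro conjI allI impI)
  fix U assume U: "openin T U"
  show "openin (prod_topology euclidean T)
      {z \<in> topspace (prod_topology euclidean T). (case z of (c, x) \<Rightarrow> smul c x) \<in> U}"
    unfolding openin_prod_topology_alt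
  proof (intro allI impI)
    fix c x
    assume "(c, x) \<in> {z \<in> topspace (prod_topology euclidean T). (case z of (c, x) \<Rightarrow> smul c x) \<in> U}"
    then have x: "x \<in> E" "smul c x \<in> U" by auto
    then obtain p e where p: "p \<in> P" "0 < e" "semiball p (smul c x) e \<subseteq> U"
      using openin_T_E[OF U] by metis
    note sn = seminorms[OF p(1)]
    have px: "0 \<le> p x" using seminorm_nonneg[OF sn x(1)] .
    define d where "d = min 1 (e / (2 * (p x + 1)))"
    define \<epsilon> where "\<epsilon> = e / (2 * (norm c + 1))"
    have pos: "0 < d" "0 < \<epsilon>" using p px
      by (auto simp: d_def \<epsilon>_def intro!: divide_pos_pos mult_pos_pos add_nonneg_pos)
    have "smul b u \<in> U" if b: "b \<in> ball c d" and u: "u \<in> semiball p x \<epsilon>" for b u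
    proof -
      have uE: "u \<in> E" and pu: "p (u - x) < \<epsilon>" using u by (auto simp: semiball_def)
      have bc: "norm (b - c) < d" using b by (simp add: dist_norm norm_minus_commute)
      have "norm b \<le> norm c + 1"
        using bc norm_triangle_sub[of b c] by (simp add: d_def)
      then have 1: "norm b * p (u - x) < e / 2"
      proof -
        have "norm b * p (u - x) \<le> (norm c + 1) * p (u - x)"
          using seminorm_nonneg[OF sn, of "u - x"] uE x \<open>norm b \<le> norm c + 1\<close>
          by (intro mult_right_mono) auto
        also have "\<dots> < (norm c + 1) * \<epsilon>"
          using pu by (intro mult_strict_left_mono) (auto intro: add_nonneg_pos)
        also have "\<dots> = e / 2"
        proof -
          have "norm c + 1 \<noteq> 0" by (metis add_nonneg_pos less_numeral_extra(3) norm_ge_zero zero_less_one)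
          then show ?thesis by (simp add: \<epsilon>_def field_simps)
        qed
        finally show ?thesis .
      qed
      have 2: "norm (b - c) * p x \<le> e / 2"
      proof -
        have "norm (b - c) * p x \<le> (e / (2 * (p x + 1))) * (p x + 1)"
          using bc px p by (intro mult_mono) (auto simp: d_def)
        also have "\<dots> = e / 2" using px by (simp add: field_simps)
        finally show ?thesis .
      qed
      have "smul b u - smul c x = smul b (u - x) + smul (b - c) x"
        by (simp add: scale_right_diff_distrib scale_left_diff_distrib)
      then have "p (smul b u - smul c x) \<le> norm b * p (u - x) + norm (b - c) * p x"
        using seminorm_add[OF sn, of "smul b (u - x)" "smul (b - c) x"] uE x
        by (simp add: seminorm_smul[OF sn])
      then have "smul b u \<in> semiball p (smul c x) e"
        using 1 2 uE by (simp add: semiball_def)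
      then show ?thesis using p by blast
    qed
    then have "ball c d \<times> semiball p x \<epsilon> \<subseteq>
        {z \<in> topspace (prod_topology euclidean T). (case z of (c, x) \<Rightarrow> smul c x) \<in> U}"
      using semiball_subset[of p x \<epsilon>] by auto
    moreover have "openin euclidean (ball c d)" "openin T (semiball p x \<epsilon>)"
      "c \<in> ball c d" "x \<in> semiball p x \<epsilon>"
      using p x pos by (auto intro!: openin_semiball center_in_semiball)
    ultimately show "\<exists>V W. openin euclidean V \<and> openin T W \<and> c \<in> V \<and> x \<in> W \<and>
        V \<times> W \<subseteq> {z \<in> topspace (prod_topology euclidean T). (case z of (c, x) \<Rightarrow> smul c x) \<in> U}"
      by blast
  qed
qed auto

lemma Hausdorff_T: "Hausdorff_space T"
  unfolding Hausdorff_space_def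
proof (intro allI impI)
  fix x y assume "x \<in> topspace T \<and> y \<in> topspace T \<and> x \<noteq> y"
  then have xy: "x \<in> E" "y \<in> E" "x - y \<noteq> 0" by auto
  then obtain p where p: "p \<in> P" "p (x - y) \<noteq> 0" using separating[of "x - y"] by blast
  note sn = seminorms[OF p(1)]
  have pos: "0 < p (x - y)" using seminorm_nonneg[OF sn, of "x - y"] xy p by auto
  have "disjnt (semiball p x (p (x - y) / 2)) (semiball p y (p (x - y) / 2))"
  proof -
    have False if z: "z \<in> E" "p (z - x) < p (x - y) / 2" "p (z - y) < p (x - y) / 2" for z
      using seminorm_diff[OF sn, of "z - y" "z - x"] z xy by simp
    then show ?thesis by (auto simp: disjnt_def semiball_def)
  qed
  then show "\<exists>U V. openin T U \<and> openin T V \<and> x \<in> U \<and> y \<in> V \<and> disjnt U V"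
    using openin_semiball[OF p(1)] center_in_semiball[OF p(1)] xy pos
    by (metis half_gt_zero)
qed

lemma locally_convex: "locally_convex_space smul T"
proof -
  have "\<exists>V. openin T V \<and> 0 \<in> V \<and> V \<subseteq> U \<and>
           (\<forall>x\<in>V. \<forall>y\<in>V. \<forall>t\<in>{0..1::real}.
              smul (of_real (1 - t)) x + smul (of_real t) y \<in> V)" if "openin T U" "0 \<in> U" for U
  proof -
    obtain p e where p: "p \<in> P" "0 < e" "semiball p 0 e \<subseteq> U"
      using \<open>openin T U\<close> \<open>0 \<in> U\<close> by (rule openin_T_E)
    note sn = seminorms[OF p(1)]
    have "smul (of_real (1 - t)) x + smul (of_real t) y \<in> semiball p 0 e"
      if xy: "x \<in> semiball p 0 e" "y \<in> semiball p 0 e" and t: "t \<in> {0..1::real}" for x y t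
    proof -
      have E: "x \<in> E" "y \<in> E" and lt: "p x < e" "p y < e" using xy by (auto simp: semiball_def)
      have "p (smul (of_real (1 - t)) x + smul (of_real t) y)
          \<le> p (smul (of_real (1 - t)) x) + p (smul (of_real t) y)"
        using E by (intro seminorm_add[OF sn]) auto
      also have "\<dots> = (1 - t) * p x + t * p y"
        using t E by (simp only: seminorm_smul[OF sn] norm_of_real) simp
      also have "\<dots> < e" using convex_bound_lt[OF lt, of "1 - t" t] t by simp
      finally show ?thesis using E by (simp add: semiball_def)
    qed
    then show ?thesis
      using p openin_semiball[OF p(1), of 0 e] center_in_semiball[OF p(1), of 0 e]
      by (intro exI[of _ "semiball p 0 e"]) auto
  qed
  then show ?thesis
    unfolding locally_convex_space_def
    using continuous_add continuous_smul Hausdorff_T subspace_E vector_space_axioms by auto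
qed

lemma continuous_seminorm_bounded:
  assumes "continuous_seminorm smul T p"
  obtains q C where "q \<in> P" "0 < C" "\<And>x. x \<in> E \<Longrightarrow> p x \<le> C * q x"
proof -
  have p: "seminorm_on smul E p" and cont: "continuous_map T euclideanreal p"
    using assms by (auto simp: continuous_seminorm_def)
  have "openin T {x \<in> topspace T. p x \<in> {..<1}}"
    by (rule openin_continuous_map_preimage[OF cont]) auto
  moreover have "0 \<in> {x \<in> topspace T. p x \<in> {..<1}}"
    by (simp add: seminorm_zero[OF p])
  ultimately obtain q e where q: "q \<in> P" "0 < e" "semiball q 0 e \<subseteq> {x \<in> topspace T. p x \<in> {..<1}}"
    by (rule openin_T_E)
  note sn = seminorms[OF q(1)]
  have "p x \<le> (1 / e) * q x" if x: "x \<in> E" for x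
  proof (rule ccontr)
    assume "\<not> ?thesis"
    then have lt: "q x < e * p x" using q by (simp add: field_simps)
    then have pp: "0 < p x" using seminorm_nonneg[OF sn x] q by (metis order_le_less_trans zero_less_mult_pos)
    have "smul (of_real (1 / p x)) x \<in> semiball q 0 e"
      using x lt pp by (simp only: semiball_def mem_Collect_eq diff_zero seminorm_smul[OF sn x] norm_of_real)
        (simp add: field_simps)
    then have "p (smul (of_real (1 / p x)) x) < 1" using q by blast
    then show False using pp by (simp only: seminorm_smul[OF p x] norm_of_real) simp
  qed
  then show ?thesis using that[of q "1 / e"] q by auto
qed

lemma continuous_seminormI:
  assumes q: "q \<in> P" and K: "0 \<le> K"
  shows "continuous_seminorm smul T (\<lambda>x. K * q x)"
proof -
  note sn = seminorms[OF q]
  have "continuous_map T euclideanreal q"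
    unfolding continuous_map_def
  proof (intro conjI allI impI)
    fix U :: "real set" assume U: "openin euclideanreal U"
    show "openin T {x \<in> topspace T. q x \<in> U}"
      unfolding openin_T_iff
    proof (intro conjI ballI)
      fix x assume x: "x \<in> {x \<in> topspace T. q x \<in> U}"
      then have "open U" "q x \<in> U" using U by auto
      then obtain e where e: "0 < e" "ball (q x) e \<subseteq> U" by (rule openE)
      have "semiball q x e \<subseteq> {x \<in> topspace T. q x \<in> U}"
      proof
        fix y assume y: "y \<in> semiball q x e"
        then have "\<bar>q y - q x\<bar> < e"
          using seminorm_abs_diff[OF sn, of y x] x by (auto simp: semiball_def)
        then show "y \<in> {x \<in> topspace T. q x \<in> U}"
          using e y by (auto simp: semiball_def dist_real_def)
      qed
      then show "\<exists>p\<in>P. \<exists>e>0. semiball p x e \<subseteq> {x \<in> topspace T. q x \<in> U}" using q e by blast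
    qed auto
  qed auto
  then have "continuous_map T euclideanreal (\<lambda>x. K * q x)"
    by (intro continuous_map_real_mult continuous_map_const[THEN iffD2]) auto
  then show ?thesis using seminorm_scaled[OF sn K] by (simp add: continuous_seminorm_def)
qed

end

section \<open>Nuclear maps between completions\<close>

context carrier_space
begin

lemma local_banach_norm_tendsto:
  assumes p: "seminorm_on smul E p" and u: "u \<in> local_banach E p"
  shows "(\<lambda>i. p (u i)) \<longlonglongrightarrow> local_banach_norm p u"
proof -
  have "Cauchy (\<lambda>i. p (u i))"
  proof (rule metric_CauchyI)
    fix e :: real assume "0 < e"
    then obtain M where M: "\<forall>i\<ge>M. \<forall>j\<ge>M. p (u i - u j) < e"
      using u by (auto simp: local_banach_def)
    then show "\<exists>M. \<forall>m\<ge>M. \<forall>n\<ge>M. dist (p (u m)) (p (u n)) < e"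
      using seminorm_abs_diff[OF p] u unfolding local_banach_def dist_real_def
      by (intro exI[of _ M]) (blast intro: order_le_less_trans)
  qed
  then show ?thesis
    unfolding local_banach_norm_def using Cauchy_convergent convergent_LIMSEQ_iff by blast
qed

lemma local_banach_const: "seminorm_on smul E p \<Longrightarrow> x \<in> E \<Longrightarrow> (\<lambda>i. x) \<in> local_banach E p"
  by (auto simp: local_banach_def seminorm_zero)

lemma functional_Cauchy:
  assumes a: "linear_functional_on smul E a"
    and c: "\<And>x. x \<in> E \<Longrightarrow> norm (a x) \<le> c * q x"
    and q: "seminorm_on smul E q" and u: "u \<in> local_banach E q"
  shows "(\<lambda>i. a (u i)) \<longlonglongrightarrow> lim (\<lambda>i. a (u i))"
proof -
  have diff: "a (x - y) = a x - a y" if "x \<in> E" "y \<in> E" for x y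
  proof -
    have "a ((x - y) + y) = a (x - y) + a y" using a that unfolding linear_functional_on_def by blast
    then show ?thesis by simp
  qed
  have uE: "u i \<in> E" for i using u by (auto simp: local_banach_def)
  have "Cauchy (\<lambda>i. a (u i))"
  proof (rule metric_CauchyI)
    fix e :: real assume "0 < e"
    then have "0 < e / (\<bar>c\<bar> + 1)" by auto
    then obtain M where M: "\<forall>i\<ge>M. \<forall>j\<ge>M. q (u i - u j) < e / (\<bar>c\<bar> + 1)"
      using u unfolding local_banach_def by blast
    have "dist (a (u i)) (a (u j)) < e" if "i \<ge> M" "j \<ge> M" for i j
    proof -
      have "dist (a (u i)) (a (u j)) = norm (a (u i - u j))"
        by (simp add: dist_norm diff uE)
      also have "\<dots> \<le> c * q (u i - u j)" using uE by (intro c) auto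
      also have "\<dots> \<le> (\<bar>c\<bar> + 1) * q (u i - u j)"
        using seminorm_nonneg[OF q, of "u i - u j"] uE by (intro mult_right_mono) auto
      also have "\<dots> < (\<bar>c\<bar> + 1) * (e / (\<bar>c\<bar> + 1))"
        using M that by (intro mult_strict_left_mono) auto
      also have "\<dots> = e" by simp
      finally show ?thesis .
    qed
    then show "\<exists>M. \<forall>m\<ge>M. \<forall>n\<ge>M. dist (a (u m)) (a (u n)) < e" by blast
  qed
  then show ?thesis using Cauchy_convergent convergent_LIMSEQ_iff by blast
qed

lemma sum_apply: "(\<Sum>j\<in>J. F j) i = (\<Sum>j\<in>J. F j i)" for F :: "'j \<Rightarrow> 'i \<Rightarrow> 'a::comm_monoid_add"
  by (induction J rule: infinite_finite_induct) auto

text \<open>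
  The functionals extend to the completion by continuity. The representation persists because its
  remainders are bounded by a multiple of \<open>q\<close> uniformly in their length, so that convergence to \<open>0\<close> on the dense
  subspace carries over.
\<close>

lemma nuclear_map_local_banach:
  assumes p: "seminorm_on smul E p" and q: "seminorm_on smul E q"
    and pq: "\<And>x. x \<in> E \<Longrightarrow> p x \<le> q x"
    and nuc: "nuclear_map smul E q smul E p (\<lambda>x. x)"
  shows "nuclear_map (pointwise_scale smul) (local_banach E q) (local_banach_norm q)
           (pointwise_scale smul) (local_banach E p) (local_banach_norm p) (\<lambda>u. u)"
proof -
  obtain a c y where rep:
    "(\<forall>j. linear_functional_on smul E (a j)) \<and>
     (\<forall>j. 0 \<le> c j \<and> (\<forall>x\<in>E. norm (a j x) \<le> c j * q x)) \<and> (\<forall>j. y j \<in> E) \<and>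
     summable (\<lambda>j. c j * p (y j)) \<and>
     (\<forall>x\<in>E. (\<lambda>N. p (x - (\<Sum>j<N. smul (a j x) (y j)))) \<longlonglongrightarrow> 0)"
    using nuc unfolding nuclear_map_def by (elim exE) (rule that)
  have a: "linear_functional_on smul E (a j)" and c: "0 \<le> c j" "x \<in> E \<Longrightarrow> norm (a j x) \<le> c j * q x"
    and y: "y j \<in> E" and sm: "summable (\<lambda>j. c j * p (y j))"
    and lim0: "x \<in> E \<Longrightarrow> (\<lambda>N. p (x - (\<Sum>j<N. smul (a j x) (y j)))) \<longlonglongrightarrow> 0" for j x
    using rep by auto
  define A where "A j u = lim (\<lambda>i. a j (u i))" for j :: nat and u :: "nat \<Rightarrow> 'v"
  have A: "(\<lambda>i. a j (u i)) \<longlonglongrightarrow> A j u" if "u \<in> local_banach E q" for j u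
    unfolding A_def by (rule functional_Cauchy[OF a c(2) q that])
  have XE: "u i \<in> E" if "u \<in> local_banach E r" for u i r using that by (auto simp: local_banach_def)
  have aadd: "a j (x + z) = a j x + a j z" and asm: "a j (smul k x) = k * a j x"
    if "x \<in> E" "z \<in> E" for j x z k
    using a[of j] that by (auto simp: linear_functional_on_def)
  note asm = asm[OF _ E_closed(1)]
  have adiff: "a j (x - z) = a j x - a j z" if "x \<in> E" "z \<in> E" for j x z
    using aadd[of "x - z" z j] that by simp
  define S where "S = (\<Sum>j. c j * p (y j))"
  have term_nonneg: "0 \<le> c j * p (y j)" for j using c(1) seminorm_nonneg[OF p y] by auto
  have partial_le_S: "(\<Sum>j<N. c j * p (y j)) \<le> S" for N
    unfolding S_def by (rule sum_le_suminf[OF sm]) (use term_nonneg in auto)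
  have S0: "0 \<le> S" using partial_le_S[of 0] by simp
  define R where "R N x = x - (\<Sum>j<N. smul (a j x) (y j))" for N x
  have RE: "R N x \<in> E" if "x \<in> E" for N x using that y by (auto simp: R_def)
  have Rdiff: "R N (x - z) = R N x - R N z" if "x \<in> E" "z \<in> E" for N x z
    using that by (simp add: R_def adiff scale_left_diff_distrib sum_subtractf)
  have sum_le: "p (\<Sum>j<N. smul (k j) (y j)) \<le> (\<Sum>j<N. norm (k j) * p (y j))" for k N
    using seminorm_sum[OF p, of "{..<N}" "\<lambda>j. smul (k j) (y j)"] y
    by (simp add: seminorm_smul[OF p])
  have Rbound: "p (R N x) \<le> (1 + S) * q x" if x: "x \<in> E" for N x
  proof -
    have "p (R N x) \<le> p x + p (\<Sum>j<N. smul (a j x) (y j))"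
      unfolding R_def using x y by (intro seminorm_diff[OF p]) auto
    also have "p (\<Sum>j<N. smul (a j x) (y j)) \<le> (\<Sum>j<N. norm (a j x) * p (y j))" by (rule sum_le)
    also have "\<dots> \<le> (\<Sum>j<N. (c j * q x) * p (y j))"
      using c x seminorm_nonneg[OF p y] by (intro sum_mono mult_right_mono) auto
    also have "\<dots> = (\<Sum>j<N. c j * p (y j)) * q x" by (simp add: sum_distrib_left mult.commute mult.left_commute)
    also have "\<dots> \<le> S * q x"
      using partial_le_S seminorm_nonneg[OF q x] by (intro mult_right_mono) auto
    finally show ?thesis using pq[OF x] by (simp add: algebra_simps)
  qed
  show ?thesis
    unfolding nuclear_map_def
  proof (intro exI[of _ A] exI[of _ c] exI[of _ "\<lambda>j i. y j"] conjI allI ballI)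
    fix j
    show "linear_functional_on (pointwise_scale smul) (local_banach E q) (A j)"
      unfolding linear_functional_on_def
    proof (intro conjI ballI allI)
      fix u v assume u: "u \<in> local_banach E q" and v: "v \<in> local_banach E q"
      have "(\<lambda>i. a j ((u + v) i)) = (\<lambda>i. a j (u i) + a j (v i))"
        using aadd XE[OF u] XE[OF v] by auto
      then show "A j (u + v) = A j u + A j v"
        unfolding A_def[of j "u + v"] using limI[OF tendsto_add[OF A[OF u, of j] A[OF v, of j]]] by simp
    next
      fix k u assume u: "u \<in> local_banach E q"
      have "(\<lambda>i. a j (pointwise_scale smul k u i)) = (\<lambda>i. k * a j (u i))"
        using asm XE[OF u] by (auto simp: pointwise_scale_def)
      then show "A j (pointwise_scale smul k u) = k * A j u"
        unfolding A_def[of j "pointwise_scale smul k u"]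
        using limI[OF tendsto_mult_left[OF A[OF u, of j], of k]] by simp
    qed
    show "0 \<le> c j" by (rule c)
    show "(\<lambda>i. y j) \<in> local_banach E p" by (rule local_banach_const[OF p y])
  next
    fix j u assume u: "u \<in> local_banach E q"
    show "norm (A j u) \<le> c j * local_banach_norm q u"
    proof (rule LIMSEQ_le[OF tendsto_norm[OF A[OF u]]])
      show "(\<lambda>i. c j * q (u i)) \<longlonglongrightarrow> c j * local_banach_norm q u"
        by (intro tendsto_mult_left local_banach_norm_tendsto[OF q u])
      show "\<exists>N. \<forall>n\<ge>N. norm (a j (u n)) \<le> c j * q (u n)" using c(2) XE[OF u] by blast
    qed
  next
    have "local_banach_norm p (\<lambda>i. x) = p x" for x
      by (simp add: local_banach_norm_def)
    then show "summable (\<lambda>j. c j * local_banach_norm p (\<lambda>i. y j))" using sm by simp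
  next
    fix u assume u: "u \<in> local_banach E q"
    define w where "w N = u - (\<Sum>j<N. pointwise_scale smul (A j u) (\<lambda>i. y j))" for N
    have w_app: "w N i = u i - (\<Sum>j<N. smul (A j u) (y j))" for N i
      by (simp add: w_def pointwise_scale_def sum_apply)
    have wX: "w N \<in> local_banach E p" for N
    proof -
      have less: "p (u i - u k) < e" if "q (u i - u k) < e" for i k e
        using pq[of "u i - u k"] XE[OF u] that by force
      have "w N i \<in> E" for i using XE[OF u] y by (simp add: w_app)
      moreover have "\<exists>M. \<forall>i\<ge>M. \<forall>k\<ge>M. p (w N i - w N k) < e" if e: "0 < e" for e :: real
      proof -
        obtain M where "\<forall>i\<ge>M. \<forall>k\<ge>M. q (u i - u k) < e"
          using u e unfolding local_banach_def by blast
        then show ?thesis using less by (intro exI[of _ M]) (simp add: w_app)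
      qed
      ultimately show ?thesis by (simp add: local_banach_def)
    qed
    show "(\<lambda>N. local_banach_norm p (w N)) \<longlonglongrightarrow> 0"
      unfolding LIMSEQ_iff
    proof (intro allI impI)
      fix e :: real assume e: "0 < e"
      \<comment> \<open>The three parts into which \<open>w N i\<close> is split below contribute \<open>\<delta>\<close>, \<open>(1 + S) * \<delta>\<close> and \<open>S * \<delta>\<close>.\<close>
      define \<delta> where "\<delta> = e / (2 * (2 + 2 * S))"
      have \<delta>: "0 < \<delta>" using e S0 by (auto simp: \<delta>_def intro!: divide_pos_pos)
      obtain i0 where i0: "\<And>i k. i \<ge> i0 \<Longrightarrow> k \<ge> i0 \<Longrightarrow> q (u i - u k) < \<delta>"
        using u \<delta> unfolding local_banach_def by blast
      have "(\<lambda>N. p (R N (u i0))) \<longlonglongrightarrow> 0" using lim0[OF XE[OF u]] by (simp add: R_def)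
      then obtain N0 where N0: "\<And>N. N \<ge> N0 \<Longrightarrow> p (R N (u i0)) < \<delta>"
        using order_tendstoD(2)[of _ 0 sequentially \<delta>] \<delta> by (auto simp: eventually_sequentially)
      have est: "norm (local_banach_norm p (w N) - 0) < e" if N: "N \<ge> N0" for N
      proof -
        have "p (w N i) \<le> \<delta> * (2 + 2 * S)" if i: "i \<ge> i0" for i
        proof -
          have Ac: "norm (a j (u i) - A j u) \<le> c j * \<delta>" for j
          proof (rule LIMSEQ_le_const2[OF tendsto_norm[OF tendsto_diff[OF tendsto_const A[OF u]]]])
            show "\<exists>M. \<forall>n\<ge>M. norm (a j (u i) - a j (u n)) \<le> c j * \<delta>"
            proof (intro exI[of _ i0] allI impI)
              fix n assume n: "i0 \<le> n"
              have "norm (a j (u i) - a j (u n)) = norm (a j (u i - u n))"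
                by (simp add: adiff XE[OF u])
              also have "\<dots> \<le> c j * q (u i - u n)" using XE[OF u] by (intro c) auto
              also have "\<dots> \<le> c j * \<delta>"
                using i0[OF i n] c(1)[of j] by (intro mult_left_mono) auto
              finally show "norm (a j (u i) - a j (u n)) \<le> c j * \<delta>" .
            qed
          qed
          have uE: "u i \<in> E" "u i0 \<in> E" using XE[OF u] by auto
          have "w N i = R N (u i0) + R N (u i - u i0) + (\<Sum>j<N. smul (a j (u i) - A j u) (y j))"
            by (simp add: w_app Rdiff uE)
              (simp add: R_def scale_left_diff_distrib sum_subtractf)
          then have "p (w N i) \<le> p (R N (u i0)) + p (R N (u i - u i0))
              + p (\<Sum>j<N. smul (a j (u i) - A j u) (y j))"
            using seminorm_add[OF p, of "R N (u i0) + R N (u i - u i0)"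
                "\<Sum>j<N. smul (a j (u i) - A j u) (y j)"]
              seminorm_add[OF p, of "R N (u i0)" "R N (u i - u i0)"] RE uE y
            by force
          moreover have "p (R N (u i - u i0)) \<le> (1 + S) * \<delta>"
          proof -
            have "(1 + S) * q (u i - u i0) \<le> (1 + S) * \<delta>"
              using i0[OF i order_refl] S0 by (intro mult_left_mono) auto
            then show ?thesis using Rbound[of "u i - u i0" N] uE by fastforce
          qed
          moreover have "p (\<Sum>j<N. smul (a j (u i) - A j u) (y j)) \<le> S * \<delta>"
          proof -
            have "p (\<Sum>j<N. smul (a j (u i) - A j u) (y j))
                \<le> (\<Sum>j<N. norm (a j (u i) - A j u) * p (y j))" by (rule sum_le)
            also have "\<dots> \<le> (\<Sum>j<N. (c j * \<delta>) * p (y j))"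
              using Ac seminorm_nonneg[OF p y] by (intro sum_mono mult_right_mono) auto
            also have "\<dots> = (\<Sum>j<N. c j * p (y j)) * \<delta>"
              by (simp add: sum_distrib_left mult.commute mult.left_commute)
            also have "\<dots> \<le> S * \<delta>" using partial_le_S \<delta> by (intro mult_right_mono) auto
            finally show ?thesis .
          qed
          ultimately show ?thesis using N0[OF N] by (simp add: algebra_simps)
        qed
        then have "local_banach_norm p (w N) \<le> \<delta> * (2 + 2 * S)"
          by (intro LIMSEQ_le_const2[OF local_banach_norm_tendsto[OF p wX]]) blast
        also have "\<dots> = e / 2" using S0 by (simp add: \<delta>_def divide_simps)
        also have "\<dots> < e" using e by simp
        finally have "local_banach_norm p (w N) < e" .
        moreover have "0 \<le> local_banach_norm p (w N)"
          using seminorm_nonneg[OF p XE[OF wX]]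
          by (intro LIMSEQ_le_const[OF local_banach_norm_tendsto[OF p wX]]) blast
        ultimately show ?thesis by simp
      qed
      then show "\<exists>no. \<forall>N\<ge>no. norm (local_banach_norm p (w N) - 0) < e" by blast
    qed
  qed
qed

end

section \<open>Hermitian forms and orthonormal sequences\<close>

text \<open>
  The scalar fields \<open>\<real>\<close> and \<open>\<complex>\<close> are treated together by means of an abstract conjugation.
\<close>

locale conjugation =
  fixes cj :: "'k::real_normed_field \<Rightarrow> 'k"
  assumes cj_add: "cj (x + y) = cj x + cj y"
    and cj_mult: "cj (x * y) = cj x * cj y"
    and cj_cj [simp]: "cj (cj x) = x"
    and mult_cj: "x * cj x = of_real ((norm x)\<^sup>2)"
begin

lemma cj_0 [simp]: "cj 0 = 0"
  using cj_add[of 0 0] by simp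

lemma cj_sum: "cj (\<Sum>i\<in>I. f i) = (\<Sum>i\<in>I. cj (f i))"
  by (induction I rule: infinite_finite_induct) (auto simp: cj_add)

lemma norm_cj [simp]: "norm (cj x) = norm x"
proof (cases "x = 0")
  case False
  have "norm (x * cj x) = norm (of_real ((norm x)\<^sup>2) :: 'k)" by (simp only: mult_cj)
  then have "norm x * norm (cj x) = norm x * norm x" by (simp add: norm_mult power2_eq_square)
  then show ?thesis using False by simp
qed simp

lemma cj_of_real [simp]: "cj (of_real t) = of_real t"
proof (cases "t = 0")
  case False
  have "of_real t * cj (of_real t) = of_real t * (of_real t :: 'k)"
    by (simp only: mult_cj norm_of_real power2_abs) (simp add: power2_eq_square)
  then show ?thesis using False by simp
qed simp

lemma bounded_linear_cj: "bounded_linear cj"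
proof (rule bounded_linear_intro[where K = 1])
  show "cj (r *\<^sub>R x) = r *\<^sub>R cj x" for r x by (simp add: scaleR_conv_of_real cj_mult)
qed (auto simp: cj_add)

end

locale hermitian_carrier = carrier_space smul E + conjugation cj
  for smul :: "'k::{real_normed_field, banach} \<Rightarrow> 'v::ab_group_add \<Rightarrow> 'v" and E :: "'v set"
    and cj :: "'k \<Rightarrow> 'k"
begin

definition hermitian_form :: "('v \<Rightarrow> 'v \<Rightarrow> 'k) \<Rightarrow> ('v \<Rightarrow> real) \<Rightarrow> bool" where
  "hermitian_form B h \<longleftrightarrow>
     (\<forall>x\<in>E. \<forall>y\<in>E. \<forall>z\<in>E. B (x + y) z = B x z + B y z) \<and>
     (\<forall>c. \<forall>x\<in>E. \<forall>z\<in>E. B (smul c x) z = c * B x z) \<and>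
     (\<forall>x\<in>E. \<forall>y\<in>E. B y x = cj (B x y)) \<and>
     (\<forall>x\<in>E. 0 \<le> h x \<and> B x x = of_real ((h x)\<^sup>2))"

lemma hermitian_form_facts:
  assumes "hermitian_form B h"
  shows form_add: "x \<in> E \<Longrightarrow> y \<in> E \<Longrightarrow> z \<in> E \<Longrightarrow> B (x + y) z = B x z + B y z"
    and form_smul: "x \<in> E \<Longrightarrow> z \<in> E \<Longrightarrow> B (smul c x) z = c * B x z"
    and form_cj: "x \<in> E \<Longrightarrow> y \<in> E \<Longrightarrow> cj (B x y) = B y x"
    and form_nonneg: "x \<in> E \<Longrightarrow> 0 \<le> h x"
    and form_self: "x \<in> E \<Longrightarrow> B x x = of_real ((h x)\<^sup>2)"
    and form_add_right: "x \<in> E \<Longrightarrow> y \<in> E \<Longrightarrow> z \<in> E \<Longrightarrow> B z (x + y) = B z x + B z y"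
    and form_smul_right: "x \<in> E \<Longrightarrow> z \<in> E \<Longrightarrow> B z (smul c x) = cj c * B z x"
    and form_diff: "x \<in> E \<Longrightarrow> y \<in> E \<Longrightarrow> z \<in> E \<Longrightarrow> B (x - y) z = B x z - B y z"
    and form_diff_right: "x \<in> E \<Longrightarrow> y \<in> E \<Longrightarrow> z \<in> E \<Longrightarrow> B z (x - y) = B z x - B z y"
    and form_zero: "z \<in> E \<Longrightarrow> B 0 z = 0"
proof -
  have "\<forall>x\<in>E. \<forall>y\<in>E. \<forall>z\<in>E. B (x + y) z = B x z + B y z"
    using assms unfolding hermitian_form_def by (elim conjE)
  then show add: "x \<in> E \<Longrightarrow> y \<in> E \<Longrightarrow> z \<in> E \<Longrightarrow> B (x + y) z = B x z + B y z" for x y z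
    by simp
  have "\<forall>c. \<forall>x\<in>E. \<forall>z\<in>E. B (smul c x) z = c * B x z"
    using assms unfolding hermitian_form_def by (elim conjE)
  then show sm: "x \<in> E \<Longrightarrow> z \<in> E \<Longrightarrow> B (smul c x) z = c * B x z" for x z c
    by simp
  have "\<forall>x\<in>E. \<forall>y\<in>E. B y x = cj (B x y)"
    using assms unfolding hermitian_form_def by (elim conjE)
  note cjB = this[rule_format]
  show "x \<in> E \<Longrightarrow> y \<in> E \<Longrightarrow> cj (B x y) = B y x" for x y using cjB[of x y] by simp
  have "\<forall>x\<in>E. 0 \<le> h x \<and> B x x = of_real ((h x)\<^sup>2)"
    using assms unfolding hermitian_form_def by (elim conjE)
  then show "x \<in> E \<Longrightarrow> 0 \<le> h x" and "x \<in> E \<Longrightarrow> B x x = of_real ((h x)\<^sup>2)" for x by auto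
  show addr: "x \<in> E \<Longrightarrow> y \<in> E \<Longrightarrow> z \<in> E \<Longrightarrow> B z (x + y) = B z x + B z y" for x y z
    using add[of x y z] cjB[of "x + y" z] cjB[of x z] cjB[of y z] by (simp add: cj_add)
  show "x \<in> E \<Longrightarrow> z \<in> E \<Longrightarrow> B z (smul c x) = cj c * B z x" for x z c
    using sm[of x z c] cjB[of "smul c x" z] cjB[of x z] by (simp add: cj_mult)
  show "x \<in> E \<Longrightarrow> y \<in> E \<Longrightarrow> z \<in> E \<Longrightarrow> B (x - y) z = B x z - B y z" for x y z
    using add[of "x - y" y z] by simp
  show "x \<in> E \<Longrightarrow> y \<in> E \<Longrightarrow> z \<in> E \<Longrightarrow> B z (x - y) = B z x - B z y" for x y z
    using addr[of "x - y" y z] by simp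
  show "z \<in> E \<Longrightarrow> B 0 z = 0" for z using sm[of 0 z 0] by simp
qed

lemma form_sum:
  assumes "hermitian_form B h" "\<And>i. i \<in> I \<Longrightarrow> x i \<in> E" "z \<in> E"
  shows "B (\<Sum>i\<in>I. x i) z = (\<Sum>i\<in>I. B (x i) z)"
  using assms(2)
  by (induction I rule: infinite_finite_induct)
    (auto simp: form_zero[OF assms(1,3)] form_add[OF assms(1)] assms(3))

lemma pythagoras:
  assumes H: "hermitian_form B h" and x: "x \<in> E" "y \<in> E" and orth: "B x y = 0"
  shows "(h (x + y))\<^sup>2 = (h x)\<^sup>2 + (h y)\<^sup>2"
proof -
  have "B y x = 0" using form_cj[OF H x] orth by simp
  then have "B (x + y) (x + y) = B x x + B y y"
    using x orth by (simp add: form_add[OF H] form_add_right[OF H])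
  then have "(of_real ((h (x + y))\<^sup>2) :: 'k) = of_real ((h x)\<^sup>2 + (h y)\<^sup>2)"
    using x by (simp only: form_self[OF H] E_closed of_real_add)
  then show ?thesis by (simp only: of_real_eq_iff)
qed

lemma form_norm_smul:
  assumes H: "hermitian_form B h" and x: "x \<in> E"
  shows "h (smul c x) = norm c * h x"
proof -
  have "(of_real ((h (smul c x))\<^sup>2) :: 'k) = c * (cj c * B x x)"
    using x by (simp only: form_self[OF H, symmetric] E_closed)
      (simp add: form_smul[OF H] form_smul_right[OF H])
  also have "\<dots> = of_real ((norm c * h x)\<^sup>2)"
    using x by (simp only: mult.assoc[symmetric] mult_cj form_self[OF H] of_real_mult[symmetric] power_mult_distrib)
  finally have "(h (smul c x))\<^sup>2 = (norm c * h x)\<^sup>2" by (simp only: of_real_eq_iff)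
  then show ?thesis using form_nonneg[OF H] x by (simp add: power2_eq_iff_nonneg)
qed

lemma form_Cauchy_Schwarz:
  assumes H: "hermitian_form B h" and x: "x \<in> E" "y \<in> E"
  shows "norm (B x y) \<le> h x * h y"
proof (cases "h y = 0")
  case False
  define c where "c = B x y / of_real ((h y)\<^sup>2)"
  have z: "B (x - smul c y) (smul c y) = 0"
    using x False by (simp add: form_diff[OF H] form_smul[OF H] form_smul_right[OF H] form_self[OF H] c_def)
  have "(h x)\<^sup>2 = (h (x - smul c y))\<^sup>2 + (h (smul c y))\<^sup>2"
    using pythagoras[OF H _ _ z] x by simp
  then have "(norm c * h y)\<^sup>2 \<le> (h x)\<^sup>2" by (simp add: form_norm_smul[OF H x(2)])
  then have "norm c * h y \<le> h x" using form_nonneg[OF H x(1)] by (rule power2_le_imp_le)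
  moreover have "norm c = norm (B x y) / (h y)\<^sup>2" by (simp add: c_def norm_divide norm_power)
  ultimately show ?thesis using False form_nonneg[OF H x(2)]
    by (simp add: power2_eq_square field_simps)
next
  case True
  \<comment> \<open>As \<open>h y = 0\<close>, the square of \<open>h (x - t * B x y * y)\<close> is affine in \<open>t\<close>.\<close>
  have le: "2 * t * (norm (B x y))\<^sup>2 \<le> (h x)\<^sup>2" for t
  proof -
    define c where "c = of_real t * B x y"
    have yx: "B y x = cj (B x y)" using form_cj[OF H x] by simp
    have "(of_real ((h (x - smul c y))\<^sup>2) :: 'k) = B (x - smul c y) (x - smul c y)"
      using x by (simp only: form_self[OF H] E_closed)
    also have "\<dots> = B x x - cj c * B x y - c * B y x + c * cj c * B y y"
      using x by (simp add: form_diff[OF H] form_diff_right[OF H] form_smul[OF H] form_smul_right[OF H] algebra_simps)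
    also have "\<dots> = B x x - of_real (2 * t) * (B x y * cj (B x y))"
      using x True by (simp add: form_self[OF H x(2)] yx c_def cj_mult algebra_simps)
    also have "\<dots> = of_real ((h x)\<^sup>2 - 2 * t * (norm (B x y))\<^sup>2)"
      by (simp only: mult_cj form_self[OF H x(1)] of_real_diff of_real_mult)
    finally have "(h (x - smul c y))\<^sup>2 = (h x)\<^sup>2 - 2 * t * (norm (B x y))\<^sup>2"
      by (simp only: of_real_eq_iff)
    then show ?thesis using zero_le_power2[of "h (x - smul c y)"] by linarith
  qed
  have "norm (B x y) = 0"
  proof (rule ccontr)
    assume nz: "norm (B x y) \<noteq> 0"
    show False using le[of "((h x)\<^sup>2 + 1) / (2 * (norm (B x y))\<^sup>2)"] nz by simp
  qed
  then show ?thesis using True by simp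
qed

lemma form_seminorm:
  assumes H: "hermitian_form B h"
  shows "seminorm_on smul E h"
  unfolding seminorm_on_def
proof (intro conjI ballI allI)
  fix x y assume x: "x \<in> E" "y \<in> E"
  have "(of_real ((h (x + y))\<^sup>2) :: 'k) = B x x + B x y + B y x + B y y"
    using x by (simp only: form_self[OF H, symmetric] E_closed)
      (simp add: form_add[OF H] form_add_right[OF H] algebra_simps)
  then have "(h (x + y))\<^sup>2 = norm (B x x + B x y + B y x + B y y)"
    by (metis abs_power2 norm_of_real)
  also have "\<dots> \<le> norm (B x x) + norm (B x y) + norm (B y x) + norm (B y y)"
    by (intro order_trans[OF norm_triangle_ineq] add_mono order_refl)
  also have "\<dots> \<le> (h x)\<^sup>2 + h x * h y + h y * h x + (h y)\<^sup>2"
    using form_Cauchy_Schwarz[OF H] x by (intro add_mono) (auto simp: form_self[OF H] norm_power)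
  also have "\<dots> = (h x + h y)\<^sup>2" by (simp add: power2_eq_square algebra_simps)
  finally show "h (x + y) \<le> h x + h y"
    using form_nonneg[OF H] x by (meson add_nonneg_nonneg power2_le_imp_le)
qed (use form_nonneg[OF H] form_norm_smul[OF H] in auto)

text \<open>
  Vectors of norm \<open>0\<close> are admitted, so that finite orthonormal systems are padded to sequences and
  the Gram-Schmidt process never stops.
\<close>

definition orthonormal :: "('v \<Rightarrow> 'v \<Rightarrow> 'k) \<Rightarrow> ('v \<Rightarrow> real) \<Rightarrow> (nat \<Rightarrow> 'v) \<Rightarrow> bool" where
  "orthonormal B h e \<longleftrightarrow>
     (\<forall>i. e i \<in> E \<and> h (e i) \<in> {0, 1}) \<and> (\<forall>i j. i \<noteq> j \<longrightarrow> B (e i) (e j) = 0)"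

definition projection :: "('v \<Rightarrow> 'v \<Rightarrow> 'k) \<Rightarrow> (nat \<Rightarrow> 'v) \<Rightarrow> nat \<Rightarrow> 'v \<Rightarrow> 'v" where
  "projection B e N x = (\<Sum>i<N. smul (B x (e i)) (e i))"

lemma projection_closed:
  "orthonormal B h e \<Longrightarrow> projection B e N x \<in> E"
  by (auto simp: projection_def orthonormal_def)

lemma combination_norm:
  assumes H: "hermitian_form B h" and e: "orthonormal B h e"
  shows "(h (\<Sum>i<N. smul (c i) (e i)))\<^sup>2 = (\<Sum>i<N. (norm (c i))\<^sup>2 * (h (e i))\<^sup>2)"
proof (induction N)
  case 0
  show ?case by (simp add: seminorm_zero[OF form_seminorm[OF H]])
next
  case (Suc N)
  have E: "e i \<in> E" for i using e by (simp add: orthonormal_def)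
  have "B (\<Sum>i<N. smul (c i) (e i)) (smul (c N) (e N)) = 0"
    using e E by (subst form_sum[OF H])
      (auto simp: form_smul[OF H] form_smul_right[OF H] orthonormal_def)
  then show ?case
    using E by (simp add: pythagoras[OF H] Suc form_norm_smul[OF H] power_mult_distrib)
qed

lemma projection_orthogonal:
  assumes H: "hermitian_form B h" and e: "orthonormal B h e" and x: "x \<in> E" and j: "j < N"
  shows "B (x - projection B e N x) (e j) = 0"
proof -
  have E: "e i \<in> E" for i using e by (simp add: orthonormal_def)
  have "B (projection B e N x) (e j) = (\<Sum>i<N. B x (e i) * B (e i) (e j))"
    unfolding projection_def using E by (subst form_sum[OF H]) (auto simp: form_smul[OF H])
  also have "\<dots> = (\<Sum>i<N. if i = j then B x (e j) * B (e j) (e j) else 0)"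
    using e by (intro sum.cong) (auto simp: orthonormal_def)
  also have "\<dots> = B x (e j) * of_real ((h (e j))\<^sup>2)"
    using j by (simp add: form_self[OF H E])
  also have "\<dots> = B x (e j)"
  proof (cases "h (e j) = 0")
    case True
    then show ?thesis using form_Cauchy_Schwarz[OF H x E, of j] by simp
  next
    case False
    then have "h (e j) = 1" using e by (auto simp: orthonormal_def)
    then show ?thesis by simp
  qed
  finally show ?thesis using projection_closed[OF e] E x by (simp add: form_diff[OF H])
qed

lemma projection_split:
  assumes H: "hermitian_form B h" and e: "orthonormal B h e" and x: "x \<in> E"
  shows "(h x)\<^sup>2 = (h (x - projection B e N x))\<^sup>2 + (h (projection B e N x))\<^sup>2"
proof -
  have E: "e i \<in> E" for i using e by (simp add: orthonormal_def)
  note P = projection_closed[OF e, of N x]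
  have "B (projection B e N x) (x - projection B e N x) = 0"
  proof -
    have "B (e i) (x - projection B e N x) = 0" if "i < N" for i
      using projection_orthogonal[OF H e x that] form_cj[OF H _ E, of "x - projection B e N x" i] P x
      by simp
    then show ?thesis using E P x
      by (subst (1) projection_def, subst form_sum[OF H]) (auto simp: form_smul[OF H])
  qed
  then show ?thesis using pythagoras[OF H P, of "x - projection B e N x"] P x by simp
qed

lemma residual_norm:
  assumes H: "hermitian_form B h" and e: "orthonormal B h e" and x: "x \<in> E"
  shows "(h (x - projection B e N x))\<^sup>2 = (h x)\<^sup>2 - (\<Sum>i<N. (norm (B x (e i)))\<^sup>2)"
proof -
  have E: "e i \<in> E" for i using e by (simp add: orthonormal_def)
  have eq: "(norm (B x (e i)))\<^sup>2 * (h (e i))\<^sup>2 = (norm (B x (e i)))\<^sup>2" for i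
  proof (cases "h (e i) = 0")
    case True
    then show ?thesis using form_Cauchy_Schwarz[OF H x E, of i] by simp
  next
    case False
    then have "h (e i) = 1" using e by (auto simp: orthonormal_def)
    then show ?thesis by simp
  qed
  have "(h (projection B e N x))\<^sup>2 = (\<Sum>i<N. (norm (B x (e i)))\<^sup>2)"
    unfolding projection_def by (simp only: combination_norm[OF H e] eq)
  then show ?thesis using projection_split[OF H e x, of N] by simp
qed

lemma bessel:
  assumes "hermitian_form B h" and "orthonormal B h e" and "x \<in> E"
  shows "(\<Sum>i<N. (norm (B x (e i)))\<^sup>2) \<le> (h x)\<^sup>2"
  using residual_norm[OF assms, of N] zero_le_power2[of "h (x - projection B e N x)"] by linarith

text \<open>Evaluating the functional at the conjugate linear combination of its own values.\<close>

lemma bessel_functional: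
  assumes H: "hermitian_form B h" and e: "orthonormal B h e"
    and a: "linear_functional_on smul E a" and K: "0 \<le> K" "\<And>x. x \<in> E \<Longrightarrow> norm (a x) \<le> K * h x"
  shows "(\<Sum>i<N. (norm (a (e i)))\<^sup>2) \<le> K\<^sup>2"
proof -
  have E: "e i \<in> E" for i using e by (simp add: orthonormal_def)
  define s where "s = (\<Sum>i<N. (norm (a (e i)))\<^sup>2)"
  define f where "f = (\<Sum>i<N. smul (cj (a (e i))) (e i))"
  have fE: "f \<in> E" using E by (auto simp: f_def)
  have "a (\<Sum>i<n. smul (cj (a (e i))) (e i)) = of_real (\<Sum>i<n. (norm (a (e i)))\<^sup>2)" for n
  proof (induction n)
    case 0
    have "a (smul 0 0) = 0 * a 0" using a E_closed(1) unfolding linear_functional_on_def by blast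
    then show ?case by simp
  next
    case (Suc n)
    have "a ((\<Sum>i<n. smul (cj (a (e i))) (e i)) + smul (cj (a (e n))) (e n))
        = a (\<Sum>i<n. smul (cj (a (e i))) (e i)) + cj (a (e n)) * a (e n)"
      using a E by (simp add: linear_functional_on_def)
    then show ?case using mult_cj[of "a (e n)"] Suc by (simp add: mult.commute)
  qed
  then have af: "norm (a f) = s"
    unfolding f_def s_def by (simp only: norm_of_real) (simp add: sum_nonneg)
  have "(h f)\<^sup>2 = (\<Sum>i<N. (norm (a (e i)))\<^sup>2 * (h (e i))\<^sup>2)"
    unfolding f_def by (subst combination_norm[OF H e]) simp
  also have "\<dots> \<le> s"
    unfolding s_def
  proof (rule sum_mono)
    fix i have "h (e i) = 0 \<or> h (e i) = 1" using e by (auto simp: orthonormal_def)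
    then show "(norm (a (e i)))\<^sup>2 * (h (e i))\<^sup>2 \<le> (norm (a (e i)))\<^sup>2" by auto
  qed
  finally have hf: "(h f)\<^sup>2 \<le> s" .
  have "s\<^sup>2 \<le> (K * h f)\<^sup>2" using K(2)[OF fE] af by (intro power_mono) (auto simp: s_def sum_nonneg)
  also have "\<dots> \<le> K\<^sup>2 * s" using hf by (simp add: power_mult_distrib mult_left_mono)
  finally have "s * s \<le> K\<^sup>2 * s" by (simp add: power2_eq_square)
  moreover have "0 \<le> s" by (simp add: s_def sum_nonneg)
  ultimately have "s \<le> K\<^sup>2" by (cases "s = 0") auto
  then show ?thesis by (simp add: s_def)
qed

lemma residual_le:
  assumes H: "hermitian_form B h" and e: "orthonormal B h e" and x: "x \<in> E"
  shows "h (x - projection B e N x) \<le> h x"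
proof (rule power2_le_imp_le)
  show "(h (x - projection B e N x))\<^sup>2 \<le> (h x)\<^sup>2"
    using residual_norm[OF assms, of N] by (simp add: sum_nonneg)
qed (rule form_nonneg[OF H x])

lemma residual_antimono:
  assumes H: "hermitian_form B h" and e: "orthonormal B h e" and x: "x \<in> E" and MN: "M \<le> N"
  shows "h (x - projection B e N x) \<le> h (x - projection B e M x)"
proof (rule power2_le_imp_le)
  have "(\<Sum>i<M. (norm (B x (e i)))\<^sup>2) \<le> (\<Sum>i<N. (norm (B x (e i)))\<^sup>2)"
    using MN by (intro sum_mono2) auto
  then show "(h (x - projection B e N x))\<^sup>2 \<le> (h (x - projection B e M x))\<^sup>2"
    by (simp add: residual_norm[OF H e x])
  show "0 \<le> h (x - projection B e M x)"
    using projection_closed[OF e] x by (intro form_nonneg[OF H]) auto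
qed

lemma residual_seminorm:
  assumes H: "hermitian_form B h" and e: "orthonormal B h e"
  shows "seminorm_on smul E (\<lambda>x. h (x - projection B e N x))"
proof -
  have E: "e i \<in> E" for i using e by (simp add: orthonormal_def)
  note sn = form_seminorm[OF H]
  show ?thesis unfolding seminorm_on_def
  proof (intro conjI ballI allI)
    fix x y assume x: "x \<in> E" "y \<in> E"
    have "x + y - projection B e N (x + y) = (x - projection B e N x) + (y - projection B e N y)"
      using x E by (simp add: projection_def form_add[OF H] scale_left_distrib sum.distrib)
    moreover have "h ((x - projection B e N x) + (y - projection B e N y))
        \<le> h (x - projection B e N x) + h (y - projection B e N y)"
      using x projection_closed[OF e] by (intro seminorm_add[OF sn]) auto
    ultimately show "h (x + y - projection B e N (x + y))
        \<le> h (x - projection B e N x) + h (y - projection B e N y)" by (simp only:)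
  next
    fix c x assume x: "x \<in> E"
    have "smul c x - projection B e N (smul c x) = smul c (x - projection B e N x)"
      using x E by (simp add: projection_def form_smul[OF H] scale_right_diff_distrib scale_sum_right)
    then show "h (smul c x - projection B e N (smul c x)) = norm c * h (x - projection B e N x)"
      using x projection_closed[OF e] by (simp add: seminorm_smul[OF sn])
  next
    fix x assume x: "x \<in> E"
    then show "0 \<le> h (x - projection B e N x)"
      using projection_closed[OF e] by (intro form_nonneg[OF H]) auto
  qed
qed

text \<open>
  As \<open>1 / 0 = 0\<close>, a vector that depends on its predecessors up to norm \<open>0\<close> is replaced by \<open>0\<close>.
\<close>

function gram_schmidt :: "('v \<Rightarrow> 'v \<Rightarrow> 'k) \<Rightarrow> ('v \<Rightarrow> real) \<Rightarrow> (nat \<Rightarrow> 'v) \<Rightarrow> nat \<Rightarrow> 'v" where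
  "gram_schmidt B h d n =
     (let w = d n - (\<Sum>i<n. smul (B (d n) (gram_schmidt B h d i)) (gram_schmidt B h d i))
      in smul (of_real (1 / h w)) w)"
  by pat_completeness auto
termination
  by (relation "Wellfounded.measure (\<lambda>(B, h, d, n). n)") auto

declare gram_schmidt.simps [simp del]

lemma gram_schmidt_orthonormal:
  assumes H: "hermitian_form B h" and d: "\<And>n. d n \<in> E"
  shows "orthonormal B h (gram_schmidt B h d)"
proof -
  define e where "e = gram_schmidt B h d"
  have e_eq: "e n = (let w = d n - projection B e n (d n) in smul (of_real (1 / h w)) w)" for n
    unfolding e_def projection_def by (subst gram_schmidt.simps) simp
  have main: "e n \<in> E \<and> h (e n) \<in> {0, 1} \<and> (\<forall>i<n. B (e n) (e i) = 0)" for n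
  proof (induction n rule: less_induct)
    case (less n)
    \<comment> \<open>The vectors found so far, padded by zeros to a sequence.\<close>
    define e' where "e' i = (if i < n then e i else 0)" for i
    have B0: "B x 0 = 0" if "x \<in> E" for x using form_smul_right[OF H E_closed(1) that, of 0] by simp
    have h0: "h 0 = 0" using seminorm_zero[OF form_seminorm[OF H]] .
    have "B (e i) (e j) = 0" if "i < n" "j < n" "i \<noteq> j" for i j
    proof (cases "i < j")
      case True
      then have "B (e j) (e i) = 0" using less that by auto
      then show ?thesis using form_cj[OF H, of "e j" "e i"] less that by simp
    next
      case False
      then show ?thesis using less that by auto
    qed
    then have e': "orthonormal B h e'"
      using less B0 form_zero[OF H] h0 by (auto simp: orthonormal_def e'_def)
    define w where "w = d n - projection B e n (d n)"
    have P: "projection B e n (d n) = projection B e' n (d n)"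
      by (simp add: projection_def e'_def)
    have wE: "w \<in> E" using d projection_closed[OF e'] by (auto simp: w_def P)
    have "B w (e i) = 0" if "i < n" for i
      using projection_orthogonal[OF H e' d that, of n] that by (simp add: w_def P e'_def)
    moreover have en: "e n = smul (of_real (1 / h w)) w" using e_eq[of n] by (simp add: w_def Let_def)
    moreover have "h (e n) = \<bar>1 / h w\<bar> * h w"
      unfolding en by (simp only: form_norm_smul[OF H wE] norm_of_real)
    then have "h (e n) \<in> {0, 1}" using form_nonneg[OF H wE] by auto
    ultimately show ?case using wE less by (auto simp: form_smul[OF H])
  qed
  have "B (e i) (e j) = 0" if "i \<noteq> j" for i j
  proof (cases "j < i")
    case False
    then have "B (e j) (e i) = 0" using main that by simp
    then show ?thesis using form_cj[OF H, of "e j" "e i"] main by simp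
  qed (use main in simp)
  then show ?thesis using main unfolding orthonormal_def e_def by blast
qed

text \<open>
  Subtracting the component along \<open>e n\<close> from the unnormalised vector leaves a multiple of \<open>e n\<close> that is
  orthogonal to \<open>e n\<close>, hence has norm \<open>0\<close>; if that vector has norm \<open>0\<close> itself, nothing is subtracted.
\<close>

lemma gram_schmidt_spans:
  assumes H: "hermitian_form B h" and d: "\<And>n. d n \<in> E" and n: "n < N"
  shows "h (d n - projection B (gram_schmidt B h d) N (d n)) = 0"
proof -
  define e where "e = gram_schmidt B h d"
  have e: "orthonormal B h e" unfolding e_def by (rule gram_schmidt_orthonormal[OF H d])
  have E: "e i \<in> E" for i using e by (simp add: orthonormal_def)
  define w where "w = d n - projection B e n (d n)"
  define w' where "w' = d n - projection B e (Suc n) (d n)"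
  have wE: "w \<in> E" "w' \<in> E" using d projection_closed[OF e] by (auto simp: w_def w'_def)
  have en: "e n = smul (of_real (1 / h w)) w"
    unfolding w_def e_def projection_def by (subst gram_schmidt.simps) (simp add: Let_def)
  have w': "w' = w - smul (B (d n) (e n)) (e n)" by (simp add: w'_def w_def projection_def)
  have "h w' = 0"
  proof (cases "h w = 0")
    case True
    then have "e n = 0" using en by simp
    then show ?thesis using True w' by simp
  next
    case False
    define k where "k = of_real (h w) - B (d n) (e n)"
    have "smul (of_real (h w)) (e n) = w"
      unfolding en using False by (simp only: scale_scale of_real_mult[symmetric]) simp
    then have "w' = smul k (e n)" by (simp add: w' k_def scale_left_diff_distrib)
    then have "B w' w' = cj k * B w' (e n)"
      using form_smul_right[OF H E wE(2), of k n] by simp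
    also have "\<dots> = 0" using projection_orthogonal[OF H e d, of n "Suc n"] by (simp add: w'_def)
    finally show ?thesis using form_self[OF H wE(2)] by simp
  qed
  then have "h (d n - projection B e N (d n)) \<le> 0"
    using residual_antimono[OF H e d, of "Suc n" N n] n by (simp add: w'_def)
  moreover have "0 \<le> h (d n - projection B e N (d n))"
    using d projection_closed[OF e] by (intro form_nonneg[OF H]) auto
  ultimately show ?thesis by (simp add: e_def)
qed

section \<open>Hilbert-Schmidt comparison of seminorms\<close>

text \<open>
  The canonical map from \<open>(E, h)\<close> to \<open>(E, p)\<close> is bounded, and a Hilbert-Schmidt map of the completions if \<open>p\<close> is
  Hermitian as well.
\<close>

definition hilbert_schmidt :: "('v \<Rightarrow> real) \<Rightarrow> ('v \<Rightarrow> 'v \<Rightarrow> 'k) \<Rightarrow> ('v \<Rightarrow> real) \<Rightarrow> bool" where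
  "hilbert_schmidt p B h \<longleftrightarrow>
     (\<exists>K\<ge>0. \<forall>x\<in>E. p x \<le> K * h x) \<and>
     (\<exists>C. \<forall>e N. orthonormal B h e \<longrightarrow> (\<Sum>i<N. (p (e i))\<^sup>2) \<le> C)"

text \<open>
  A finite orthonormal system that almost maximises \<open>\<Sum>i<N. (p (e i))\<^sup>2\<close> leaves little to be gained from
  a further unit vector, so \<open>p\<close> is small relative to \<open>h\<close> on its orthogonal complement.
\<close>

lemma hilbert_schmidt_finite_rank:
  assumes p: "seminorm_on smul E p" and H: "hermitian_form B h" and HS: "hilbert_schmidt p B h"
    and \<epsilon>: "0 < \<epsilon>"
  shows "\<exists>e N. orthonormal B h e \<and> (\<forall>x\<in>E. p (x - projection B e N x) \<le> \<epsilon> * h x)"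
proof -
  from HS obtain K C where K: "0 \<le> K" "\<forall>x\<in>E. p x \<le> K * h x"
    and C: "\<forall>e N. orthonormal B h e \<longrightarrow> (\<Sum>i<N. (p (e i))\<^sup>2) \<le> C"
    unfolding hilbert_schmidt_def by (elim conjE exE) (rule that)
  note K = K(1) K(2)[rule_format] and C = C[rule_format]
  define S where "S = {\<Sum>i<N. (p (e i))\<^sup>2 | e N. orthonormal B h e}"
  have h0: "h 0 = 0" using seminorm_zero[OF form_seminorm[OF H]] .
  have B0: "B x 0 = 0" if "x \<in> E" for x using form_smul_right[OF H E_closed(1) that, of 0] by simp
  have "orthonormal B h (\<lambda>i. 0)" using h0 B0 by (simp add: orthonormal_def)
  then have "S \<noteq> {}" by (auto simp: S_def)
  have bdd: "bdd_above S" unfolding S_def using C by (auto intro!: bdd_aboveI[of _ C])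
  have "Sup S - \<epsilon>\<^sup>2 < Sup S" using \<epsilon> by simp
  then obtain s where "s \<in> S" "Sup S - \<epsilon>\<^sup>2 < s" using less_cSupE \<open>S \<noteq> {}\<close> by metis
  then obtain e N where e: "orthonormal B h e" and sup: "Sup S - \<epsilon>\<^sup>2 < (\<Sum>i<N. (p (e i))\<^sup>2)"
    by (auto simp: S_def)
  have E: "e i \<in> E" for i using e by (simp add: orthonormal_def)
  have "p (x - projection B e N x) \<le> \<epsilon> * h x" if x: "x \<in> E" for x
  proof -
    define w where "w = x - projection B e N x"
    have wE: "w \<in> E" using x projection_closed[OF e] by (auto simp: w_def)
    have "p w \<le> \<epsilon> * h w"
    proof (cases "h w = 0")
      case True
      then show ?thesis using K(2)[OF wE] by simp
    next
      case False
      then have hw: "0 < h w" using form_nonneg[OF H wE] by simp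
      define v where "v = smul (of_real (1 / h w)) w"
      have vE: "v \<in> E" using wE by (simp add: v_def)
      have "h v = \<bar>1 / h w\<bar> * h w" unfolding v_def by (simp only: form_norm_smul[OF H wE] norm_of_real)
      then have hv: "h v = 1" using hw by simp
      have pv: "p v = p w / h w"
        unfolding v_def using hw by (simp only: seminorm_smul[OF p wE] norm_of_real) simp
      have orth: "B v (e i) = 0" "B (e i) v = 0" if "i < N" for i
      proof -
        show "B v (e i) = 0"
          using projection_orthogonal[OF H e x that] wE E by (simp add: v_def form_smul[OF H] w_def)
        then show "B (e i) v = 0" using form_cj[OF H vE E, of i] by simp
      qed
      \<comment> \<open>The competitor for the supremum.\<close>
      define e' where "e' i = (if i < N then e i else if i = N then v else 0)" for i
      have "orthonormal B h e'"
        using e orth hv h0 vE E B0[OF vE] B0[OF E] form_zero[OF H] by (auto simp: orthonormal_def e'_def)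
      then have "(\<Sum>i<Suc N. (p (e' i))\<^sup>2) \<in> S" unfolding S_def by blast
      then have "(\<Sum>i<Suc N. (p (e' i))\<^sup>2) \<le> Sup S" by (rule cSup_upper[OF _ bdd])
      moreover have "(\<Sum>i<Suc N. (p (e' i))\<^sup>2) = (\<Sum>i<N. (p (e i))\<^sup>2) + (p v)\<^sup>2"
        by (simp add: e'_def)
      ultimately have "(p v)\<^sup>2 \<le> \<epsilon>\<^sup>2" using sup by linarith
      then have "p v \<le> \<epsilon>" using \<epsilon> by (intro power2_le_imp_le[of "p v" \<epsilon>]) auto
      then show ?thesis using hw by (simp add: pv field_simps)
    qed
    also have "\<dots> \<le> \<epsilon> * h x"
      using residual_le[OF H e x, of N] \<epsilon> by (simp add: w_def)
    finally show ?thesis by (simp add: w_def)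
  qed
  then show ?thesis using e by (intro exI[of _ e] exI[of _ N]) simp
qed

text \<open>
  The finite systems that belong to \<open>\<epsilon> = 1 / (m + 1)\<close> are countably many, and together they span a \<open>p\<close>-dense
  subspace.
\<close>

lemma hilbert_schmidt_separable:
  assumes p: "seminorm_on smul E p" and H: "hermitian_form B h" and HS: "hilbert_schmidt p B h"
  shows "\<exists>d :: nat \<Rightarrow> 'v. (\<forall>k. d k \<in> E) \<and>
           (\<forall>x\<in>E. \<forall>\<epsilon>>0. \<exists>c M. p (x - (\<Sum>k<M. smul (c k) (d k))) \<le> \<epsilon>)"
proof -
  have "\<forall>m. \<exists>e N. orthonormal B h e \<and> (\<forall>x\<in>E. p (x - projection B e N x) \<le> (1 / real (Suc m)) * h x)"
    by (intro allI hilbert_schmidt_finite_rank[OF p H HS]) simp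
  then obtain e N where e: "\<And>m. orthonormal B h (e m)"
    and approx: "\<And>m x. x \<in> E \<Longrightarrow> p (x - projection B (e m) (N m) x) \<le> (1 / real (Suc m)) * h x"
    by metis
  define d where "d k = e (fst (prod_decode k)) (snd (prod_decode k))" for k
  have dE: "d k \<in> E" for k using e by (simp add: d_def orthonormal_def)
  have "\<exists>c M. p (x - (\<Sum>k<M. smul (c k) (d k))) \<le> \<epsilon>" if x: "x \<in> E" and \<epsilon>: "0 < \<epsilon>" for x \<epsilon>
  proof -
    obtain m where m: "h x / \<epsilon> < real m" using reals_Archimedean2 by blast
    have hx: "0 \<le> h x" by (rule form_nonneg[OF H x])
    have "(1 / real (Suc m)) * h x \<le> \<epsilon>"
      using m \<epsilon> by (simp add: field_simps)
    then have le: "p (x - projection B (e m) (N m) x) \<le> \<epsilon>" using approx[OF x, of m] by linarith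
    define J where "J = (\<lambda>i. prod_encode (m, i)) ` {..<N m}"
    define c where "c k = (if k \<in> J then B x (d k) else 0)" for k
    obtain M where M: "J \<subseteq> {..<M}" using finite_nat_iff_bounded[of J] by (auto simp: J_def)
    have "(\<Sum>k<M. smul (c k) (d k)) = (\<Sum>k\<in>J. smul (c k) (d k))"
      by (rule sum.mono_neutral_right) (use M in \<open>auto simp: c_def\<close>)
    also have "\<dots> = (\<Sum>i<N m. smul (c (prod_encode (m, i))) (d (prod_encode (m, i))))"
      unfolding J_def by (subst sum.reindex) (auto simp: inj_on_def)
    also have "\<dots> = projection B (e m) (N m) x"
      unfolding projection_def by (rule sum.cong) (auto simp: c_def d_def J_def)
    finally show ?thesis using le by metis
  qed
  then show ?thesis using dE by (intro exI[of _ d]) simp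
qed

text \<open>
  Gram-Schmidt applied to a sequence with dense span; the residual after \<open>N\<close> steps is a seminorm below \<open>h1\<close> that
  vanishes on the first \<open>N\<close> vectors of this sequence.
\<close>

lemma orthonormal_basis_exists:
  assumes H1: "hermitian_form B1 h1" and H2: "hermitian_form B2 h2" and HS: "hilbert_schmidt h1 B2 h2"
  shows "\<exists>e. orthonormal B1 h1 e \<and> (\<forall>x\<in>E. (\<lambda>N. h1 (x - projection B1 e N x)) \<longlonglongrightarrow> 0)"
proof -
  note sn = form_seminorm[OF H1]
  obtain d :: "nat \<Rightarrow> 'v" where d: "\<And>k. d k \<in> E"
    and dense: "\<forall>x\<in>E. \<forall>\<epsilon>>0. \<exists>c M. h1 (x - (\<Sum>k<M. smul (c k) (d k))) \<le> \<epsilon>"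
    using hilbert_schmidt_separable[OF sn H2 HS] by (elim exE conjE) (rule that, erule spec)
  define e where "e = gram_schmidt B1 h1 d"
  have e: "orthonormal B1 h1 e" unfolding e_def by (rule gram_schmidt_orthonormal[OF H1 d])
  have "(\<lambda>N. h1 (x - projection B1 e N x)) \<longlonglongrightarrow> 0" if x: "x \<in> E" for x
    unfolding LIMSEQ_iff
  proof (intro allI impI)
    fix \<epsilon> :: real assume \<epsilon>: "0 < \<epsilon>"
    then obtain c M where cM: "h1 (x - (\<Sum>k<M. smul (c k) (d k))) \<le> \<epsilon> / 2"
      using dense[rule_format, OF x, of "\<epsilon> / 2"] by auto
    define g where "g = (\<Sum>k<M. smul (c k) (d k))"
    have gE: "g \<in> E" using d by (auto simp: g_def)
    have "norm (h1 (x - projection B1 e N x) - 0) < \<epsilon>" if N: "M \<le> N" for N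
    proof -
      define r where "r y = h1 (y - projection B1 e N y)" for y
      have r: "seminorm_on smul E r" unfolding r_def by (rule residual_seminorm[OF H1 e])
      have rd: "r (d k) = 0" if "k < M" for k
        using gram_schmidt_spans[OF H1 d, of k N] that N by (simp add: r_def e_def)
      have "r g \<le> (\<Sum>k<M. r (smul (c k) (d k)))"
        unfolding g_def using d by (intro seminorm_sum[OF r]) auto
      also have "\<dots> = 0"
        using rd by (intro sum.neutral) (simp add: seminorm_smul[OF r d])
      finally have "r g \<le> 0" .
      moreover have "r (x - g) \<le> \<epsilon> / 2"
        using residual_le[OF H1 e, of "x - g" N] x gE cM by (simp add: r_def g_def)
      moreover have "r x \<le> r (x - g) + r g" using seminorm_add[OF r, of "x - g" g] x gE by simp
      ultimately show ?thesis using \<epsilon> seminorm_nonneg[OF r x] by (simp add: r_def)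
    qed
    then show "\<exists>no. \<forall>N\<ge>no. norm (h1 (x - projection B1 e N x) - 0) < \<epsilon>" by blast
  qed
  then show ?thesis using e by (intro exI[of _ e]) simp
qed

text \<open>
  The composition of two Hilbert-Schmidt maps is nuclear: in the expansion \<open>x = \<Sum>j. B1 x (e j) \<cdot> e j\<close> along an
  orthonormal basis of the middle space, both the norms of the functionals and those of the vectors are square
  summable. The first of these sums is evaluated on a basis \<open>g\<close> of the outer space.
\<close>

lemma nuclear_of_hilbert_schmidt:
  assumes p: "seminorm_on smul E p"
    and H1: "hermitian_form B1 h1" and H2: "hermitian_form B2 h2" and H3: "hermitian_form B3 h3"
    and HS1: "hilbert_schmidt p B1 h1" and HS2: "hilbert_schmidt h1 B2 h2"
    and HS3: "hilbert_schmidt h2 B3 h3"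
    and q: "0 \<le> K" "\<And>x. x \<in> E \<Longrightarrow> h2 x \<le> K * q x"
  shows "nuclear_map smul E q smul E p (\<lambda>x. x)"
proof -
  obtain e where e: "orthonormal B1 h1 e"
    and e_lim: "\<forall>x\<in>E. (\<lambda>N. h1 (x - projection B1 e N x)) \<longlonglongrightarrow> 0"
    using orthonormal_basis_exists[OF H1 H2 HS2] by (elim exE conjE) (rule that)
  note e_lim = e_lim[rule_format]
  obtain g where g: "orthonormal B2 h2 g"
    and g_lim: "\<forall>x\<in>E. (\<lambda>N. h2 (x - projection B2 g N x)) \<longlonglongrightarrow> 0"
    using orthonormal_basis_exists[OF H2 H3 HS3] by (elim exE conjE) (rule that)
  note g_lim = g_lim[rule_format]
  have eE: "e i \<in> E" and gE: "g i \<in> E" for i using e g by (auto simp: orthonormal_def)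
  have e1: "h1 (e i) \<le> 1" for i
  proof -
    have "h1 (e i) \<in> {0, 1}" using e by (simp add: orthonormal_def)
    then show ?thesis by auto
  qed
  from HS1 obtain K1 C1' where K1: "0 \<le> K1" "\<forall>x\<in>E. p x \<le> K1 * h1 x"
    and C1': "\<forall>e N. orthonormal B1 h1 e \<longrightarrow> (\<Sum>i<N. (p (e i))\<^sup>2) \<le> C1'"
    unfolding hilbert_schmidt_def by (elim conjE exE) (rule that)
  note K1 = K1(1) K1(2)[rule_format] and C1' = C1'[rule_format]
  from HS2 obtain K2 C2' where K2: "0 \<le> K2" "\<forall>x\<in>E. h1 x \<le> K2 * h2 x"
    and C2': "\<forall>e N. orthonormal B2 h2 e \<longrightarrow> (\<Sum>i<N. (h1 (e i))\<^sup>2) \<le> C2'"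
    unfolding hilbert_schmidt_def by (elim conjE exE) (rule that)
  note K2 = K2(1) K2(2)[rule_format] and C2' = C2'[rule_format]
  note C1 = C1'[OF e] and C2 = C2'[OF g]
  \<comment> \<open>The double sum of \<open>G\<close> is finite, and its sums over \<open>i\<close> control the norms of the functionals.\<close>
  define G where "G i j = (norm (B1 (g i) (e j)))\<^sup>2" for i j
  have Gsum: "(\<Sum>i<n. \<Sum>j<M. G i j) \<le> C2'" for n M
  proof -
    have "(\<Sum>i<n. \<Sum>j<M. G i j) \<le> (\<Sum>i<n. (h1 (g i))\<^sup>2)"
      unfolding G_def by (intro sum_mono bessel[OF H1 e gE])
    then show ?thesis using C2[of n] by linarith
  qed
  have Gsm: "summable (\<lambda>i. G i j)" for j
  proof (rule summableI_nonneg_bounded)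
    fix n
    have "(\<Sum>i<n. G i j) \<le> (\<Sum>i<n. \<Sum>j<Suc j. G i j)"
      by (intro sum_mono) (simp add: G_def sum_nonneg)
    then show "(\<Sum>i<n. G i j) \<le> C2'" using Gsum[where n=n and M="Suc j"] by linarith
  qed (simp add: G_def)
  define s where "s j = (\<Sum>i. G i j)" for j
  have s0: "0 \<le> s j" for j unfolding s_def by (rule suminf_nonneg[OF Gsm]) (simp add: G_def)
  have ssum: "(\<Sum>j<M. s j) \<le> C2'" for M
  proof -
    have "(\<Sum>j<M. s j) = (\<Sum>i. \<Sum>j<M. G i j)" unfolding s_def by (rule suminf_sum[symmetric]) (rule Gsm)
    also have "\<dots> \<le> C2'"
      by (rule suminf_le_const[OF summable_sum[OF Gsm] Gsum])
    finally show ?thesis .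
  qed
  have a_bound: "norm (B1 x (e j)) \<le> h2 x * sqrt (s j)" if x: "x \<in> E" for x j
  proof (rule LIMSEQ_le_const2)
    note PE = projection_closed[OF g, of _ x]
    have lim: "(\<lambda>N. K2 * h2 (x - projection B2 g N x)) \<longlonglongrightarrow> 0"
      by (rule tendsto_mult_right_zero[OF g_lim[OF x]])
    have bound: "norm (B1 x (e j) - B1 (projection B2 g N x) (e j)) \<le> K2 * h2 (x - projection B2 g N x)"
      for N
    proof -
      have "norm (B1 x (e j) - B1 (projection B2 g N x) (e j)) = norm (B1 (x - projection B2 g N x) (e j))"
        using x PE eE by (simp add: form_diff[OF H1])
      also have "\<dots> \<le> h1 (x - projection B2 g N x) * h1 (e j)"
        using x PE eE by (intro form_Cauchy_Schwarz[OF H1]) auto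
      also have "\<dots> \<le> h1 (x - projection B2 g N x) * 1"
        by (intro mult_left_mono[OF e1] form_nonneg[OF H1]) (use x PE in auto)
      also have "\<dots> \<le> K2 * h2 (x - projection B2 g N x)"
        using K2(2)[of "x - projection B2 g N x"] x PE by simp
      finally show ?thesis .
    qed
    have "(\<lambda>N. B1 x (e j) - B1 (projection B2 g N x) (e j)) \<longlonglongrightarrow> 0"
      by (rule Lim_null_comparison[OF always_eventually lim]) (rule allI, rule bound)
    from tendsto_diff[OF tendsto_const[of "B1 x (e j)"] this]
    have "(\<lambda>N. B1 (projection B2 g N x) (e j)) \<longlonglongrightarrow> B1 x (e j)"
      by (simp only: diff_diff_eq2 add_diff_cancel_left' diff_zero)
    then show "(\<lambda>N. norm (B1 (projection B2 g N x) (e j))) \<longlonglongrightarrow> norm (B1 x (e j))"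
      by (rule tendsto_norm)
    have "norm (B1 (projection B2 g N x) (e j)) \<le> h2 x * sqrt (s j)" for N
    proof -
      have "B1 (projection B2 g N x) (e j) = (\<Sum>i<N. B2 x (g i) * B1 (g i) (e j))"
        unfolding projection_def using gE eE by (subst form_sum[OF H1]) (auto simp: form_smul[OF H1])
      then have "norm (B1 (projection B2 g N x) (e j)) \<le> (\<Sum>i<N. \<bar>norm (B2 x (g i))\<bar> * \<bar>norm (B1 (g i) (e j))\<bar>)"
        using norm_sum[of "\<lambda>i. B2 x (g i) * B1 (g i) (e j)" "{..<N}"] by (simp add: norm_mult)
      also have "\<dots> \<le> L2_set (\<lambda>i. norm (B2 x (g i))) {..<N} * L2_set (\<lambda>i. norm (B1 (g i) (e j))) {..<N}"
        by (rule L2_set_mult_ineq)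
      also have "\<dots> \<le> h2 x * sqrt (s j)"
      proof (intro mult_mono)
        show "L2_set (\<lambda>i. norm (B2 x (g i))) {..<N} \<le> h2 x"
          unfolding L2_set_def using bessel[OF H2 g x, of N] form_nonneg[OF H2 x]
          by (intro real_le_lsqrt) (auto simp: sum_nonneg)
        show "L2_set (\<lambda>i. norm (B1 (g i) (e j))) {..<N} \<le> sqrt (s j)"
          unfolding L2_set_def s_def
          using sum_le_suminf[OF Gsm, of "{..<N}" j] by (simp add: G_def)
      qed (auto simp: form_nonneg[OF H2 x] L2_set_nonneg)
      finally show ?thesis .
    qed
    then show "\<exists>N. \<forall>n\<ge>N. norm (B1 (projection B2 g n x) (e j)) \<le> h2 x * sqrt (s j)" by blast
  qed
  show ?thesis
    unfolding nuclear_map_def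
  proof (intro exI[of _ "\<lambda>j x. B1 x (e j)"] exI[of _ "\<lambda>j. K * sqrt (s j)"] exI[of _ e] conjI allI ballI)
    fix j
    show "linear_functional_on smul E (\<lambda>x. B1 x (e j))"
      using eE by (simp add: linear_functional_on_def form_add[OF H1] form_smul[OF H1])
    show "0 \<le> K * sqrt (s j)" using q(1) s0 by simp
    show "e j \<in> E" by (rule eE)
  next
    fix j x assume x: "x \<in> E"
    have "norm (B1 x (e j)) \<le> h2 x * sqrt (s j)" by (rule a_bound[OF x])
    also have "\<dots> \<le> (K * q x) * sqrt (s j)" using q(2)[OF x] s0 by (intro mult_right_mono) auto
    finally show "norm (B1 x (e j)) \<le> K * sqrt (s j) * q x" by (simp add: mult_ac)
  next
    show "summable (\<lambda>j. K * sqrt (s j) * p (e j))"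
    proof (rule summableI_nonneg_bounded)
      show "0 \<le> K * sqrt (s j) * p (e j)" for j
        using q(1) s0 seminorm_nonneg[OF p eE] by simp
      fix n
      have "(\<Sum>j<n. K * sqrt (s j) * p (e j)) = K * (\<Sum>j<n. \<bar>sqrt (s j)\<bar> * \<bar>p (e j)\<bar>)"
        using s0 seminorm_nonneg[OF p eE] by (simp add: sum_distrib_left mult.assoc)
      also have "\<dots> \<le> K * (L2_set (\<lambda>j. sqrt (s j)) {..<n} * L2_set (\<lambda>j. p (e j)) {..<n})"
        using q(1) by (intro mult_left_mono L2_set_mult_ineq)
      also have "\<dots> \<le> K * (sqrt C2' * sqrt C1')"
        unfolding L2_set_def using q(1) ssum C1 s0
          ssum[of 0] C1[of 0]
        by (intro mult_left_mono mult_mono) (auto simp: sum_nonneg)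
      finally show "(\<Sum>j<n. K * sqrt (s j) * p (e j)) \<le> K * (sqrt C2' * sqrt C1')" .
    qed
  next
    fix x assume x: "x \<in> E"
    have "(\<lambda>N. p (x - projection B1 e N x)) \<longlonglongrightarrow> 0"
    proof (rule Lim_null_comparison)
      show "(\<lambda>N. K1 * h1 (x - projection B1 e N x)) \<longlonglongrightarrow> 0"
        by (rule tendsto_mult_right_zero[OF e_lim[OF x]])
      show "\<forall>\<^sub>F N in sequentially. norm (p (x - projection B1 e N x)) \<le> K1 * h1 (x - projection B1 e N x)"
        using K1(2) seminorm_nonneg[OF p] x projection_closed[OF e] by (intro always_eventually) simp
    qed
    then show "(\<lambda>N. p (x - (\<Sum>j<N. smul (B1 x (e j)) (e j)))) \<longlonglongrightarrow> 0"
      by (simp add: projection_def)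
  qed
qed

end

section \<open>Iterated partial derivatives\<close>

text \<open>
  In contrast to \<open>smooth_functions\<close>, nothing is required outside \<open>\<Omega>\<close>; this makes the class closed under partial
  derivatives.
\<close>

definition smooth_on :: "(real^'d::finite) set \<Rightarrow> (real^'d \<Rightarrow> 'k::real_normed_vector) \<Rightarrow> bool" where
  "smooth_on \<Omega> f \<longleftrightarrow>
     (\<forall>js. continuous_on \<Omega> (iterated_partial js f) \<and>
        (\<forall>i. \<forall>x\<in>\<Omega>. (\<lambda>t. iterated_partial js f (x + t *\<^sub>R axis i 1)) differentiable (at 0)))"

lemma iterated_partial_Nil [simp]: "iterated_partial [] f = f"
  by (simp add: iterated_partial_def)

lemma iterated_partial_Cons: "iterated_partial (i # js) f = partial i (iterated_partial js f)"
  by (simp add: iterated_partial_def)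

lemma iterated_partial_append:
  "iterated_partial (as @ bs) f = iterated_partial as (iterated_partial bs f)"
  by (simp add: iterated_partial_def)

lemma smooth_on_iterated: "smooth_on \<Omega> f \<Longrightarrow> smooth_on \<Omega> (iterated_partial bs f)"
  unfolding smooth_on_def iterated_partial_append[symmetric] by blast

lemma smooth_on_partial: "smooth_on \<Omega> f \<Longrightarrow> smooth_on \<Omega> (partial i f)"
  using smooth_on_iterated[of \<Omega> f "[i]"] by (simp add: iterated_partial_Cons)

lemma smooth_on_continuous: "smooth_on \<Omega> f \<Longrightarrow> continuous_on \<Omega> (iterated_partial js f)"
  by (simp add: smooth_on_def)

lemma partial_has_vector_derivative:
  assumes f: "smooth_on \<Omega> f" and x: "x + s *\<^sub>R axis i 1 \<in> \<Omega>"
  shows "((\<lambda>t. f (x + t *\<^sub>R axis i 1)) has_vector_derivative partial i f (x + s *\<^sub>R axis i 1)) (at s)"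
proof -
  have "(\<lambda>t. iterated_partial [] f (x + s *\<^sub>R axis i 1 + t *\<^sub>R axis i 1)) differentiable (at 0)"
    using f x unfolding smooth_on_def by blast
  then have "((\<lambda>t. f (x + s *\<^sub>R axis i 1 + t *\<^sub>R axis i 1)) has_vector_derivative
      partial i f (x + s *\<^sub>R axis i 1)) (at (s - s))"
    by (simp add: partial_def vector_derivative_works)
  moreover have "((\<lambda>t. t - s) has_vector_derivative 1) (at s)"
    by (auto intro!: derivative_eq_intros)
  ultimately have "((\<lambda>t. f (x + s *\<^sub>R axis i 1 + t *\<^sub>R axis i 1)) \<circ> (\<lambda>t. t - s)
      has_vector_derivative 1 *\<^sub>R partial i f (x + s *\<^sub>R axis i 1)) (at s)"
    by (intro vector_diff_chain_at) auto
  moreover have "(\<lambda>t. f (x + s *\<^sub>R axis i 1 + t *\<^sub>R axis i 1)) \<circ> (\<lambda>t. t - s)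
      = (\<lambda>t. f (x + t *\<^sub>R axis i 1))"
    by (auto simp: fun_eq_iff algebra_simps)
  ultimately show ?thesis by simp
qed

lemma partial_eqI:
  assumes "((\<lambda>t. f (x + t *\<^sub>R axis i 1)) has_vector_derivative D) (at 0)"
  shows "partial i f x = D"
  unfolding partial_def by (rule vector_derivative_at[OF assms])

lemma eventually_line_in_open:
  fixes x :: "real^'d::finite"
  assumes "open \<Omega>" "x \<in> \<Omega>"
  shows "\<forall>\<^sub>F t in nhds 0. x + t *\<^sub>R v \<in> \<Omega>"
proof -
  have "((\<lambda>t. x + t *\<^sub>R v) \<longlongrightarrow> x + 0 *\<^sub>R v) (nhds 0)"
    by (intro tendsto_intros filterlim_ident)
  then show ?thesis using assms by (intro topological_tendstoD) auto
qed

lemma partial_cong: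
  assumes "open \<Omega>" "x \<in> \<Omega>" "\<And>y. y \<in> \<Omega> \<Longrightarrow> f y = g y"
  shows "partial i f x = partial i g x"
  unfolding partial_def
proof (rule vector_derivative_cong_eq)
  show "\<forall>\<^sub>F t in nhds 0. t \<in> UNIV \<longrightarrow> f (x + t *\<^sub>R axis i 1) = g (x + t *\<^sub>R axis i 1)"
    using eventually_line_in_open[OF assms(1,2), of "axis i 1"] by eventually_elim (simp add: assms(3))
qed auto

lemma smooth_on_line_derivative:
  assumes "smooth_on \<Omega> f" "x \<in> \<Omega>"
  shows "((\<lambda>t. f (x + t *\<^sub>R axis i 1)) has_vector_derivative partial i f x) (at 0)"
  using partial_has_vector_derivative[OF assms(1), of x 0 i] assms(2) by simp

lemma iterated_partial_add:
  assumes "open \<Omega>" and f: "smooth_on \<Omega> f" and g: "smooth_on \<Omega> g" and x: "x \<in> \<Omega>"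
  shows "iterated_partial js (f + g) x = iterated_partial js f x + iterated_partial js g x"
  using x
proof (induction js arbitrary: x)
  case (Cons i js)
  have "partial i (iterated_partial js (f + g)) x
      = partial i (\<lambda>y. iterated_partial js f y + iterated_partial js g y) x"
    by (rule partial_cong[OF assms(1) Cons.prems]) (rule Cons.IH)
  also have "\<dots> = partial i (iterated_partial js f) x + partial i (iterated_partial js g) x"
    by (intro partial_eqI has_vector_derivative_add smooth_on_line_derivative[OF _ Cons.prems]
        smooth_on_iterated f g)
  finally show ?case by (simp only: iterated_partial_Cons)
qed simp

lemma iterated_partial_scale:
  fixes f :: "real^'d::finite \<Rightarrow> 'k::real_normed_field"
  assumes "open \<Omega>" and f: "smooth_on \<Omega> f" and x: "x \<in> \<Omega>"
  shows "iterated_partial js (pointwise_scale (*) c f) x = c * iterated_partial js f x"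
  using x
proof (induction js arbitrary: x)
  case (Cons i js)
  have "partial i (iterated_partial js (pointwise_scale (*) c f)) x
      = partial i (\<lambda>y. c * iterated_partial js f y) x"
    by (rule partial_cong[OF assms(1) Cons.prems]) (rule Cons.IH)
  also have "\<dots> = c * partial i (iterated_partial js f) x"
    by (intro partial_eqI has_vector_derivative_mult_right
        smooth_on_line_derivative[OF _ Cons.prems] smooth_on_iterated f)
  finally show ?case by (simp only: iterated_partial_Cons)
qed (simp add: pointwise_scale_def)

lemma smooth_on_of_iterated:
  assumes op: "open \<Omega>"
    and eq: "\<And>js x. x \<in> \<Omega> \<Longrightarrow> iterated_partial js h x = G js x"
    and cont: "\<And>js. continuous_on \<Omega> (G js)"
    and diff: "\<And>js i x. x \<in> \<Omega> \<Longrightarrow> (\<lambda>t. G js (x + t *\<^sub>R axis i 1)) differentiable (at 0)"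
  shows "smooth_on \<Omega> h"
  unfolding smooth_on_def
proof (intro conjI allI ballI)
  fix js show "continuous_on \<Omega> (iterated_partial js h)"
    using cont[of js] eq by (simp cong: continuous_on_cong)
  fix i x assume x: "x \<in> \<Omega>"
  then obtain D where D: "((\<lambda>t. G js (x + t *\<^sub>R axis i 1)) has_vector_derivative D) (at 0)"
    using diff vector_derivative_works by blast
  have "((\<lambda>t. iterated_partial js h (x + t *\<^sub>R axis i 1)) has_vector_derivative D) (at 0)"
  proof (rule has_vector_derivative_transform_within_open[OF D])
    show "open ((\<lambda>t. x + t *\<^sub>R axis i 1) -` \<Omega>)"
      by (intro open_vimage op continuous_intros)
  qed (use x eq in auto)
  then show "(\<lambda>t. iterated_partial js h (x + t *\<^sub>R axis i 1)) differentiable (at 0)"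
    by (rule differentiableI_vector)
qed

lemma smooth_on_add:
  fixes f :: "real^'d::finite \<Rightarrow> 'k::real_normed_vector"
  assumes op: "open \<Omega>" and f: "smooth_on \<Omega> f" and g: "smooth_on \<Omega> g"
  shows "smooth_on \<Omega> (f + g)"
proof (rule smooth_on_of_iterated[OF op])
  fix js i and x :: "real^'d" assume x: "x \<in> \<Omega>"
  show "iterated_partial js (f + g) x = iterated_partial js f x + iterated_partial js g x"
    by (rule iterated_partial_add[OF op f g x])
  show "(\<lambda>t. iterated_partial js f (x + t *\<^sub>R axis i 1) + iterated_partial js g (x + t *\<^sub>R axis i 1))
      differentiable (at 0)"
    using f g x unfolding smooth_on_def by (intro differentiable_add) auto
qed (intro continuous_on_add smooth_on_continuous f g)

lemma smooth_on_scale: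
  fixes f :: "real^'d::finite \<Rightarrow> 'k::real_normed_field"
  assumes op: "open \<Omega>" and f: "smooth_on \<Omega> f"
  shows "smooth_on \<Omega> (pointwise_scale (*) c f)"
proof (rule smooth_on_of_iterated[OF op])
  fix js i and x :: "real^'d" assume x: "x \<in> \<Omega>"
  show "iterated_partial js (pointwise_scale (*) c f) x = c * iterated_partial js f x"
    by (rule iterated_partial_scale[OF op f x])
  have "(\<lambda>t. iterated_partial js f (x + t *\<^sub>R axis i 1)) differentiable (at 0)"
    using f x unfolding smooth_on_def by auto
  then show "(\<lambda>t. c * iterated_partial js f (x + t *\<^sub>R axis i 1)) differentiable (at 0)"
    by (intro differentiable_mult) auto
qed (intro continuous_intros smooth_on_continuous f)

text \<open>
  The second difference of \<open>f\<close> over a rectangle is compared with the mixed derivative by applying the mean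
  value inequality twice.
\<close>

lemma mixed_difference_bound:
  fixes f :: "real^'d::finite \<Rightarrow> 'k::real_normed_vector"
  assumes f: "smooth_on \<Omega> f" and s: "0 < s"
    and rect: "\<And>\<sigma> \<tau>. \<sigma> \<in> {0..s} \<Longrightarrow> \<tau> \<in> {0..s} \<Longrightarrow> x + \<sigma> *\<^sub>R axis i 1 + \<tau> *\<^sub>R axis j 1 \<in> \<Omega>"
    and near: "\<And>\<sigma> \<tau>. \<sigma> \<in> {0..s} \<Longrightarrow> \<tau> \<in> {0..s} \<Longrightarrow>
      norm (partial j (partial i f) (x + \<sigma> *\<^sub>R axis i 1 + \<tau> *\<^sub>R axis j 1) - D) \<le> \<epsilon>"
  shows "norm (f (x + s *\<^sub>R axis i 1 + s *\<^sub>R axis j 1) - f (x + s *\<^sub>R axis i 1)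
      - (f (x + s *\<^sub>R axis j 1) - f x) - (s * s) *\<^sub>R D) \<le> \<epsilon> * (s * s)"
proof -
  have mvt: "norm (g s - g 0) \<le> B * s"
    if "\<And>t. t \<in> {0..s} \<Longrightarrow> (g has_vector_derivative g' t) (at t)"
      and "\<And>t. t \<in> {0..s} \<Longrightarrow> norm (g' t) \<le> B" for g g' :: "real \<Rightarrow> 'k" and B
  proof -
    have "norm (g s - g 0) \<le> B * s - B * 0"
    proof (rule differentiable_bound_general[OF s, where f' = g' and \<phi>' = "\<lambda>_. B"])
      show "continuous_on {0..s} g"
        using that(1) by (intro continuous_at_imp_continuous_on ballI)
          (blast intro: has_vector_derivative_continuous)
      show "continuous_on {0..s} (\<lambda>t. B * t)" by (intro continuous_intros)
      show "\<And>t. 0 < t \<Longrightarrow> t < s \<Longrightarrow> ((*) B has_vector_derivative B) (at t)"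
        by (auto intro!: derivative_eq_intros)
    qed (use that in auto)
    then show ?thesis by simp
  qed
  define p where "p \<sigma> \<tau> = x + \<sigma> *\<^sub>R axis i 1 + \<tau> *\<^sub>R axis j 1" for \<sigma> \<tau>
  have p': "p \<sigma> \<tau> = x + \<tau> *\<^sub>R axis j 1 + \<sigma> *\<^sub>R axis i 1" for \<sigma> \<tau> by (simp add: p_def)
  note rect = rect[folded p_def] and near = near[folded p_def]
  have inner: "norm (partial i f (p \<sigma> s) - partial i f (p \<sigma> 0) - s *\<^sub>R D) \<le> \<epsilon> * s"
    if \<sigma>: "\<sigma> \<in> {0..s}" for \<sigma>
  proof -
    have "norm ((partial i f (p \<sigma> s) - s *\<^sub>R D) - (partial i f (p \<sigma> 0) - 0 *\<^sub>R D)) \<le> \<epsilon> * s"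
    proof (rule mvt[where g' = "\<lambda>\<tau>. partial j (partial i f) (p \<sigma> \<tau>) - D"])
      fix \<tau> assume \<tau>: "\<tau> \<in> {0..s}"
      have "((\<lambda>\<tau>. \<tau> *\<^sub>R D) has_vector_derivative D) (at \<tau>)"
        by (auto intro!: derivative_eq_intros)
      then show "((\<lambda>\<tau>. partial i f (p \<sigma> \<tau>) - \<tau> *\<^sub>R D) has_vector_derivative
          partial j (partial i f) (p \<sigma> \<tau>) - D) (at \<tau>)"
        using rect[OF \<sigma> \<tau>] unfolding p_def
        by (intro has_vector_derivative_diff partial_has_vector_derivative[OF smooth_on_partial[OF f]])
    qed (rule near[OF \<sigma>])
    then show ?thesis by (simp add: algebra_simps)
  qed
  have "norm ((f (p s s) - f (p s 0) - (s * s) *\<^sub>R D) - (f (p 0 s) - f (p 0 0) - (0 * s) *\<^sub>R D)) \<le> \<epsilon> * s * s"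
  proof (rule mvt[where g' = "\<lambda>\<sigma>. partial i f (p \<sigma> s) - partial i f (p \<sigma> 0) - s *\<^sub>R D"])
    fix \<sigma> assume \<sigma>: "\<sigma> \<in> {0..s}"
    have "((\<lambda>\<sigma>. (\<sigma> * s) *\<^sub>R D) has_vector_derivative s *\<^sub>R D) (at \<sigma>)"
      by (auto intro!: derivative_eq_intros)
    moreover have "p \<sigma> s \<in> \<Omega>" "p \<sigma> 0 \<in> \<Omega>" using rect[OF \<sigma>] s by auto
    ultimately show "((\<lambda>\<sigma>. f (p \<sigma> s) - f (p \<sigma> 0) - (\<sigma> * s) *\<^sub>R D)
        has_vector_derivative partial i f (p \<sigma> s) - partial i f (p \<sigma> 0) - s *\<^sub>R D) (at \<sigma>)"
      unfolding p' by (intro has_vector_derivative_diff partial_has_vector_derivative[OF f])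
  qed (rule inner)
  then show ?thesis by (simp add: p_def algebra_simps)
qed

text \<open>
  Both mixed derivatives are limits of one and the same second difference quotient.
\<close>

lemma partial_commute:
  fixes f :: "real^'d::finite \<Rightarrow> 'k::real_normed_vector"
  assumes op: "open \<Omega>" and f: "smooth_on \<Omega> f" and x: "x \<in> \<Omega>"
  shows "partial i (partial j f) x = partial j (partial i f) x"
proof -
  define D1 where "D1 = partial j (partial i f) x"
  define D2 where "D2 = partial i (partial j f) x"
  have le: "norm (D2 - D1) \<le> 2 * \<epsilon>" if \<epsilon>: "0 < \<epsilon>" for \<epsilon>
  proof -
    have c: "isCont (partial a (partial b f)) x" for a b
      using smooth_on_continuous[OF f, of "[a, b]"] op x
      by (simp add: iterated_partial_Cons continuous_on_eq_continuous_at)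
    have ev: "\<forall>\<^sub>F y in nhds x. norm (partial a (partial b f) y - partial a (partial b f) x) < \<epsilon>" for a b
      using tendstoD[OF c[of a b, unfolded isCont_def tendsto_at_iff_tendsto_nhds] \<epsilon>]
      by (simp add: dist_norm)
    have "\<forall>\<^sub>F y in nhds x. y \<in> \<Omega> \<and> norm (partial j (partial i f) y - D1) < \<epsilon> \<and>
        norm (partial i (partial j f) y - D2) < \<epsilon>"
      unfolding D1_def D2_def
      by (intro eventually_conj ev) (use op x eventually_nhds in blast)
    then obtain \<delta> where \<delta>: "0 < \<delta>" and near: "\<And>y. dist y x < \<delta> \<Longrightarrow>
        y \<in> \<Omega> \<and> norm (partial j (partial i f) y - D1) < \<epsilon> \<and> norm (partial i (partial j f) y - D2) < \<epsilon>"
      unfolding eventually_nhds_metric by blast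
    define s where "s = \<delta> / 3"
    have s: "0 < s" using \<delta> by (simp add: s_def)
    have close: "dist (x + \<sigma> *\<^sub>R axis a 1 + \<tau> *\<^sub>R axis b 1) x < \<delta>"
      if "\<sigma> \<in> {0..s}" "\<tau> \<in> {0..s}" for \<sigma> \<tau> a b
    proof -
      have "dist (x + \<sigma> *\<^sub>R axis a 1 + \<tau> *\<^sub>R axis b 1) x
          = norm (\<sigma> *\<^sub>R axis a (1::real) + \<tau> *\<^sub>R axis b 1)"
        by (simp add: dist_norm add.assoc)
      also have "\<dots> \<le> \<bar>\<sigma>\<bar> + \<bar>\<tau>\<bar>" by (rule order_trans[OF norm_triangle_ineq]) simp
      also have "\<dots> < \<delta>" using that \<delta> by (simp add: s_def)
      finally show ?thesis .
    qed
    define \<Delta> where "\<Delta> = f (x + s *\<^sub>R axis i 1 + s *\<^sub>R axis j 1) - f (x + s *\<^sub>R axis i 1)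
      - (f (x + s *\<^sub>R axis j 1) - f x)"
    have 1: "norm (\<Delta> - (s * s) *\<^sub>R D1) \<le> \<epsilon> * (s * s)"
      unfolding \<Delta>_def
      by (rule mixed_difference_bound[OF f s]) (use near close in \<open>auto intro: less_imp_le\<close>)
    have "norm (f (x + s *\<^sub>R axis j 1 + s *\<^sub>R axis i 1) - f (x + s *\<^sub>R axis j 1)
      - (f (x + s *\<^sub>R axis i 1) - f x) - (s * s) *\<^sub>R D2) \<le> \<epsilon> * (s * s)"
      by (rule mixed_difference_bound[OF f s]) (use near close in \<open>auto intro: less_imp_le\<close>)
    then have 2: "norm (\<Delta> - (s * s) *\<^sub>R D2) \<le> \<epsilon> * (s * s)"
      by (simp add: \<Delta>_def algebra_simps)
    have "(s * s) *\<^sub>R (D2 - D1) = (\<Delta> - (s * s) *\<^sub>R D1) - (\<Delta> - (s * s) *\<^sub>R D2)"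
      by (simp add: algebra_simps)
    then have "norm ((s * s) *\<^sub>R (D2 - D1)) \<le> norm (\<Delta> - (s * s) *\<^sub>R D1) + norm (\<Delta> - (s * s) *\<^sub>R D2)"
      by (simp only: norm_triangle_ineq4)
    also have "\<dots> \<le> 2 * \<epsilon> * (s * s)" using 1 2 by simp
    finally have "(s * s) * norm (D2 - D1) \<le> (s * s) * (2 * \<epsilon>)" using s by (simp add: mult_ac)
    then show ?thesis using s by simp
  qed
  have "norm (D2 - D1) = 0"
  proof (rule ccontr)
    assume "norm (D2 - D1) \<noteq> 0"
    then show False using le[of "norm (D2 - D1) / 4"] by simp
  qed
  then show ?thesis by (simp add: D1_def D2_def)
qed

lemma iterated_partial_move:
  assumes op: "open \<Omega>" and f: "smooth_on \<Omega> f" and x: "x \<in> \<Omega>"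
  shows "iterated_partial (as @ i # bs) f x = iterated_partial (i # as @ bs) f x"
  using x
proof (induction as arbitrary: x)
  case (Cons a as)
  have "partial a (iterated_partial (as @ i # bs) f) x = partial a (iterated_partial (i # as @ bs) f) x"
    by (rule partial_cong[OF op Cons.prems]) (rule Cons.IH)
  also have "\<dots> = partial i (partial a (iterated_partial (as @ bs) f)) x"
    using partial_commute[OF op smooth_on_iterated[OF f] Cons.prems] by (simp add: iterated_partial_Cons)
  finally show ?case by (simp add: iterated_partial_Cons)
qed simp

lemma iterated_partial_perm:
  assumes op: "open \<Omega>" and f: "smooth_on \<Omega> f" and x: "x \<in> \<Omega>" and "mset as = mset bs"
  shows "iterated_partial as f x = iterated_partial bs f x"
  using x assms(4)
proof (induction as arbitrary: bs x)
  case (Cons i as)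
  then have "i \<in> set bs" by (metis list.set_intros(1) set_mset_mset)
  then obtain us vs where bs: "bs = us @ i # vs" by (meson split_list)
  then have "mset as = mset (us @ vs)" using Cons.prems by simp
  then have "partial i (iterated_partial as f) x = partial i (iterated_partial (us @ vs) f) x"
    using Cons.IH by (intro partial_cong[OF op Cons.prems(1)]) auto
  then show ?case
    using iterated_partial_move[OF op f Cons.prems(1), of us i vs] by (simp add: bs iterated_partial_Cons)
qed simp

definition multi_index_list :: "('d::finite \<Rightarrow> nat) \<Rightarrow> 'd list" where
  "multi_index_list \<alpha> = concat (map (\<lambda>i. replicate (\<alpha> i) i) coordinate_list)"

lemma coordinate_list: "distinct (coordinate_list :: 'd::finite list)" "set (coordinate_list :: 'd list) = UNIV"
proof -
  have "\<exists>js :: 'd list. distinct js \<and> set js = UNIV"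
    using finite_distinct_list[of "UNIV :: 'd set"] by auto
  from someI_ex[OF this]
  show "distinct (coordinate_list :: 'd::finite list)" "set (coordinate_list :: 'd list) = UNIV"
    by (auto simp: coordinate_list_def)
qed

lemma multi_partial_eq_iterated:
  fixes f :: "real^'d::finite \<Rightarrow> 'k::real_normed_vector"
  shows "multi_partial \<alpha> f = iterated_partial (multi_index_list \<alpha>) f"
proof -
  have rep: "foldr partial (replicate n i) g = (partial i ^^ n) g"
    for n i and g :: "real^'d \<Rightarrow> 'k"
    by (induction n) auto
  have "foldr (\<lambda>i. partial i ^^ \<alpha> i) cs f = foldr partial (concat (map (\<lambda>i. replicate (\<alpha> i) i) cs)) f" for cs
    by (induction cs) (auto simp: rep)
  then show ?thesis by (simp add: multi_partial_def iterated_partial_def multi_index_list_def)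
qed

lemma length_multi_index_list: "length (multi_index_list \<alpha>) = (\<Sum>i\<in>UNIV. \<alpha> i)"
  by (simp add: multi_index_list_def length_concat comp_def sum_list_distinct_conv_sum_set coordinate_list)

lemma count_multi_index_list: "count (mset (multi_index_list \<alpha>)) i = \<alpha> i"
proof -
  have "count (mset (concat (map (\<lambda>i. replicate (\<alpha> i) i) cs))) i = (if i \<in> set cs then \<alpha> i else 0)"
    if "distinct cs" for cs
    using that by (induction cs) auto
  then show ?thesis by (simp add: multi_index_list_def coordinate_list)
qed

text \<open>
  In this form bounds for multi-indices apply to derivatives taken in any order.
\<close>

lemma iterated_partial_eq_multi:
  assumes "open \<Omega>" "smooth_on \<Omega> f" "x \<in> \<Omega>"
  shows "iterated_partial js f x = multi_partial (count_list js) f x"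
  unfolding multi_partial_eq_iterated
proof (rule iterated_partial_perm[OF assms])
  show "mset js = mset (multi_index_list (count_list js))"
    by (rule multiset_eqI) (simp only: count_multi_index_list count_mset[symmetric])
qed

section \<open>Seminorms given by integrals of squares\<close>

context hermitian_carrier
begin

definition hilbert_schmidt_above :: "('v \<Rightarrow> real) \<Rightarrow> ('v \<Rightarrow> real) \<Rightarrow> bool" where
  "hilbert_schmidt_above h q \<longleftrightarrow>
     (\<forall>B' h' K. 0 \<le> K \<and> hermitian_form B' h' \<and> (\<forall>x\<in>E. q x \<le> K * h' x) \<longrightarrow> hilbert_schmidt h B' h')"

text \<open>
  The definition imitates, with a Hermitian seminorm in between, that the canonical map from \<open>(E, q)\<close> to \<open>(E, p)\<close> is
  absolutely \<open>2\<close>-summing.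
\<close>

definition hilbert_summing :: "('v \<Rightarrow> real) \<Rightarrow> ('v \<Rightarrow> real) \<Rightarrow> bool" where
  "hilbert_summing p q \<longleftrightarrow>
     (\<exists>B h C. 0 \<le> C \<and> hermitian_form B h \<and> (\<forall>x\<in>E. p x \<le> C * h x) \<and> (\<forall>x\<in>E. h x \<le> C * q x) \<and>
        hilbert_schmidt_above h q)"

lemma hilbert_schmidt_mono:
  assumes p: "seminorm_on smul E p" and h: "seminorm_on smul E h"
    and le: "0 \<le> C" "\<And>x. x \<in> E \<Longrightarrow> p x \<le> C * h x" and HS: "hilbert_schmidt h B h'"
  shows "hilbert_schmidt p B h'"
proof -
  from HS obtain K D where K: "0 \<le> K" "\<forall>x\<in>E. h x \<le> K * h' x"
    and D: "\<forall>e N. orthonormal B h' e \<longrightarrow> (\<Sum>i<N. (h (e i))\<^sup>2) \<le> D"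
    unfolding hilbert_schmidt_def by (elim conjE exE) (rule that)
  have 1: "p x \<le> (C * K) * h' x" if x: "x \<in> E" for x
    using le(2)[OF x] mult_left_mono[OF bspec[OF K(2) x] le(1)] by (simp add: mult.assoc)
  have 2: "(\<Sum>i<N. (p (e i))\<^sup>2) \<le> C\<^sup>2 * D" if e: "orthonormal B h' e" for e N
  proof -
    have E: "e i \<in> E" for i using e by (simp add: orthonormal_def)
    have "(\<Sum>i<N. (p (e i))\<^sup>2) \<le> (\<Sum>i<N. (C * h (e i))\<^sup>2)"
      by (intro sum_mono power_mono le seminorm_nonneg[OF p] E)
    also have "\<dots> = C\<^sup>2 * (\<Sum>i<N. (h (e i))\<^sup>2)"
      by (simp add: power_mult_distrib sum_distrib_left)
    also have "\<dots> \<le> C\<^sup>2 * D" using D e by (intro mult_left_mono) auto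
    finally show ?thesis .
  qed
  show ?thesis
    unfolding hilbert_schmidt_def
  proof (intro conjI exI allI impI ballI)
    show "0 \<le> C * K" using le K by simp
    show "p x \<le> (C * K) * h' x" if "x \<in> E" for x by (rule 1[OF that])
    show "(\<Sum>i<N. (p (e i))\<^sup>2) \<le> C\<^sup>2 * D" if "orthonormal B h' e" for e N by (rule 2[OF that])
  qed
qed

end

text \<open>
  The functionals \<open>b j t\<close> are integrated over \<open>t\<close> and summed over a finite set of indices \<open>j\<close>; in the application \<open>t\<close> is
  a point of evaluation and \<open>j\<close> the order of a derivative.
\<close>

locale square_integral_form = hermitian_carrier smul E cj
  for smul :: "'k::{real_normed_field, banach, second_countable_topology} \<Rightarrow> 'v::ab_group_add \<Rightarrow> 'v"
    and E :: "'v set" and cj :: "'k \<Rightarrow> 'k" +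
  fixes J :: "'j set" and \<mu> :: "'t measure" and b :: "'j \<Rightarrow> 't \<Rightarrow> 'v \<Rightarrow> 'k" and q :: "'v \<Rightarrow> real"
  assumes finite_J: "finite J" and finite_mu: "finite_measure \<mu>"
    and b_linear: "j \<in> J \<Longrightarrow> t \<in> space \<mu> \<Longrightarrow> linear_functional_on smul E (b j t)"
    and b_measurable: "j \<in> J \<Longrightarrow> x \<in> E \<Longrightarrow> (\<lambda>t. b j t x) \<in> borel_measurable \<mu>"
    and b_bound: "j \<in> J \<Longrightarrow> t \<in> space \<mu> \<Longrightarrow> x \<in> E \<Longrightarrow> norm (b j t x) \<le> q x"
    and q_seminorm: "seminorm_on smul E q"
begin

definition "form x y = (\<Sum>j\<in>J. \<integral>t. b j t x * cj (b j t y) \<partial>\<mu>)"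

definition "form_norm x = sqrt (\<Sum>j\<in>J. \<integral>t. (norm (b j t x))\<^sup>2 \<partial>\<mu>)"

lemma q_nonneg: "x \<in> E \<Longrightarrow> 0 \<le> q x"
  by (rule seminorm_nonneg[OF q_seminorm])

lemma cj_measurable [measurable]: "cj \<in> borel_measurable borel"
  by (intro borel_measurable_continuous_onI linear_continuous_on bounded_linear_cj)

lemma integrable_product:
  assumes j: "j \<in> J" and x: "x \<in> E" "y \<in> E"
  shows "integrable \<mu> (\<lambda>t. b j t x * cj (b j t y))"
proof (rule finite_measure.integrable_const_bound[OF finite_mu, where B = "q x * q y"])
  note [measurable] = b_measurable[OF j x(1)] b_measurable[OF j x(2)]
  show "(\<lambda>t. b j t x * cj (b j t y)) \<in> borel_measurable \<mu>" by measurable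
  show "AE t in \<mu>. norm (b j t x * cj (b j t y)) \<le> q x * q y"
    using b_bound[OF j] x q_nonneg by (intro AE_I2) (auto simp: norm_mult intro!: mult_mono)
qed

lemma integrable_square:
  assumes j: "j \<in> J" and x: "x \<in> E"
  shows "integrable \<mu> (\<lambda>t. (norm (b j t x))\<^sup>2)"
proof (rule finite_measure.integrable_const_bound[OF finite_mu, where B = "(q x)\<^sup>2"])
  note [measurable] = b_measurable[OF j x]
  show "(\<lambda>t. (norm (b j t x))\<^sup>2) \<in> borel_measurable \<mu>" by measurable
  show "AE t in \<mu>. norm ((norm (b j t x))\<^sup>2) \<le> (q x)\<^sup>2"
    using b_bound[OF j _ x] by (intro AE_I2) (auto intro!: power_mono)
qed

lemma integrable_norm_b:
  assumes j: "j \<in> J" and x: "x \<in> E"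
  shows "integrable \<mu> (\<lambda>t. norm (b j t x))"
proof (rule finite_measure.integrable_const_bound[OF finite_mu, where B = "q x"])
  note [measurable] = b_measurable[OF j x]
  show "(\<lambda>t. norm (b j t x)) \<in> borel_measurable \<mu>" by measurable
  show "AE t in \<mu>. norm (norm (b j t x)) \<le> q x"
    using b_bound[OF j _ x] by (intro AE_I2) auto
qed

lemma form_norm_square: "(form_norm x)\<^sup>2 = (\<Sum>j\<in>J. \<integral>t. (norm (b j t x))\<^sup>2 \<partial>\<mu>)"
  by (simp add: form_norm_def sum_nonneg)

lemma hermitian_form_form: "hermitian_form form form_norm"
  unfolding hermitian_form_def
proof (intro conjI ballI allI)
  fix x y z assume x: "x \<in> E" "y \<in> E" "z \<in> E"
  have "(\<integral>t. b j t (x + y) * cj (b j t z) \<partial>\<mu>)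
      = (\<integral>t. b j t x * cj (b j t z) \<partial>\<mu>) + (\<integral>t. b j t y * cj (b j t z) \<partial>\<mu>)" if j: "j \<in> J" for j
  proof -
    have "(\<integral>t. b j t (x + y) * cj (b j t z) \<partial>\<mu>)
        = (\<integral>t. b j t x * cj (b j t z) + b j t y * cj (b j t z) \<partial>\<mu>)"
      using b_linear[OF j] x
      by (intro Bochner_Integration.integral_cong) (auto simp: linear_functional_on_def distrib_right)
    then show ?thesis using integrable_product[OF j] x by simp
  qed
  then show "form (x + y) z = form x z + form y z" by (simp add: form_def sum.distrib)
next
  fix c x z assume x: "x \<in> E" "z \<in> E"
  have "(\<integral>t. b j t (smul c x) * cj (b j t z) \<partial>\<mu>) = c * (\<integral>t. b j t x * cj (b j t z) \<partial>\<mu>)"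
    if j: "j \<in> J" for j
  proof -
    have "(\<integral>t. b j t (smul c x) * cj (b j t z) \<partial>\<mu>) = (\<integral>t. c * (b j t x * cj (b j t z)) \<partial>\<mu>)"
      using b_linear[OF j] x
      by (intro Bochner_Integration.integral_cong) (auto simp: linear_functional_on_def mult.assoc)
    then show ?thesis by simp
  qed
  then show "form (smul c x) z = c * form x z" by (simp add: form_def sum_distrib_left)
next
  fix x y assume x: "x \<in> E" "y \<in> E"
  have "cj (\<integral>t. b j t x * cj (b j t y) \<partial>\<mu>) = (\<integral>t. b j t y * cj (b j t x) \<partial>\<mu>)" if j: "j \<in> J" for j
  proof -
    have "cj (\<integral>t. b j t x * cj (b j t y) \<partial>\<mu>) = (\<integral>t. cj (b j t x * cj (b j t y)) \<partial>\<mu>)"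
      by (rule integral_bounded_linear[OF bounded_linear_cj integrable_product[OF j x], symmetric])
    then show ?thesis by (simp add: cj_mult mult.commute)
  qed
  then show "form y x = cj (form x y)" by (simp add: form_def cj_sum)
next
  fix x assume x: "x \<in> E"
  show "0 \<le> form_norm x" by (simp add: form_norm_def sum_nonneg)
  have "(\<integral>t. b j t x * cj (b j t x) \<partial>\<mu>) = of_real (\<integral>t. (norm (b j t x))\<^sup>2 \<partial>\<mu>)"
    if j: "j \<in> J" for j
    using integral_bounded_linear[OF bounded_linear_of_real integrable_square[OF j x]]
    by (simp only: mult_cj)
  then show "form x x = of_real ((form_norm x)\<^sup>2)" by (simp add: form_def form_norm_square)
qed

lemma form_norm_le: 
  assumes x: "x \<in> E"
  shows "form_norm x \<le> sqrt (card J * measure \<mu> (space \<mu>)) * q x"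
proof -
  have "(\<integral>t. (norm (b j t x))\<^sup>2 \<partial>\<mu>) \<le> measure \<mu> (space \<mu>) * (q x)\<^sup>2" if j: "j \<in> J" for j
  proof -
    have "(\<integral>t. (norm (b j t x))\<^sup>2 \<partial>\<mu>) \<le> (\<integral>t. (q x)\<^sup>2 \<partial>\<mu>)"
      using b_bound[OF j _ x] finite_measure.integrable_const[OF finite_mu]
      by (intro integral_mono integrable_square[OF j x]) (auto intro: power_mono)
    then show ?thesis by simp
  qed
  then have "(\<Sum>j\<in>J. \<integral>t. (norm (b j t x))\<^sup>2 \<partial>\<mu>) \<le> card J * (measure \<mu> (space \<mu>) * (q x)\<^sup>2)"
    by (rule sum_bounded_above)
  then have "form_norm x \<le> sqrt (card J * measure \<mu> (space \<mu>) * (q x)\<^sup>2)"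
    unfolding form_norm_def by (simp add: mult.assoc)
  then show ?thesis using q_nonneg[OF x] by (simp add: real_sqrt_mult)
qed

text \<open>By Bessel's inequality for each of the functionals \<open>b j t\<close>.\<close>

lemma form_norm_hilbert_schmidt:
  assumes H: "hermitian_form B' h'" and K: "0 \<le> K" "\<And>x. x \<in> E \<Longrightarrow> q x \<le> K * h' x"
  shows "hilbert_schmidt form_norm B' h'"
proof -
  define M where "M = measure \<mu> (space \<mu>)"
  have 1: "form_norm x \<le> (sqrt (card J * M) * K) * h' x" if x: "x \<in> E" for x
    using form_norm_le[OF x] mult_left_mono[OF K(2)[OF x], of "sqrt (card J * M)"]
    by (simp add: M_def mult.assoc)
  have 2: "(\<Sum>i<N. (form_norm (e i))\<^sup>2) \<le> card J * (M * K\<^sup>2)" if e: "orthonormal B' h' e" for e N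
  proof -
    have E: "e i \<in> E" for i using e by (simp add: orthonormal_def)
    have "(\<Sum>i<N. \<integral>t. (norm (b j t (e i)))\<^sup>2 \<partial>\<mu>) \<le> M * K\<^sup>2" if j: "j \<in> J" for j
    proof -
      have "(\<Sum>i<N. \<integral>t. (norm (b j t (e i)))\<^sup>2 \<partial>\<mu>) = (\<integral>t. (\<Sum>i<N. (norm (b j t (e i)))\<^sup>2) \<partial>\<mu>)"
        by (rule Bochner_Integration.integral_sum[symmetric]) (rule integrable_square[OF j E])
      also have "\<dots> \<le> (\<integral>t. K\<^sup>2 \<partial>\<mu>)"
      proof (rule integral_mono)
        show "integrable \<mu> (\<lambda>t. \<Sum>i<N. (norm (b j t (e i)))\<^sup>2)"
          by (intro Bochner_Integration.integrable_sum integrable_square[OF j E])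
        show "integrable \<mu> (\<lambda>t. K\<^sup>2)" by (rule finite_measure.integrable_const[OF finite_mu])
        fix t assume t: "t \<in> space \<mu>"
        have "norm (b j t x) \<le> K * h' x" if "x \<in> E" for x
          using b_bound[OF j t that] K(2)[OF that] by linarith
        then show "(\<Sum>i<N. (norm (b j t (e i)))\<^sup>2) \<le> K\<^sup>2"
          by (rule bessel_functional[OF H e b_linear[OF j t] K(1)])
      qed
      also have "\<dots> = M * K\<^sup>2" by (simp add: M_def)
      finally show ?thesis .
    qed
    then have "(\<Sum>j\<in>J. \<Sum>i<N. \<integral>t. (norm (b j t (e i)))\<^sup>2 \<partial>\<mu>) \<le> card J * (M * K\<^sup>2)"
      by (rule sum_bounded_above)
    then show ?thesis unfolding form_norm_square by (subst sum.swap) simp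
  qed
  show ?thesis
    unfolding hilbert_schmidt_def
  proof (intro conjI exI allI impI ballI)
    show "0 \<le> sqrt (card J * M) * K" using K by (simp add: M_def)
    show "form_norm x \<le> (sqrt (card J * M) * K) * h' x" if "x \<in> E" for x by (rule 1[OF that])
    show "(\<Sum>i<N. (form_norm (e i))\<^sup>2) \<le> card J * (M * K\<^sup>2)" if "orthonormal B' h' e" for e N
      by (rule 2[OF that])
  qed
qed

lemma integral_norm_le_form_norm:
  assumes x: "x \<in> E"
  shows "(\<Sum>j\<in>J. \<integral>t. norm (b j t x) \<partial>\<mu>) \<le> card J * sqrt (measure \<mu> (space \<mu>)) * form_norm x"
proof -
  define M where "M = measure \<mu> (space \<mu>)"
  have "(\<integral>t. norm (b j t x) \<partial>\<mu>) \<le> sqrt M * form_norm x" if j: "j \<in> J" for j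
  proof -
    define c where "c = (\<integral>t. norm (b j t x) \<partial>\<mu>)"
    define s where "s = (\<integral>t. (norm (b j t x))\<^sup>2 \<partial>\<mu>)"
    note int = integrable_norm_b[OF j x] integrable_square[OF j x]
      finite_measure.integrable_const[OF finite_mu]
    have "c\<^sup>2 \<le> M * s"
    proof (cases "M = 0")
      case True
      have "c \<le> (\<integral>t. q x \<partial>\<mu>)"
        unfolding c_def using b_bound[OF j _ x] by (intro integral_mono int) auto
      moreover have "0 \<le> c" by (simp add: c_def)
      ultimately show ?thesis using True by (simp add: M_def)
    next
      case False
      then have M: "0 < M" by (simp add: M_def zero_less_measure_iff)
      \<comment> \<open>The Cauchy-Schwarz inequality, from the variance of \<open>norm (b j t x)\<close>.\<close>
      have "0 \<le> (\<integral>t. (M * norm (b j t x) - c)\<^sup>2 \<partial>\<mu>)" by (intro integral_nonneg_AE) auto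
      also have "\<dots> = (\<integral>t. M\<^sup>2 * (norm (b j t x))\<^sup>2 - (2 * M * c) * norm (b j t x) + c\<^sup>2 \<partial>\<mu>)"
        by (intro Bochner_Integration.integral_cong) (auto simp: power2_eq_square algebra_simps)
      also have "\<dots> = M\<^sup>2 * s - (2 * M * c) * c + M * c\<^sup>2"
      proof -
        have i1: "integrable \<mu> (\<lambda>t. M\<^sup>2 * (norm (b j t x))\<^sup>2)"
          and i2: "integrable \<mu> (\<lambda>t. (2 * M * c) * norm (b j t x))"
          and i3: "integrable \<mu> (\<lambda>t. c\<^sup>2)"
          using int by auto
        show ?thesis
          unfolding Bochner_Integration.integral_add[OF Bochner_Integration.integrable_diff[OF i1 i2] i3]
            Bochner_Integration.integral_diff[OF i1 i2]
          by (simp add: c_def s_def M_def)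
      qed
      also have "\<dots> = M * (M * s - c\<^sup>2)" by (simp add: power2_eq_square algebra_simps)
      finally show ?thesis using M by (simp add: zero_le_mult_iff)
    qed
    then have "c \<le> sqrt (M * s)" by (rule real_le_rsqrt)
    also have "\<dots> = sqrt M * sqrt s" by (rule real_sqrt_mult)
    also have "\<dots> \<le> sqrt M * form_norm x"
      unfolding form_norm_def s_def M_def using j finite_J
      by (intro mult_left_mono real_sqrt_le_mono member_le_sum) auto
    finally show ?thesis by (simp add: c_def)
  qed
  then have "(\<Sum>j\<in>J. \<integral>t. norm (b j t x) \<partial>\<mu>) \<le> card J * (sqrt M * form_norm x)"
    by (rule sum_bounded_above)
  then show ?thesis by (simp add: M_def mult.assoc)
qed

lemma hilbert_summingI:
  assumes C: "0 \<le> C" and p: "\<And>x. x \<in> E \<Longrightarrow> p x \<le> C * (\<Sum>j\<in>J. \<integral>t. norm (b j t x) \<partial>\<mu>)"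
  shows "hilbert_summing p q"
proof -
  define M where "M = measure \<mu> (space \<mu>)"
  define D where "D = max (C * (card J * sqrt M)) (sqrt (card J * M))"
  have nn: "0 \<le> form_norm x" for x by (simp add: form_norm_def sum_nonneg)
  have "p x \<le> D * form_norm x" if x: "x \<in> E" for x
  proof -
    have "p x \<le> C * (card J * sqrt M * form_norm x)"
      using p[OF x] mult_left_mono[OF integral_norm_le_form_norm[OF x] C] by (simp add: M_def)
    also have "\<dots> \<le> D * form_norm x"
      using nn[of x] by (simp add: D_def mult.assoc[symmetric] mult_right_mono)
    finally show ?thesis .
  qed
  moreover have "form_norm x \<le> D * q x" if x: "x \<in> E" for x
  proof -
    have "sqrt (card J * M) * q x \<le> D * q x"
      using q_nonneg[OF x] by (intro mult_right_mono) (auto simp: D_def)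
    then show ?thesis using form_norm_le[OF x] by (simp add: M_def)
  qed
  moreover have "0 \<le> D" by (simp add: D_def M_def le_max_iff_disj)
  ultimately show ?thesis
    unfolding hilbert_summing_def hilbert_schmidt_above_def
    using hermitian_form_form form_norm_hilbert_schmidt
    by (intro exI[of _ form] exI[of _ form_norm] exI[of _ D]) auto
qed

end

section \<open>A criterion for nuclearity\<close>

locale hermitian_seminorm_system = seminorm_system smul E P + hermitian_carrier smul E cj
  for smul :: "'k::{real_normed_field, banach} \<Rightarrow> 'v::ab_group_add \<Rightarrow> 'v" and E :: "'v set" and P
    and cj :: "'k \<Rightarrow> 'k"
begin

text \<open>
  Four consecutive comparisons supply the three Hilbert-Schmidt maps of
  \<open>nuclear_of_hilbert_schmidt\<close>: two are composed to a nuclear map, the third one makes the outer space separable.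
\<close>

theorem nuclear_space_criterion:
  assumes summing: "\<And>p. p \<in> P \<Longrightarrow> \<exists>q\<in>P. hilbert_summing p q"
  shows "nuclear_space smul T"
proof -
  have "\<exists>q. continuous_seminorm smul T q \<and> (\<forall>x\<in>topspace T. p x \<le> q x) \<and>
           nuclear_map
             (pointwise_scale smul) (local_banach (topspace T) q) (local_banach_norm q)
             (pointwise_scale smul) (local_banach (topspace T) p) (local_banach_norm p)
             (\<lambda>u. u)" if p: "continuous_seminorm smul T p" for p
  proof -
    have sp: "seminorm_on smul E p" using p by (simp add: continuous_seminorm_def)
    obtain q0 C where q0: "q0 \<in> P" "0 < C" and pq0: "\<And>x. x \<in> E \<Longrightarrow> p x \<le> C * q0 x"
      by (rule continuous_seminorm_bounded[OF p]) blast
    obtain q1 where q1: "q1 \<in> P" "hilbert_summing q0 q1" using summing[OF q0(1)] by blast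
    obtain q2 where q2: "q2 \<in> P" "hilbert_summing q1 q2" using summing[OF q1(1)] by blast
    obtain q3 where q3: "q3 \<in> P" "hilbert_summing q2 q3" using summing[OF q2(1)] by blast
    obtain q4 where q4: "q4 \<in> P" "hilbert_summing q3 q4" using summing[OF q3(1)] by blast
    from q1(2) obtain B0 h0 C0 where h0: "0 \<le> C0" "hermitian_form B0 h0" "\<forall>x\<in>E. q0 x \<le> C0 * h0 x"
      and HS0: "hilbert_schmidt_above h0 q1"
      unfolding hilbert_summing_def by (elim exE conjE) (rule that)
    from q2(2) obtain B1 h1 C1 where h1: "0 \<le> C1" "hermitian_form B1 h1" "\<forall>x\<in>E. q1 x \<le> C1 * h1 x"
      and HS1: "hilbert_schmidt_above h1 q2"
      unfolding hilbert_summing_def by (elim exE conjE) (rule that)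
    from q3(2) obtain B2 h2 C2 where h2: "0 \<le> C2" "hermitian_form B2 h2" "\<forall>x\<in>E. q2 x \<le> C2 * h2 x"
        "\<forall>x\<in>E. h2 x \<le> C2 * q3 x"
      and HS2: "hilbert_schmidt_above h2 q3"
      unfolding hilbert_summing_def by (elim exE conjE) (rule that)
    from q4(2) obtain B3 h3 C3 where h3: "0 \<le> C3" "hermitian_form B3 h3" "\<forall>x\<in>E. q3 x \<le> C3 * h3 x"
      unfolding hilbert_summing_def by (elim exE conjE) (rule that)
    have "hilbert_schmidt h0 B1 h1" by (rule HS0[unfolded hilbert_schmidt_above_def, rule_format, OF conjI[OF h1(1) conjI[OF h1(2,3)]]])
    moreover have "p x \<le> (C * C0) * h0 x" if x: "x \<in> E" for x
    proof -
      have "C * q0 x \<le> C * (C0 * h0 x)"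
        using bspec[OF h0(3) x] q0(2) by (intro mult_left_mono) auto
      then show ?thesis using pq0[OF x] by (simp add: mult.assoc)
    qed
    ultimately have p_HS: "hilbert_schmidt p B1 h1"
      using q0(2) h0(1) by (intro hilbert_schmidt_mono[OF sp form_seminorm[OF h0(2)], of "C * C0"]) auto
    have h1_HS: "hilbert_schmidt h1 B2 h2" by (rule HS1[unfolded hilbert_schmidt_above_def, rule_format, OF conjI[OF h2(1) conjI[OF h2(2,3)]]])
    have h2_HS: "hilbert_schmidt h2 B3 h3" by (rule HS2[unfolded hilbert_schmidt_above_def, rule_format, OF conjI[OF h3(1) conjI[OF h3(2,3)]]])
    obtain s where s: "s \<in> P" "\<forall>x\<in>E. q0 x \<le> s x \<and> q3 x \<le> s x" using directed[OF q0(1) q3(1)] by blast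
    define K where "K = max C 1"
    define q where "q x = K * s x" for x
    have q: "continuous_seminorm smul T q"
      unfolding q_def by (rule continuous_seminormI[OF s(1)]) (simp add: K_def)
    then have sq: "seminorm_on smul E q" by (simp add: continuous_seminorm_def)
    have s0: "0 \<le> s x" if "x \<in> E" for x by (rule seminorm_nonneg[OF seminorms[OF s(1)] that])
    have pq: "p x \<le> q x" if x: "x \<in> E" for x
    proof -
      have "p x \<le> C * q0 x" by (rule pq0[OF x])
      also have "\<dots> \<le> C * s x" using s(2) x q0(2) by (intro mult_left_mono) auto
      also have "\<dots> \<le> K * s x" using s0[OF x] by (intro mult_right_mono) (auto simp: K_def)
      finally show ?thesis by (simp add: q_def)
    qed
    have h2q: "h2 x \<le> C2 * q x" if x: "x \<in> E" for x
    proof -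
      have "1 * s x \<le> K * s x" using s0[OF x] by (intro mult_right_mono) (auto simp: K_def)
      then have "q3 x \<le> q x" using s(2) x by (auto simp: q_def intro: order_trans)
      then have "C2 * q3 x \<le> C2 * q x" using h2(1) by (rule mult_left_mono)
      then show ?thesis using h2(4) x by (auto intro: order_trans)
    qed
    have "nuclear_map smul E q smul E p (\<lambda>x. x)"
      by (rule nuclear_of_hilbert_schmidt[OF sp h1(2) h2(2) h3(2) p_HS h1_HS h2_HS h2(1) h2q])
    from nuclear_map_local_banach[OF sp sq pq this] show ?thesis
      using q pq by (intro exI[of _ q]) simp
  qed
  then show ?thesis using locally_convex by (simp add: nuclear_space_def)
qed

end

section \<open>A Sobolev inequality on cubes\<close>

text \<open>
  \<open>g 0\<close> differs from \<open>g s\<close> by at most the integral of \<open>norm (g' t)\<close>; then take the average over \<open>s\<close>. The bound \<open>r \<le> 1\<close>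
  allows one common factor \<open>1 / r\<close> for both terms.
\<close>

lemma norm_le_average:
  fixes g :: "real \<Rightarrow> 'a::banach"
  assumes r: "0 < r" "r \<le> 1"
    and deriv: "\<And>t. t \<in> {0..r} \<Longrightarrow> (g has_vector_derivative g' t) (at t)"
    and cont: "continuous_on {0..r} g'"
  shows "norm (g 0) \<le> (1 / r) * integral {0..r} (\<lambda>t. norm (g t) + norm (g' t))"
proof -
  define I where "I = integral {0..r} (\<lambda>t. norm (g' t))"
  have contg: "continuous_on {0..r} g"
    by (intro continuous_at_imp_continuous_on ballI has_vector_derivative_continuous[OF deriv])
  have ig: "(\<lambda>t. norm (g t)) integrable_on {0..r}"
    by (intro integrable_continuous_interval continuous_on_norm contg)
  have ig': "(\<lambda>t. norm (g' t)) integrable_on {0..s}" if "s \<le> r" for s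
    by (intro integrable_continuous_interval continuous_on_norm continuous_on_subset[OF cont]) (use that in auto)
  have I0: "0 \<le> I" unfolding I_def by (intro integral_nonneg ig') auto
  have le: "norm (g 0) \<le> norm (g s) + I" if s: "s \<in> {0..r}" for s
  proof -
    have sub: "{0..s} \<subseteq> {0..r}" using s by auto
    have "(g' has_integral (g s - g 0)) {0..s}"
    proof (rule fundamental_theorem_of_calculus)
      show "(g has_vector_derivative g' t) (at t within {0..s})" if "t \<in> {0..s}" for t
        by (rule has_vector_derivative_at_within[OF deriv]) (use that s in auto)
    qed (use s in simp)
    then have "norm (g s - g 0) = norm (integral {0..s} g')" by (simp add: integral_unique)
    also have "\<dots> \<le> integral {0..s} (\<lambda>t. norm (g' t))"
    proof (rule integral_norm_bound_integral)
      show "g' integrable_on {0..s}"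
        by (rule integrable_continuous_interval[OF continuous_on_subset[OF cont sub]])
      show "(\<lambda>t. norm (g' t)) integrable_on {0..s}" using s by (intro ig') simp
    qed simp
    also have "\<dots> \<le> I"
      unfolding I_def using s by (intro integral_subset_le sub ig') auto
    finally show ?thesis using norm_triangle_sub[of "g 0" "g s"] by (simp add: norm_minus_commute)
  qed
  have "r * norm (g 0) = integral {0..r} (\<lambda>s. norm (g 0))" using r by simp
  also have "\<dots> \<le> integral {0..r} (\<lambda>s. norm (g s) + I)"
    by (intro integral_le integrable_add ig le) auto
  also have "\<dots> = integral {0..r} (\<lambda>s. norm (g s)) + r * I"
    using r by (subst integral_add[OF ig]) auto
  also have "\<dots> \<le> integral {0..r} (\<lambda>s. norm (g s)) + I"
    using r I0 mult_right_mono[of r 1 I] by simp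
  also have "\<dots> = integral {0..r} (\<lambda>t. norm (g t) + norm (g' t))"
    unfolding I_def by (rule integral_add[symmetric, OF ig ig']) simp
  finally show ?thesis using r by (simp add: field_simps)
qed

text \<open>
  The sum runs over lists of coordinates, that is, a mixed derivative is counted once for each order of
  differentiation. Differentiating once more prepends a coordinate, which is injective on lists.
\<close>

definition derivative_sum :: "nat \<Rightarrow> (real^'d::finite \<Rightarrow> 'k::real_normed_vector) \<Rightarrow> real^'d \<Rightarrow> real" where
  "derivative_sum m f x = (\<Sum>js\<in>{js. length js \<le> m}. norm (iterated_partial js f x))"

lemma finite_lists_le [simp]: "finite {js :: 'd::finite list. length js \<le> m}"
  using finite_lists_length_le[of "UNIV :: 'd set" m] by simp

lemma derivative_sum_nonneg [simp]: "0 \<le> derivative_sum m f x"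
  by (simp add: derivative_sum_def sum_nonneg)

lemma continuous_on_derivative_sum: "smooth_on \<Omega> f \<Longrightarrow> continuous_on \<Omega> (derivative_sum m f)"
  unfolding derivative_sum_def
  by (intro continuous_on_sum continuous_on_norm smooth_on_continuous)

lemma derivative_sum_Suc:
  fixes i :: "'d::finite"
  shows "(\<Sum>js\<in>{js. length js \<le> m}. norm (iterated_partial js f x) + norm (iterated_partial (i # js) f x))
    \<le> 2 * derivative_sum (Suc m) f x"
proof -
  have "(\<Sum>js\<in>{js. length js \<le> m}. norm (iterated_partial js f x)) \<le> derivative_sum (Suc m) f x"
    unfolding derivative_sum_def by (intro sum_mono2) auto
  moreover have "(\<Sum>js\<in>{js. length js \<le> m}. norm (iterated_partial (i # js) f x))
      = (\<Sum>js\<in>(#) i ` {js. length js \<le> m}. norm (iterated_partial js f x))"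
    by (subst sum.reindex) auto
  moreover have "\<dots> \<le> derivative_sum (Suc m) f x"
    unfolding derivative_sum_def by (intro sum_mono2) auto
  ultimately show ?thesis by (simp add: sum.distrib)
qed

lemma derivative_sum_average:
  fixes f :: "real^'d::finite \<Rightarrow> 'k::{real_normed_vector, banach}"
  assumes f: "smooth_on \<Omega> f" and r: "0 < r" "r \<le> 1"
    and seg: "\<And>t. t \<in> {0..r} \<Longrightarrow> y + t *\<^sub>R axis i 1 \<in> \<Omega>"
  shows "ennreal (derivative_sum m f y) \<le> ennreal (2 / r) *
    (\<integral>\<^sup>+t. ennreal (derivative_sum (Suc m) f (y + t *\<^sub>R axis i 1)) * indicator {0..r} t \<partial>lborel)"
proof -
  define L where "L = {js :: 'd list. length js \<le> m}"
  define G where "G js t = iterated_partial js f (y + t *\<^sub>R axis i 1)" for js t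
  define u where "u t = derivative_sum (Suc m) f (y + t *\<^sub>R axis i 1)" for t
  have cont: "continuous_on {0..r} (G js)" for js
    unfolding G_def by (rule continuous_on_compose2[OF smooth_on_continuous[OF f]])
      (use seg in \<open>auto intro!: continuous_intros\<close>)
  have contU: "continuous_on {0..r} u"
    unfolding u_def derivative_sum_def by (intro continuous_on_sum continuous_on_norm cont[unfolded G_def])
  have int: "(\<lambda>t. norm (G js t)
      + norm (G (i # js) t)) integrable_on {0..r}" for js
    by (intro integrable_continuous_interval continuous_intros cont)
  have u0 [simp]: "0 \<le> u t" for t by (simp add: u_def)
  have le_u: "(\<Sum>js\<in>{js. length js \<le> m}. norm (G js t) + norm (G (i # js) t)) \<le> 2 * u t" for t
    unfolding G_def u_def by (rule derivative_sum_Suc)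
  have "derivative_sum m f y \<le> (\<Sum>js\<in>L. (1 / r) * integral {0..r}
      (\<lambda>t. norm (G js t)
        + norm (G (i # js) t)))"
    unfolding derivative_sum_def L_def
  proof (rule sum_mono)
    fix js
    show "norm (iterated_partial js f y) \<le> (1 / r) * integral {0..r}
      (\<lambda>t. norm (G js t)
        + norm (G (i # js) t))"
      using norm_le_average[OF r, of "G js" "G (i # js)", OF _ cont]
        partial_has_vector_derivative[OF smooth_on_iterated[OF f, of js] seg]
      unfolding G_def iterated_partial_Cons by simp
  qed
  also have "\<dots> = (1 / r) * integral {0..r} (\<lambda>t. \<Sum>js\<in>L. norm (G js t)
        + norm (G (i # js) t))"
    unfolding L_def by (subst integral_sum) (auto intro: int simp: sum_distrib_left)
  also have "\<dots> \<le> (1 / r) * integral {0..r} (\<lambda>t. 2 * u t)"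
    unfolding L_def using r
    by (intro mult_left_mono integral_le integrable_sum int le_u
        integrable_continuous_interval continuous_intros contU) auto
  also have "\<dots> = (2 / r) * integral {0..r} (\<lambda>t. u t)"
    by simp
  finally have "ennreal (derivative_sum m f y)
      \<le> ennreal ((2 / r) * integral {0..r} (\<lambda>t. u t))"
    by (rule ennreal_leI)
  also have "\<dots> = ennreal (2 / r) * ennreal (integral {0..r} (\<lambda>t. u t))"
    using r by (intro ennreal_mult integral_nonneg integrable_continuous_interval contU) auto
  also have "ennreal (integral {0..r} (\<lambda>t. u t))
      = (\<integral>\<^sup>+t. ennreal (u t) * indicator {0..r} t \<partial>lborel)"
    by (rule nn_integral_has_integral_lebesgue'[symmetric])
      (auto intro!: integrable_integral integrable_continuous_interval contU)
  finally show ?thesis by (simp only: u_def)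
qed

text \<open>
  The averages over the coordinate directions in \<open>I\<close> are taken one after the other and combined by Tonelli's
  theorem. The integrand is cut off outside \<open>\<Omega>\<close> to make it measurable.
\<close>

lemma derivative_sum_iterated_average:
  fixes f :: "real^'d::finite \<Rightarrow> 'k::{real_normed_vector, banach}"
  assumes op: "open \<Omega>" and f: "smooth_on \<Omega> f" and r: "0 < r" "r \<le> 1" and I: "I \<subseteq> Basis"
    and cube: "\<And>s. (\<And>b. b \<in> I \<Longrightarrow> s b \<in> {0..r}) \<Longrightarrow> y + (\<Sum>b\<in>I. s b *\<^sub>R b) \<in> \<Omega>"
  shows "ennreal (derivative_sum m f y) \<le> ennreal ((2 / r) ^ card I) *
    (\<integral>\<^sup>+s. ennreal (derivative_sum (m + card I) f (y + (\<Sum>b\<in>I. s b *\<^sub>R b))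
        * indicator \<Omega> (y + (\<Sum>b\<in>I. s b *\<^sub>R b))) *
      (\<Prod>b\<in>I. indicator {0..r} (s b)) \<partial>Pi\<^sub>M I (\<lambda>_. lborel))"
proof -
  have "finite I" using I finite_subset[OF _ finite_Basis] by blast
  then show ?thesis using I cube
  proof (induction I arbitrary: y m rule: finite_induct)
    case empty
    have "y \<in> \<Omega>" using empty.prems(2)[of "\<lambda>_. 0"] by simp
    then show ?case
      by (simp add: PiM_empty nn_integral_count_space_finite)
  next
    case (insert b I)
    interpret product_sigma_finite "\<lambda>_ :: real^'d. lborel :: real measure" by standard
    obtain i where i: "b = axis i 1" using insert.prems(1) by (auto simp: Basis_vec_def)
    have bI: "finite I" "b \<notin> I" using insert.hyps by auto
    have meas: "(\<lambda>z. derivative_sum k f z * indicator \<Omega> z) \<in> borel_measurable borel" for k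
      using borel_measurable_continuous_on_indicator[OF borel_open[OF op] continuous_on_derivative_sum[OF f, of k]]
      by (simp add: mult.commute)
    define F where "F k J y s = ennreal (derivative_sum k f (y + (\<Sum>b\<in>J. s b *\<^sub>R b))
        * indicator \<Omega> (y + (\<Sum>b\<in>J. s b *\<^sub>R b))) * (\<Prod>b\<in>J. indicator {0..r} (s b))"
      for k J y and s :: "real^'d \<Rightarrow> real"
    have Fmeas: "F k J y \<in> borel_measurable (Pi\<^sub>M J (\<lambda>_. lborel))" if "finite J" for k J y
    proof -
      note [measurable] = meas
      show ?thesis unfolding F_def by measurable
    qed
    have IH: "ennreal (derivative_sum k f (y + t *\<^sub>R b)) \<le> ennreal ((2 / r) ^ card I) *
        (\<integral>\<^sup>+s. F (k + card I) I (y + t *\<^sub>R b) s \<partial>Pi\<^sub>M I (\<lambda>_. lborel))" if t: "t \<in> {0..r}" for t k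
      unfolding F_def
    proof (rule insert.IH)
      show "I \<subseteq> Basis" using insert.prems by simp
      fix s :: "real^'d \<Rightarrow> real" assume s: "\<And>c. c \<in> I \<Longrightarrow> s c \<in> {0..r}"
      have "y + (\<Sum>c\<in>insert b I. (s(b := t)) c *\<^sub>R c) \<in> \<Omega>"
        by (rule insert.prems(2)) (use s t in auto)
      moreover have "(\<Sum>c\<in>insert b I. (s(b := t)) c *\<^sub>R c) = t *\<^sub>R b + (\<Sum>c\<in>I. s c *\<^sub>R c)"
        using bI by (auto intro!: sum.cong)
      ultimately show "y + t *\<^sub>R b + (\<Sum>c\<in>I. s c *\<^sub>R c) \<in> \<Omega>" by (simp add: add.assoc)
    qed
    have seg: "y + t *\<^sub>R axis i 1 \<in> \<Omega>" if "t \<in> {0..r}" for t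
    proof -
      have "y + (\<Sum>c\<in>insert b I. ((\<lambda>_. 0)(b := t)) c *\<^sub>R c) \<in> \<Omega>"
        by (rule insert.prems(2)) (use that in auto)
      moreover have "(\<Sum>c\<in>insert b I. ((\<lambda>_. 0)(b := t)) c *\<^sub>R c) = t *\<^sub>R b + (\<Sum>c\<in>I. 0 *\<^sub>R c)"
        using bI by (auto intro!: sum.neutral)
      ultimately show ?thesis by (simp add: i)
    qed
    have F_insert: "F k (insert b I) y (s(b := t)) = F k I (y + t *\<^sub>R b) s * indicator {0..r} t" for k s t
    proof -
      have "(\<Sum>c\<in>insert b I. (s(b := t)) c *\<^sub>R c) = t *\<^sub>R b + (\<Sum>c\<in>I. s c *\<^sub>R c)"
        using bI by (auto intro!: sum.cong)
      moreover have "(\<Prod>c\<in>I. indicator {0..r} ((s(b := t)) c) :: ennreal)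
          = (\<Prod>c\<in>I. indicator {0..r} (s c))"
        by (rule prod.cong) (use bI in auto)
      then have "(\<Prod>c\<in>insert b I. indicator {0..r} ((s(b := t)) c) :: ennreal)
          = indicator {0..r} t * (\<Prod>c\<in>I. indicator {0..r} (s c))"
        unfolding prod.insert[OF bI] by simp
      ultimately show ?thesis by (simp only: F_def) (simp add: add.assoc mult_ac)
    qed
    have "ennreal (derivative_sum m f y) \<le> ennreal (2 / r) *
        (\<integral>\<^sup>+t. ennreal (derivative_sum (Suc m) f (y + t *\<^sub>R b)) * indicator {0..r} t \<partial>lborel)"
      unfolding i by (rule derivative_sum_average[OF f r seg])
    also have "\<dots> \<le> ennreal (2 / r) * (\<integral>\<^sup>+t. ennreal ((2 / r) ^ card I) *
        (\<integral>\<^sup>+s. F (Suc m + card I) (insert b I) y (s(b := t)) \<partial>Pi\<^sub>M I (\<lambda>_. lborel)) \<partial>lborel)"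
    proof (intro mult_left_mono nn_integral_mono)
      fix t :: real
      show "ennreal (derivative_sum (Suc m) f (y + t *\<^sub>R b)) * indicator {0..r} t \<le> ennreal ((2 / r) ^ card I) *
        (\<integral>\<^sup>+s. F (Suc m + card I) (insert b I) y (s(b := t)) \<partial>Pi\<^sub>M I (\<lambda>_. lborel))"
        using IH[of t "Suc m"] unfolding F_insert by (cases "t \<in> {0..r}") auto
    qed simp
    also have "\<dots> = ennreal (2 / r) * (ennreal ((2 / r) ^ card I) *
        (\<integral>\<^sup>+t. (\<integral>\<^sup>+s. F (Suc m + card I) (insert b I) y (s(b := t)) \<partial>Pi\<^sub>M I (\<lambda>_. lborel)) \<partial>lborel))"
    proof (subst nn_integral_cmult)
      have "(\<lambda>t. \<integral>\<^sup>+s. F (Suc m + card I) I (y + t *\<^sub>R b) s \<partial>Pi\<^sub>M I (\<lambda>_. lborel)) \<in> borel_measurable lborel"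
        (is "?f \<in> _")
      proof -
        interpret finite_product_sigma_finite "\<lambda>_ :: real^'d. lborel :: real measure" I
          by standard (rule bI)
        note [measurable] = meas
        have "(\<lambda>(t, s). F (Suc m + card I) I (y + t *\<^sub>R b) s) \<in> borel_measurable (lborel \<Otimes>\<^sub>M Pi\<^sub>M I (\<lambda>_. lborel))"
          unfolding F_def by measurable
        then show ?thesis by (rule borel_measurable_nn_integral)
      qed
      then show "(\<lambda>t. \<integral>\<^sup>+s. F (Suc m + card I) (insert b I) y (s(b := t)) \<partial>Pi\<^sub>M I (\<lambda>_. lborel))
          \<in> borel_measurable lborel"
        unfolding F_insert by (subst nn_integral_multc) (use Fmeas[OF bI(1)] in auto)
    qed simp
    also have "(\<integral>\<^sup>+t. (\<integral>\<^sup>+s. F (Suc m + card I) (insert b I) y (s(b := t)) \<partial>Pi\<^sub>M I (\<lambda>_. lborel)) \<partial>lborel)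
        = (\<integral>\<^sup>+s. F (Suc m + card I) (insert b I) y s \<partial>Pi\<^sub>M (insert b I) (\<lambda>_. lborel))"
      using bI by (intro product_nn_integral_insert_rev[symmetric] Fmeas) auto
    also have "ennreal (2 / r) * (ennreal ((2 / r) ^ card I) * \<dots>)
        = ennreal ((2 / r) ^ card (insert b I)) * \<dots>"
    proof -
      have "ennreal ((2 / r) ^ card (insert b I)) = ennreal ((2 / r) * (2 / r) ^ card I)"
        using bI by simp
      also have "\<dots> = ennreal (2 / r) * ennreal ((2 / r) ^ card I)" using r by (intro ennreal_mult) auto
      finally show ?thesis by (simp only: mult.assoc)
    qed
    finally show ?case using bI by (simp add: F_def)
  qed
qed

text \<open>
  The iterated averages over all coordinate directions, rewritten as one Lebesgue integral. They run over the
  corner \<open>y + {0..r} ^ d\<close> of the cube only.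
\<close>

lemma sobolev_inequality:
  fixes f :: "real^'d::finite \<Rightarrow> 'k::{real_normed_vector, banach}"
  assumes op: "open \<Omega>" and f: "smooth_on \<Omega> f" and r: "0 < r" "r \<le> 1"
    and cube: "\<And>w. infnorm (w - y) \<le> r \<Longrightarrow> w \<in> \<Omega>"
  shows "ennreal (derivative_sum m f y) \<le> ennreal ((2 / r) ^ CARD('d)) *
    (\<integral>\<^sup>+w. ennreal (derivative_sum (m + CARD('d)) f w) * indicator {w. infnorm (w - y) \<le> r} w \<partial>lborel)"
proof -
  define D where "D = CARD('d)"
  have card: "card (Basis :: (real^'d) set) = D" by (simp add: D_def)
  define G where "G w = ennreal (derivative_sum (m + D) f w * indicator \<Omega> w)" for w
  have "(\<lambda>z. derivative_sum (m + D) f z * indicator \<Omega> z) \<in> borel_measurable borel"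
    using borel_measurable_continuous_on_indicator[OF borel_open[OF op] continuous_on_derivative_sum[OF f, of "m + D"]]
    by (simp add: mult.commute)
  then have [measurable]: "G \<in> borel_measurable borel" unfolding G_def by measurable
  define H where "H z = G (y + z) * (\<Prod>b\<in>Basis. indicator {0..r} (z \<bullet> b))" for z
  have [measurable]: "H \<in> borel_measurable borel" unfolding H_def by measurable
  have inf_le: "infnorm z \<le> r" if "\<And>b. b \<in> Basis \<Longrightarrow> \<bar>z \<bullet> b\<bar> \<le> r" for z :: "real^'d"
    unfolding infnorm_Max using that by (subst Max_le_iff) auto
  have coord: "(\<Sum>c\<in>Basis. s c *\<^sub>R c) \<bullet> b = s b" if "b \<in> Basis" for s and b :: "real^'d"
    using that by simp
  have cube': "y + (\<Sum>b\<in>Basis. s b *\<^sub>R b) \<in> \<Omega>" if s: "\<And>b. b \<in> Basis \<Longrightarrow> s b \<in> {0..r}" for s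
  proof -
    have "infnorm (\<Sum>b\<in>Basis. s b *\<^sub>R b) \<le> r"
      by (rule inf_le) (use s in \<open>auto simp: coord\<close>)
    then show ?thesis by (intro cube) simp
  qed
  have H_sum: "H (\<Sum>b\<in>Basis. s b *\<^sub>R b)
      = G (y + (\<Sum>b\<in>Basis. s b *\<^sub>R b)) * (\<Prod>b\<in>Basis. indicator {0..r} (s b))" for s
    unfolding H_def by (intro arg_cong2[where f = "(*)"] refl prod.cong) (simp add: coord)
  let ?X = "\<integral>\<^sup>+s. H (\<Sum>b\<in>Basis. s b *\<^sub>R b) \<partial>Pi\<^sub>M Basis (\<lambda>_. lborel)"
  have main: "ennreal (derivative_sum m f y) \<le> ennreal ((2 / r) ^ D) * ?X"
    using derivative_sum_iterated_average[OF op f r order_refl cube', of m]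
    unfolding H_sum G_def card .
  have "?X = (\<integral>\<^sup>+z. H z \<partial>lborel)"
    by (subst (2) lborel_eq) (rule nn_integral_distr[symmetric]; measurable)
  also have "\<dots> = (\<integral>\<^sup>+w. H (- y + w) \<partial>lborel)"
    using lborel_distr_plus[of "- y"] nn_integral_distr[of "(+) (- y)" lborel borel H] by simp
  also have "\<dots> \<le> (\<integral>\<^sup>+w. ennreal (derivative_sum (m + D) f w) * indicator {w. infnorm (w - y) \<le> r} w \<partial>lborel)"
  proof (rule nn_integral_mono)
    fix w
    show "H (- y + w) \<le> ennreal (derivative_sum (m + D) f w) * indicator {w. infnorm (w - y) \<le> r} w"
    proof (cases "\<forall>b\<in>Basis. (- y + w) \<bullet> b \<in> {0..r}")
      case True
      then have "infnorm (- y + w) \<le> r" by (intro inf_le) auto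
      then have "infnorm (w - y) \<le> r" by simp
      then show ?thesis using True cube[of w] by (simp add: H_def G_def)
    next
      case False
      then obtain b where "b \<in> Basis" "(- y + w) \<bullet> b \<notin> {0..r}" by blast
      then have "(\<Prod>b\<in>Basis. indicator {0..r} ((- y + w) \<bullet> b) :: ennreal) = 0"
        by (intro prod_zero[OF finite_Basis] bexI[of _ b]) simp_all
      then have "H (- y + w) = 0" unfolding H_def by (simp only: mult_zero_right)
      then show ?thesis by (simp only: zero_le)
    qed
  qed
  finally have "?X \<le> (\<integral>\<^sup>+w. ennreal (derivative_sum (m + D) f w) * indicator {w. infnorm (w - y) \<le> r} w \<partial>lborel)" .
  then have le: "ennreal ((2 / r) ^ D) * ?X \<le> ennreal ((2 / r) ^ D) *
      (\<integral>\<^sup>+w. ennreal (derivative_sum (m + D) f w) * indicator {w. infnorm (w - y) \<le> r} w \<partial>lborel)"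
    by (rule mult_left_mono) (rule zero_le)
  from order_trans[OF main le] show ?thesis by (simp only: D_def)
qed

section \<open>The weighted spaces as seminormed spaces\<close>

lemma smooth_functions_iff:
  "f \<in> smooth_functions \<Omega> \<longleftrightarrow> (\<forall>x. x \<notin> \<Omega> \<longrightarrow> f x = 0) \<and> smooth_on \<Omega> f"
  by (simp add: smooth_functions_def smooth_on_def)

locale weight_system =
  fixes \<Omega> :: "(real^'d::finite) set"
    and \<Omega>n :: "nat \<Rightarrow> (real^'d) set"
    and \<nu> :: "nat \<Rightarrow> real^'d \<Rightarrow> real"
  assumes open_Omega: "open \<Omega>"
    and Omega_n: "1 \<le> n \<Longrightarrow> \<Omega>n n \<noteq> {} \<and> \<Omega>n n \<in> sets lebesgue \<and> \<Omega>n n \<subseteq> \<Omega>n (n + 1)"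
    and Omega_Union: "\<Omega> = (\<Union>n\<in>{1..}. \<Omega>n n)"
    and weights: "1 \<le> n \<Longrightarrow> continuous_on \<Omega> (\<nu> n) \<and> (\<forall>x\<in>\<Omega>. 0 < \<nu> n x \<and> \<nu> n x \<le> \<nu> (n + 1) x)"
begin

abbreviation "EV \<equiv> ev_space \<Omega> \<Omega>n \<nu>"

abbreviation "EV_norm \<equiv> ev_seminorm \<Omega>n \<nu>"

lemma Omega_n_subset: "1 \<le> n \<Longrightarrow> \<Omega>n n \<subseteq> \<Omega>"
  using Omega_Union by auto

lemma Omega_n_mono:
  assumes "1 \<le> n" "n \<le> m"
  shows "\<Omega>n n \<subseteq> \<Omega>n m"
  using assms(2)
proof (induction rule: dec_induct)
  case (step m)
  then show ?case using Omega_n[of m] assms(1) by auto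
qed simp

lemma weight_pos: "1 \<le> n \<Longrightarrow> x \<in> \<Omega> \<Longrightarrow> 0 < \<nu> n x"
  using weights by blast

lemma weight_mono:
  assumes "1 \<le> n" "n \<le> m" "x \<in> \<Omega>"
  shows "\<nu> n x \<le> \<nu> m x"
  using assms(2)
proof (induction rule: dec_induct)
  case (step m)
  then have "\<nu> m x \<le> \<nu> (m + 1) x" using weights[of m] assms by simp
  then show ?case using step by simp
qed simp

lemma ev_space_smooth: "f \<in> EV \<Longrightarrow> smooth_on \<Omega> f"
  by (simp add: ev_space_def smooth_functions_iff)

lemma ev_sup_nonneg:
  assumes "1 \<le> n"
  shows "0 \<le> ev_sup \<Omega>n \<nu> n m f"
proof -
  obtain x where x: "x \<in> \<Omega>n n" using Omega_n[OF assms] by auto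
  then have "0 < \<nu> n x" using weight_pos[OF assms] Omega_n_subset[OF assms] by auto
  then have "0 \<le> ereal (norm (multi_partial (\<lambda>_. 0) f x) * \<nu> n x)" by simp
  also have "\<dots> \<le> ev_sup \<Omega>n \<nu> n m f"
    unfolding ev_sup_def by (rule SUP_upper2[of "(x, \<lambda>_. 0)"]) (use x in auto)
  finally show ?thesis .
qed

lemma ev_sup_eq_ev_seminorm:
  assumes "f \<in> EV" "1 \<le> n"
  shows "ev_sup \<Omega>n \<nu> n m f = ereal (EV_norm n m f)"
  using assms ev_sup_nonneg[OF assms(2), of m f] unfolding ev_seminorm_def ev_space_def
  by (cases "ev_sup \<Omega>n \<nu> n m f") auto

lemma iterated_partial_le_ev_seminorm:
  assumes f: "f \<in> EV" and n: "1 \<le> n" and x: "x \<in> \<Omega>n n" and js: "length js \<le> m"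
  shows "norm (iterated_partial js f x) * \<nu> n x \<le> EV_norm n m f"
proof -
  have x': "x \<in> \<Omega>" using x Omega_n_subset[OF n] by auto
  have "(\<Sum>i\<in>UNIV. count_list js i) = length js" by (rule sum_count_set) auto
  then have "ereal (norm (multi_partial (count_list js) f x) * \<nu> n x) \<le> ev_sup \<Omega>n \<nu> n m f"
    unfolding ev_sup_def using x js by (intro SUP_upper2[of "(x, count_list js)"]) auto
  then show ?thesis
    by (simp add: ev_sup_eq_ev_seminorm[OF f n]
        iterated_partial_eq_multi[OF open_Omega ev_space_smooth[OF f] x'])
qed

lemma ev_sup_leI:
  assumes "\<And>js x. length js \<le> m \<Longrightarrow> x \<in> \<Omega>n n \<Longrightarrow> norm (iterated_partial js f x) * \<nu> n x \<le> B"
  shows "ev_sup \<Omega>n \<nu> n m f \<le> ereal B"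
  unfolding ev_sup_def
  by (rule SUP_least) (auto simp: multi_partial_eq_iterated length_multi_index_list intro!: assms)

lemma ev_seminorm_leI:
  assumes f: "f \<in> EV" and n: "1 \<le> n"
    and "\<And>js x. length js \<le> m \<Longrightarrow> x \<in> \<Omega>n n \<Longrightarrow> norm (iterated_partial js f x) * \<nu> n x \<le> B"
  shows "EV_norm n m f \<le> B"
  using ev_sup_leI[OF assms(3)] by (simp add: ev_sup_eq_ev_seminorm[OF f n])

lemma ev_seminorm_nonneg: "1 \<le> n \<Longrightarrow> 0 \<le> EV_norm n m f"
  unfolding ev_seminorm_def by (simp add: real_of_ereal_pos ev_sup_nonneg)

lemma ev_seminorm_mono:
  assumes f: "f \<in> EV" and n: "1 \<le> n" "n \<le> n'" and m: "m \<le> m'"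
  shows "EV_norm n m f \<le> EV_norm n' m' f"
proof (rule ev_seminorm_leI[OF f n(1)])
  fix js :: "'d list" and x assume js: "length js \<le> m" and x: "x \<in> \<Omega>n n"
  have "norm (iterated_partial js f x) * \<nu> n x \<le> norm (iterated_partial js f x) * \<nu> n' x"
    using weight_mono[OF n] x Omega_n_subset[OF n(1)] by (intro mult_left_mono) auto
  also have "\<dots> \<le> EV_norm n' m' f"
    using js m n x Omega_n_mono[OF n] by (intro iterated_partial_le_ev_seminorm f) auto
  finally show "norm (iterated_partial js f x) * \<nu> n x \<le> EV_norm n' m' f" .
qed

lemma ev_add_bound:
  assumes f: "f \<in> EV" and g: "g \<in> EV" and n: "1 \<le> n"
    and js: "length js \<le> m" and x: "x \<in> \<Omega>n n"
  shows "norm (iterated_partial js (f + g) x) * \<nu> n x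
    \<le> EV_norm n m f + EV_norm n m g"
proof -
  have x': "x \<in> \<Omega>" using x Omega_n_subset[OF n] by auto
  have "norm (iterated_partial js (f + g) x) * \<nu> n x
      \<le> (norm (iterated_partial js f x) + norm (iterated_partial js g x)) * \<nu> n x"
    unfolding iterated_partial_add[OF open_Omega ev_space_smooth[OF f] ev_space_smooth[OF g] x']
    using weight_pos[OF n x'] by (intro mult_right_mono norm_triangle_ineq) auto
  also have "\<dots> \<le> EV_norm n m f + EV_norm n m g"
    unfolding distrib_right by (intro add_mono iterated_partial_le_ev_seminorm f g n x js)
  finally show ?thesis .
qed

lemma ev_scale_bound:
  assumes f: "f \<in> EV" and n: "1 \<le> n" and js: "length js \<le> m" and x: "x \<in> \<Omega>n n"
  shows "norm (iterated_partial js (pointwise_scale (*) c f) x) * \<nu> n x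
    \<le> norm c * EV_norm n m f"
proof -
  have x': "x \<in> \<Omega>" using x Omega_n_subset[OF n] by auto
  show ?thesis
    unfolding iterated_partial_scale[OF open_Omega ev_space_smooth[OF f] x'] norm_mult mult.assoc
    by (intro mult_left_mono iterated_partial_le_ev_seminorm f n x js) auto
qed

lemma vector_space_pointwise: "vector_space (pointwise_scale ((*) :: 'k::field \<Rightarrow> 'k \<Rightarrow> 'k) :: 'k \<Rightarrow> ('i \<Rightarrow> 'k) \<Rightarrow> _)"
  by unfold_locales (auto simp: pointwise_scale_def fun_eq_iff algebra_simps)

lemma ev_space_add:
  assumes f: "f \<in> EV" and g: "g \<in> EV"
  shows "f + g \<in> EV"
proof -
  have "ev_sup \<Omega>n \<nu> n m (f + g) < \<infinity>" if n: "1 \<le> n" for n m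
    using ev_sup_leI[OF ev_add_bound[OF f g n]] by (rule order_le_less_trans) auto
  then show ?thesis
    using f g smooth_on_add[OF open_Omega, of f g] unfolding ev_space_def smooth_functions_iff by simp
qed

lemma ev_space_scale:
  assumes f: "f \<in> EV"
  shows "pointwise_scale (*) c f \<in> EV"
proof -
  have "ev_sup \<Omega>n \<nu> n m (pointwise_scale (*) c f) < \<infinity>" if n: "1 \<le> n" for n m
    using ev_sup_leI[OF ev_scale_bound[OF f n]] by (rule order_le_less_trans) auto
  then show ?thesis
    using f smooth_on_scale[OF open_Omega, of f c] unfolding ev_space_def smooth_functions_iff
    by (simp add: pointwise_scale_def)
qed

lemma partial_zero: "partial i (\<lambda>x. 0) = (\<lambda>x. 0)"
  unfolding partial_def by (rule ext) (simp add: vector_derivative_const_at)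

lemma iterated_partial_zero: "iterated_partial js (\<lambda>x. 0) = (\<lambda>x. 0)"
  by (induction js) (simp_all add: iterated_partial_Cons partial_zero)

lemma ev_space_zero: "(0 :: real^'d \<Rightarrow> 'k::real_normed_field) \<in> EV"
proof -
  have "ev_sup \<Omega>n \<nu> n m (0 :: real^'d \<Rightarrow> 'k) \<le> ereal 0" for n m
    by (rule ev_sup_leI) (simp add: zero_fun_def iterated_partial_zero)
  then have "ev_sup \<Omega>n \<nu> n m (0 :: real^'d \<Rightarrow> 'k) < \<infinity>" for n m
    by (rule order_le_less_trans) auto
  moreover have "smooth_on \<Omega> (0 :: real^'d \<Rightarrow> 'k)"
    by (simp add: smooth_on_def zero_fun_def iterated_partial_zero)
  ultimately show ?thesis by (simp add: ev_space_def smooth_functions_iff)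
qed

lemma ev_seminorm_seminorm:
  assumes n: "1 \<le> n"
  shows "seminorm_on (pointwise_scale (*)) EV
    (EV_norm n m :: (real^'d \<Rightarrow> 'k::real_normed_field) \<Rightarrow> real)"
  unfolding seminorm_on_def
proof (intro conjI ballI allI)
  fix f g :: "real^'d \<Rightarrow> 'k" assume f: "f \<in> EV" and g: "g \<in> EV"
  show "0 \<le> EV_norm n m f" by (rule ev_seminorm_nonneg[OF n])
  show "EV_norm n m (f + g) \<le> EV_norm n m f + EV_norm n m g"
    by (rule ev_seminorm_leI[OF ev_space_add[OF f g] n ev_add_bound[OF f g n]])
next
  fix c and f :: "real^'d \<Rightarrow> 'k" assume f: "f \<in> EV"
  have le: "EV_norm n m (pointwise_scale (*) c g) \<le> norm c * EV_norm n m g"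
    if g: "g \<in> EV" for c and g :: "real^'d \<Rightarrow> 'k"
    by (rule ev_seminorm_leI[OF ev_space_scale[OF g] n ev_scale_bound[OF g n]])
  show "EV_norm n m (pointwise_scale (*) c f) = norm c * EV_norm n m f"
  proof (cases "c = 0")
    case True
    then show ?thesis
      using le[OF f, of 0] ev_seminorm_nonneg[OF n, of m "pointwise_scale (*) 0 f"] by simp
  next
    case False
    have "pointwise_scale (*) (inverse c) (pointwise_scale (*) c f) = f"
      using False by (auto simp: pointwise_scale_def fun_eq_iff)
    then have "norm c * EV_norm n m f
        \<le> norm c * (norm (inverse c) * EV_norm n m (pointwise_scale (*) c f))"
      using le[OF ev_space_scale[OF f], of "inverse c" c] by (intro mult_left_mono) auto
    also have "\<dots> = EV_norm n m (pointwise_scale (*) c f)"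
      using False by (simp add: norm_inverse)
    finally show ?thesis using le[OF f, of c] by simp
  qed
qed

lemma ev_seminorm_system:
  "seminorm_system (pointwise_scale (*)) EV
     {EV_norm n m :: (real^'d \<Rightarrow> 'k::{real_normed_field, banach}) \<Rightarrow> real | n m. 1 \<le> n}"
proof -
  interpret vector_space "pointwise_scale (*) :: 'k \<Rightarrow> (real^'d \<Rightarrow> 'k) \<Rightarrow> _"
    by (rule vector_space_pointwise)
  show ?thesis
  proof
    show "subspace (EV :: (real^'d \<Rightarrow> 'k) set)"
      by (rule subspaceI) (auto intro: ev_space_zero ev_space_add ev_space_scale)
    fix p q :: "(real^'d \<Rightarrow> 'k) \<Rightarrow> real"
    assume p: "p \<in> {EV_norm n m | n m. 1 \<le> n}"
    then show "seminorm_on (pointwise_scale (*)) EV p"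
      using ev_seminorm_seminorm by blast
    assume q: "q \<in> {EV_norm n m | n m. 1 \<le> n}"
    obtain n m n' m' where pq: "p = EV_norm n m" "q = EV_norm n' m'" "1 \<le> n" "1 \<le> n'"
      using p q by blast
    have "\<forall>f\<in>EV. p f \<le> EV_norm (max n n') (max m m') f \<and>
        q f \<le> EV_norm (max n n') (max m m') f"
      using pq by (auto intro!: ev_seminorm_mono)
    moreover have "EV_norm (max n n') (max m m')
        \<in> {EV_norm n m :: (real^'d \<Rightarrow> 'k) \<Rightarrow> real | n m. 1 \<le> n}"
      using pq(3) by (auto simp: le_max_iff_disj)
    ultimately show "\<exists>s\<in>{EV_norm n m | n m. 1 \<le> n}. \<forall>f\<in>EV. p f \<le> s f \<and> q f \<le> s f"
      by (rule bexI)
  next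
    show "{EV_norm n m :: (real^'d \<Rightarrow> 'k) \<Rightarrow> real | n m. 1 \<le> n} \<noteq> {}" by auto
  next
    fix f :: "real^'d \<Rightarrow> 'k"
    assume f: "f \<in> EV" and zero: "\<And>p. p \<in> {EV_norm n m | n m. 1 \<le> n} \<Longrightarrow> p f = 0"
    have "f x = 0" for x
    proof (cases "x \<in> \<Omega>")
      case True
      then obtain n where n: "1 \<le> n" "x \<in> \<Omega>n n" using Omega_Union by auto
      have "EV_norm n 0 f = 0" using n by (intro zero) blast
      then have "norm (f x) * \<nu> n x \<le> 0"
        using iterated_partial_le_ev_seminorm[OF f n, of "[]" 0] by simp
      then show ?thesis using weight_pos[OF n(1) True] by (simp add: mult_le_0_iff)
    next
      case False
      then show ?thesis using f by (simp add: ev_space_def smooth_functions_iff)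
    qed
    then show "f = 0" by auto
  qed
qed

end

section \<open>The weighted estimate\<close>

locale growth_weight_system = weight_system \<Omega> \<Omega>n \<nu>
  for \<Omega> :: "(real^'d::finite) set" and \<Omega>n :: "nat \<Rightarrow> (real^'d) set" and \<nu> :: "nat \<Rightarrow> real^'d \<Rightarrow> real" +
  fixes r :: "nat \<Rightarrow> real^'d \<Rightarrow> real"
  assumes radius: "1 \<le> k \<Longrightarrow> x \<in> \<Omega>n k \<Longrightarrow>
      0 < r k x \<and> r k x \<le> 1 \<and> ereal (r k x) < boundary_dist (\<Omega>n (k + 1)) x"
    and growth: "1 \<le> k \<Longrightarrow> 1 \<le> n \<Longrightarrow> \<exists>\<psi> I1 I2 I3 A1 A2 A3.
           integrable (lebesgue_on (\<Omega>n k)) \<psi> \<and> (\<forall>x\<in>\<Omega>n k. 0 < \<psi> x) \<and>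
           n \<le> I1 \<and> n \<le> I2 \<and> n \<le> I3 \<and> 0 < A1 \<and> 0 < A2 \<and> 0 < A3 \<and>
           (\<forall>x\<in>\<Omega>n k.
              (SUP \<zeta>\<in>{\<zeta>. infnorm \<zeta> \<le> r k x}. \<nu> n (x + \<zeta>))
                \<le> A1 * (INF \<zeta>\<in>{\<zeta>. infnorm \<zeta> \<le> r k x}. \<nu> I1 (x + \<zeta>)) \<and>
              \<nu> n x \<le> A2 * \<psi> x * \<nu> I2 x \<and>
              \<nu> n x \<le> A3 * r k x * \<nu> I3 x)"
begin

text \<open>A segment that leaves a set from one of its points meets the boundary.\<close>

lemma cube_subset:
  assumes k: "1 \<le> k" and x: "x \<in> \<Omega>n k" and w: "infnorm (w - x) \<le> r k x"
  shows "w \<in> \<Omega>n (k + 1)"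
proof (rule ccontr)
  assume w': "w \<notin> \<Omega>n (k + 1)"
  define S where "S = closed_segment x w"
  have "x \<in> S \<inter> \<Omega>n (k + 1)" using Omega_n[OF k] x by (auto simp: S_def)
  moreover have "w \<in> S - \<Omega>n (k + 1)" using w' by (auto simp: S_def)
  ultimately have "S \<inter> frontier (\<Omega>n (k + 1)) \<noteq> {}"
    by (intro connected_Int_frontier) (auto simp: S_def)
  then obtain \<zeta> where \<zeta>: "\<zeta> \<in> S" "\<zeta> \<in> frontier (\<Omega>n (k + 1))" by auto
  then obtain t where t: "0 \<le> t" "t \<le> 1" "\<zeta> = (1 - t) *\<^sub>R x + t *\<^sub>R w"
    by (auto simp: S_def in_segment)
  have "x - \<zeta> = t *\<^sub>R (x - w)" using t by (simp add: algebra_simps)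
  then have "infnorm (x - \<zeta>) = t * infnorm (w - x)" using t by (simp add: infnorm_mul infnorm_sub)
  also have "\<dots> \<le> 1 * infnorm (w - x)" using t by (intro mult_right_mono) (auto simp: infnorm_pos_le)
  finally have "infnorm (x - \<zeta>) \<le> r k x" using w by simp
  moreover have "boundary_dist (\<Omega>n (k + 1)) x \<le> ereal (infnorm (x - \<zeta>))"
    unfolding boundary_dist_def by (rule INF_lower[OF \<zeta>(2)])
  moreover have "ereal (r k x) < boundary_dist (\<Omega>n (k + 1)) x" using radius[OF k x] by simp
  ultimately show False by (metis ereal_less_eq(3) leD order_trans)
qed

lemma cube_compact: "compact {\<zeta> :: real^'d. infnorm \<zeta> \<le> c}"
proof -
  have "closed {\<zeta> :: real^'d. infnorm \<zeta> \<le> c}"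
    by (intro closed_Collect_le continuous_intros)
  moreover have "bounded {\<zeta> :: real^'d. infnorm \<zeta> \<le> c}"
  proof (rule boundedI)
    fix \<zeta> :: "real^'d" assume "\<zeta> \<in> {\<zeta>. infnorm \<zeta> \<le> c}"
    then have "sqrt DIM(real^'d) * infnorm \<zeta> \<le> sqrt DIM(real^'d) * c"
      by (intro mult_left_mono) auto
    then show "norm \<zeta> \<le> sqrt DIM(real^'d) * c" by (rule order_trans[OF norm_le_infnorm])
  qed
  ultimately show ?thesis by (simp add: compact_eq_bounded_closed)
qed

lemma growthE:
  assumes "1 \<le> k" "1 \<le> n"
  obtains \<psi> I1 I2 I3 A1 A2 A3 where
    "integrable (lebesgue_on (\<Omega>n k)) \<psi>" "\<forall>x\<in>\<Omega>n k. 0 < \<psi> x"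
    "n \<le> I1" "n \<le> I2" "n \<le> I3" "0 < A1" "0 < A2" "0 < A3"
    "\<forall>x\<in>\<Omega>n k. (SUP \<zeta>\<in>{\<zeta>. infnorm \<zeta> \<le> r k x}. \<nu> n (x + \<zeta>))
                \<le> A1 * (INF \<zeta>\<in>{\<zeta>. infnorm \<zeta> \<le> r k x}. \<nu> I1 (x + \<zeta>))"
    "\<forall>x\<in>\<Omega>n k. \<nu> n x \<le> A2 * \<psi> x * \<nu> I2 x" "\<forall>x\<in>\<Omega>n k. \<nu> n x \<le> A3 * r k x * \<nu> I3 x"
proof -
  from growth[OF assms] obtain \<psi> I1 I2 I3 A1 A2 A3 where
    G: "integrable (lebesgue_on (\<Omega>n k)) \<psi> \<and> (\<forall>x\<in>\<Omega>n k. 0 < \<psi> x) \<and>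
      n \<le> I1 \<and> n \<le> I2 \<and> n \<le> I3 \<and> 0 < A1 \<and> 0 < A2 \<and> 0 < A3 \<and>
      (\<forall>x\<in>\<Omega>n k.
         (SUP \<zeta>\<in>{\<zeta>. infnorm \<zeta> \<le> r k x}. \<nu> n (x + \<zeta>))
            \<le> A1 * (INF \<zeta>\<in>{\<zeta>. infnorm \<zeta> \<le> r k x}. \<nu> I1 (x + \<zeta>)) \<and>
         \<nu> n x \<le> A2 * \<psi> x * \<nu> I2 x \<and> \<nu> n x \<le> A3 * r k x * \<nu> I3 x)"
    by (elim exE) (rule that)
  show thesis by (rule that[of \<psi> I1 I2 I3 A1 A2 A3]; insert G; elim conjE; simp)
qed

text \<open>
  Continuity of the weight on the compact cube makes the supremum a genuine upper bound; positivity does the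
  same for the infimum.
\<close>

lemma weight_le_on_cube:
  assumes k: "1 \<le> k" and n: "1 \<le> n" "1 \<le> I" and x: "x \<in> \<Omega>n k" and A: "0 < A"
    and le: "(SUP \<zeta>\<in>{\<zeta>. infnorm \<zeta> \<le> r k x}. \<nu> n (x + \<zeta>))
      \<le> A * (INF \<zeta>\<in>{\<zeta>. infnorm \<zeta> \<le> r k x}. \<nu> I (x + \<zeta>))"
    and w: "infnorm (w - x) \<le> r k x"
  shows "\<nu> n x \<le> A * \<nu> I w"
proof -
  define Q where "Q = {\<zeta> :: real^'d. infnorm \<zeta> \<le> r k x}"
  have Q\<Omega>: "x + \<zeta> \<in> \<Omega>" if "\<zeta> \<in> Q" for \<zeta>
    using cube_subset[OF k x, of "x + \<zeta>"] that Omega_n_subset[of "k + 1"] by (auto simp: Q_def)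
  have "0 \<in> Q" using radius[OF k x] by (simp add: Q_def infnorm_0)
  have "continuous_on Q (\<lambda>\<zeta>. \<nu> n (x + \<zeta>))"
    by (rule continuous_on_compose2[of \<Omega> "\<nu> n"])
      (use weights[OF n(1)] Q\<Omega> in \<open>auto intro!: continuous_intros\<close>)
  then have "compact ((\<lambda>\<zeta>. \<nu> n (x + \<zeta>)) ` Q)"
    using cube_compact unfolding Q_def by (rule compact_continuous_image)
  then have "bdd_above ((\<lambda>\<zeta>. \<nu> n (x + \<zeta>)) ` Q)"
    by (intro bounded_imp_bdd_above compact_imp_bounded)
  then have "\<nu> n (x + 0) \<le> (SUP \<zeta>\<in>Q. \<nu> n (x + \<zeta>))" using \<open>0 \<in> Q\<close> by (rule cSUP_upper[rotated])
  also have "\<dots> \<le> A * (INF \<zeta>\<in>Q. \<nu> I (x + \<zeta>))" using le by (simp add: Q_def)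
  also have "(INF \<zeta>\<in>Q. \<nu> I (x + \<zeta>)) \<le> \<nu> I (x + (w - x))"
  proof (rule cINF_lower)
    show "bdd_below ((\<lambda>\<zeta>. \<nu> I (x + \<zeta>)) ` Q)"
      using weight_pos[OF n(2) Q\<Omega>] by (intro bdd_belowI[of _ 0]) (auto intro: less_imp_le)
    show "w - x \<in> Q" using w by (simp add: Q_def)
  qed
  finally show ?thesis using A by simp
qed

lemma weight_le_radius_power:
  assumes n: "1 \<le> n"
  shows "\<exists>n' A. n \<le> n' \<and> 0 < A \<and> (\<forall>x\<in>\<Omega>n n. \<nu> n x \<le> A * r n x ^ e * \<nu> n' x)"
proof (induction e)
  case 0
  show ?case by (intro exI[of _ n] exI[of _ 1]) auto
next
  case (Suc e)
  then obtain n' A where n': "n \<le> n'" "0 < A" "\<forall>x\<in>\<Omega>n n. \<nu> n x \<le> A * r n x ^ e * \<nu> n' x" by blast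
  obtain I A' where I: "n' \<le> I" "0 < A'" "\<forall>x\<in>\<Omega>n n. \<nu> n' x \<le> A' * r n x * \<nu> I x"
    by (rule growthE[OF n order_trans[OF n n'(1)]]) (rule that)
  have "\<nu> n x \<le> (A * A') * r n x ^ Suc e * \<nu> I x" if x: "x \<in> \<Omega>n n" for x
  proof -
    have "A * r n x ^ e * \<nu> n' x \<le> A * r n x ^ e * (A' * r n x * \<nu> I x)"
      using I(3) x n'(2) radius[OF n x] by (intro mult_left_mono) auto
    then show ?thesis using n'(3) x by (fastforce simp: mult_ac)
  qed
  then show ?case using n' I by (intro exI[of _ I] exI[of _ "A * A'"]) auto
qed

text \<open>
  The Sobolev inequality on the cube of radius \<open>r n x\<close> costs a factor \<open>r n x ^ - d\<close>. It is absorbed into the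
  weight by \<open>d\<close> applications of the third growth condition. The first one moves the weight from the centre to
  the points of the cube, and the second one inserts the integrable factor \<open>\<psi>\<close>.
\<close>

lemma weighted_sobolev_inequality:
  assumes n: "1 \<le> n"
  shows "\<exists>N \<psi> C. n + 1 \<le> N \<and> 0 \<le> C \<and> integrable (lebesgue_on (\<Omega>n (n + 1))) \<psi> \<and> (\<forall>x\<in>\<Omega>n (n + 1). 0 < \<psi> x) \<and>
    (\<forall>m (f :: real^'d \<Rightarrow> 'k::{real_normed_vector, banach}). \<forall>x\<in>\<Omega>n n. smooth_on \<Omega> f \<longrightarrow>
      ennreal (derivative_sum m f x * \<nu> n x) \<le>
        (\<integral>\<^sup>+y. ennreal (\<psi> y) * ennreal (C * (derivative_sum (m + CARD('d)) f y * \<nu> N y)) \<partial>lebesgue_on (\<Omega>n (n + 1))))"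
proof -
  define d where "d = CARD('d)"
  define S where "S = \<Omega>n (n + 1)"
  have S: "S \<in> sets lebesgue" "S \<subseteq> \<Omega>" using Omega_n[of "n + 1"] Omega_n_subset[of "n + 1"] by (auto simp: S_def)
  obtain n' A where n': "n \<le> n'" "0 < A" "\<forall>x\<in>\<Omega>n n. \<nu> n x \<le> A * r n x ^ d * \<nu> n' x"
    using weight_le_radius_power[OF n, of d] by blast
  have n'1: "1 \<le> n'" using n n' by simp
  obtain I1 A1 where I1: "n' \<le> I1" "0 < A1"
    "\<forall>x\<in>\<Omega>n n. (SUP \<zeta>\<in>{\<zeta>. infnorm \<zeta> \<le> r n x}. \<nu> n' (x + \<zeta>))
      \<le> A1 * (INF \<zeta>\<in>{\<zeta>. infnorm \<zeta> \<le> r n x}. \<nu> I1 (x + \<zeta>))"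
    by (rule growthE[OF n n'1]) (rule that)
  have I11: "1 \<le> I1" using n'1 I1 by simp
  have "1 \<le> n + 1" by simp
  then obtain \<psi> I2 A2 where
    \<psi>: "integrable (lebesgue_on (\<Omega>n (n + 1))) \<psi>" "\<forall>x\<in>\<Omega>n (n + 1). 0 < \<psi> x"
    and I2: "I1 \<le> I2" "0 < A2" "\<forall>x\<in>\<Omega>n (n + 1). \<nu> I1 x \<le> A2 * \<psi> x * \<nu> I2 x"
    by (rule growthE[OF _ I11]) (rule that)
  note \<psi> = \<psi>[folded S_def] and I2 = I2(1,2) I2(3)[folded S_def]
  define N where "N = max I2 (n + 1)"
  define C where "C = 2 ^ d * A * A1 * A2"
  have C: "0 \<le> C" using n' I1 I2 by (simp add: C_def)
  have est: "ennreal (derivative_sum m f x * \<nu> n x) \<le>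
        (\<integral>\<^sup>+y. ennreal (\<psi> y) * ennreal (C * (derivative_sum (m + d) f y * \<nu> N y)) \<partial>lebesgue_on S)"
    if x: "x \<in> \<Omega>n n" and f: "smooth_on \<Omega> f" for m x and f :: "real^'d \<Rightarrow> 'k"
  proof -
    define \<rho> where "\<rho> = r n x"
    have \<rho>: "0 < \<rho>" "\<rho> \<le> 1" using radius[OF n x] by (auto simp: \<rho>_def)
    define Q where "Q = {w. infnorm (w - x) \<le> \<rho>}"
    have QS: "w \<in> S" if "w \<in> Q" for w using cube_subset[OF n x] that by (simp add: Q_def S_def \<rho>_def)
    have x\<Omega>: "x \<in> \<Omega>" using x Omega_n_subset[OF n] by auto
    have \<nu>0: "0 \<le> \<nu> n x" using weight_pos[OF n x\<Omega>] by simp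
    have "closed Q" unfolding Q_def by (intro closed_Collect_le continuous_intros)
    then have Qmeas: "(\<lambda>w. indicator Q w *\<^sub>R derivative_sum (m + d) f w) \<in> borel_measurable borel"
      using QS S by (intro borel_measurable_continuous_on_indicator borel_closed
          continuous_on_subset[OF continuous_on_derivative_sum[OF f]]) auto
    have meas: "(\<lambda>w. ennreal (derivative_sum (m + d) f w) * indicator Q w) \<in> borel_measurable borel"
    proof -
      have "(\<lambda>w. ennreal (indicator Q w *\<^sub>R derivative_sum (m + d) f w)) \<in> borel_measurable borel"
        using Qmeas by measurable
      moreover have "(\<lambda>w. ennreal (indicator Q w *\<^sub>R derivative_sum (m + d) f w))
          = (\<lambda>w. ennreal (derivative_sum (m + d) f w) * indicator Q w)"
        by (auto simp: indicator_def fun_eq_iff)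
      ultimately show ?thesis by (simp only:)
    qed
    have "ennreal (derivative_sum m f x) \<le> ennreal ((2 / \<rho>) ^ d) *
        (\<integral>\<^sup>+w. ennreal (derivative_sum (m + d) f w) * indicator Q w \<partial>lborel)"
      unfolding d_def Q_def
      by (rule sobolev_inequality[OF open_Omega f \<rho>]) (use QS S in \<open>auto simp: Q_def\<close>)
    from mult_right_mono[OF this, of "ennreal (\<nu> n x)"]
    have "ennreal (derivative_sum m f x * \<nu> n x) \<le> ennreal ((2 / \<rho>) ^ d) *
        (\<integral>\<^sup>+w. ennreal (derivative_sum (m + d) f w) * indicator Q w \<partial>lborel) * ennreal (\<nu> n x)"
      by (simp add: ennreal_mult \<nu>0)
    also have "\<dots> = ennreal ((2 / \<rho>) ^ d * \<nu> n x) *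
        (\<integral>\<^sup>+w. ennreal (derivative_sum (m + d) f w) * indicator Q w \<partial>lborel)"
      using \<rho> \<nu>0 by (subst ennreal_mult) (auto simp: mult_ac)
    also have "\<dots> = (\<integral>\<^sup>+w. ennreal ((2 / \<rho>) ^ d * \<nu> n x) *
        (ennreal (derivative_sum (m + d) f w) * indicator Q w) \<partial>lborel)"
      using meas by (intro nn_integral_cmult[symmetric]) simp
    also have "\<dots> \<le> (\<integral>\<^sup>+w. (ennreal (\<psi> w) * ennreal (C * (derivative_sum (m + d) f w * \<nu> N w))) * indicator S w \<partial>lborel)"
    proof (rule nn_integral_mono)
      fix w
      show "ennreal ((2 / \<rho>) ^ d * \<nu> n x) * (ennreal (derivative_sum (m + d) f w) * indicator Q w)
          \<le> (ennreal (\<psi> w) * ennreal (C * (derivative_sum (m + d) f w * \<nu> N w))) * indicator S w"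
      proof (cases "w \<in> Q")
        case True
        then have w: "w \<in> S" "w \<in> \<Omega>" "infnorm (w - x) \<le> r n x" using QS S by (auto simp: Q_def \<rho>_def)
        have \<psi>0: "0 \<le> \<psi> w" using \<psi>(2) w by (auto intro: less_imp_le)
        have "(2 / \<rho>) ^ d * \<nu> n x \<le> (2 / \<rho>) ^ d * (A * \<rho> ^ d * \<nu> n' x)"
          using n'(3) x \<rho> by (intro mult_left_mono) (auto simp: \<rho>_def)
        also have "\<dots> = 2 ^ d * A * \<nu> n' x" using \<rho> by (simp add: power_divide)
        also have "\<dots> \<le> 2 ^ d * A * (A1 * \<nu> I1 w)"
          using n'(2) I1(2) I1(3) x
          by (intro mult_left_mono weight_le_on_cube[OF n n'1 I11 x I1(2) _ w(3)]) auto
        also have "\<dots> \<le> 2 ^ d * A * (A1 * (A2 * \<psi> w * \<nu> I2 w))"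
          using n'(2) I1(2) I2(3) w by (intro mult_left_mono) auto
        also have "\<dots> \<le> 2 ^ d * A * (A1 * (A2 * \<psi> w * \<nu> N w))"
          using n'(2) I1(2) I2 I11 \<psi>0 w
          by (intro mult_left_mono weight_mono) (auto simp: N_def)
        also have "\<dots> = \<psi> w * (C * \<nu> N w)" by (simp add: C_def mult_ac)
        finally have "((2 / \<rho>) ^ d * \<nu> n x) * derivative_sum (m + d) f w
            \<le> (\<psi> w * (C * \<nu> N w)) * derivative_sum (m + d) f w"
          by (intro mult_right_mono) auto
        then have "ennreal (((2 / \<rho>) ^ d * \<nu> n x) * derivative_sum (m + d) f w)
            \<le> ennreal (\<psi> w * (C * (derivative_sum (m + d) f w * \<nu> N w)))"
          by (intro ennreal_leI) (simp add: mult_ac)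
        moreover have "ennreal (((2 / \<rho>) ^ d * \<nu> n x) * derivative_sum (m + d) f w)
            = ennreal ((2 / \<rho>) ^ d * \<nu> n x) * ennreal (derivative_sum (m + d) f w)"
          using \<rho> \<nu>0 by (intro ennreal_mult) auto
        moreover have "0 \<le> \<nu> N w" using weight_pos[of N w] w by (simp add: N_def less_imp_le)
        then have "0 \<le> C * (derivative_sum (m + d) f w * \<nu> N w)" using C by simp
        then have "ennreal (\<psi> w * (C * (derivative_sum (m + d) f w * \<nu> N w)))
            = ennreal (\<psi> w) * ennreal (C * (derivative_sum (m + d) f w * \<nu> N w))"
          using \<psi>0 by (intro ennreal_mult)
        ultimately show ?thesis using True w by simp
      qed simp
    qed
    also have "\<dots> = (\<integral>\<^sup>+w. (ennreal (\<psi> w) * ennreal (C * (derivative_sum (m + d) f w * \<nu> N w))) * indicator S w \<partial>lebesgue)"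
      by (simp add: nn_integral_completion)
    also have "\<dots> = (\<integral>\<^sup>+w. ennreal (\<psi> w) * ennreal (C * (derivative_sum (m + d) f w * \<nu> N w)) \<partial>lebesgue_on S)"
      using S by (intro nn_integral_restrict_space[symmetric]) simp
    finally show ?thesis .
  qed
  show ?thesis
    using C \<psi> est unfolding S_def d_def
    by (intro exI[of _ N] exI[of _ \<psi>] exI[of _ C]) (auto simp: N_def)
qed

text \<open>
  By the weighted Sobolev inequality the seminorm is at most a multiple of the integral of the weighted
  derivatives against \<open>\<psi>\<close>. Since \<open>\<Omega>n (n + 1) \<subseteq> \<Omega>n N\<close>, these are bounded by the seminorm of index \<open>N\<close>.
\<close>

lemma ev_seminorm_hilbert_summing:
  assumes "conjugation (cj :: 'k::{real_normed_field, banach, second_countable_topology} \<Rightarrow> 'k)" and n: "1 \<le> n"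
  shows "\<exists>N\<ge>1. hermitian_carrier.hilbert_summing (pointwise_scale (*)) EV cj
    (EV_norm n m) (EV_norm N (m + CARD('d)))"
proof -
  interpret conjugation cj by (rule assms(1))
  interpret seminorm_system "pointwise_scale (*) :: 'k \<Rightarrow> (real^'d \<Rightarrow> 'k) \<Rightarrow> _" "EV"
    "{EV_norm n m | n m. 1 \<le> n}"
    by (rule ev_seminorm_system)
  define d where "d = CARD('d)"
  define S where "S = \<Omega>n (n + 1)"
  have S: "S \<in> sets lebesgue" "S \<subseteq> \<Omega>" using Omega_n[of "n + 1"] Omega_n_subset[of "n + 1"] by (auto simp: S_def)
  obtain N \<psi> C where N: "n + 1 \<le> N" and C: "0 \<le> C" and \<psi>: "integrable (lebesgue_on S) \<psi>" "\<forall>x\<in>S. 0 < \<psi> x"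
    and est: "\<forall>m (f :: real^'d \<Rightarrow> 'k). \<forall>x\<in>\<Omega>n n. smooth_on \<Omega> f \<longrightarrow>
      ennreal (derivative_sum m f x * \<nu> n x) \<le>
        (\<integral>\<^sup>+y. ennreal (\<psi> y) * ennreal (C * (derivative_sum (m + d) f y * \<nu> N y)) \<partial>lebesgue_on S)"
    using weighted_sobolev_inequality[OF n, where 'k = 'k] unfolding S_def[symmetric] d_def[symmetric]
    by (elim exE conjE) (rule that)
  have N1: "1 \<le> N" using N n by simp
  have S_N: "S \<subseteq> \<Omega>n N" unfolding S_def using N n by (intro Omega_n_mono) auto
  define \<mu> where "\<mu> = density (lebesgue_on S) (\<lambda>y. ennreal (\<psi> y))"
  have [measurable]: "\<psi> \<in> borel_measurable (lebesgue_on S)" using \<psi>(1) by auto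
  have space: "space \<mu> = S" by (simp add: \<mu>_def space_restrict_space)
  have fin: "finite_measure \<mu>"
  proof (rule finite_measureI)
    have "emeasure \<mu> (space \<mu>) = (\<integral>\<^sup>+y. ennreal (\<psi> y) \<partial>lebesgue_on S)"
    proof -
      have "S \<in> sets (lebesgue_on S)" using sets.top[of "lebesgue_on S"] by (simp add: space_restrict_space)
      then have "emeasure \<mu> S = (\<integral>\<^sup>+y. ennreal (\<psi> y) * indicator S y \<partial>lebesgue_on S)"
        unfolding \<mu>_def by (intro emeasure_density) auto
      also have "\<dots> = (\<integral>\<^sup>+y. ennreal (\<psi> y) \<partial>lebesgue_on S)"
        by (rule nn_integral_cong) (simp add: space_restrict_space)
      finally show ?thesis by (simp only: space)
    qed
    also have "\<dots> < \<infinity>"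
    proof -
      have "(\<integral>\<^sup>+y. ennreal (\<psi> y) \<partial>lebesgue_on S) = ennreal (\<integral>y. \<psi> y \<partial>lebesgue_on S)"
        using \<psi>(2) by (intro nn_integral_eq_integral \<psi>(1) AE_I2) (auto simp: space_restrict_space intro: less_imp_le)
      then show ?thesis by simp
    qed
    finally show "emeasure \<mu> (space \<mu>) \<noteq> \<infinity>" by simp
  qed
  define J where "J = {js :: 'd list. length js \<le> m + d}"
  define b where "b js y f = iterated_partial js f y * of_real (\<nu> N y)" for js y and f :: "real^'d \<Rightarrow> 'k"
  have lin: "linear_functional_on (pointwise_scale (*)) EV (b js y)"
    if "y \<in> space \<mu>" for js y
  proof -
    have y: "y \<in> \<Omega>" using that S by (auto simp: space)
    show ?thesis
      unfolding linear_functional_on_def b_def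
      by (simp add: iterated_partial_add[OF open_Omega ev_space_smooth ev_space_smooth y]
          iterated_partial_scale[OF open_Omega ev_space_smooth y] distrib_right)
  qed
  have meas: "(\<lambda>y. b js y f) \<in> borel_measurable \<mu>" if f: "f \<in> EV" for js f
  proof -
    have "continuous_on S (iterated_partial js f)"
      by (rule continuous_on_subset[OF smooth_on_continuous[OF ev_space_smooth[OF f]] S(2)])
    moreover have "continuous_on S (\<nu> N)"
      using weights[OF N1] S(2) continuous_on_subset by blast
    ultimately have "continuous_on S (\<lambda>y. b js y f)"
      unfolding b_def by (intro continuous_on_mult continuous_on_of_real)
    from continuous_imp_measurable_on_sets_lebesgue[OF this S(1)]
    show ?thesis by (simp add: \<mu>_def)
  qed
  have bound: "norm (b js y f) \<le> EV_norm N (m + d) f"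
    if js: "js \<in> J" and y: "y \<in> space \<mu>" and f: "f \<in> EV" for js y f
  proof -
    have y': "y \<in> \<Omega>n N" "y \<in> \<Omega>" using y S S_N by (auto simp: space)
    have "norm (b js y f) = norm (iterated_partial js f y) * \<nu> N y"
      using weight_pos[OF N1 y'(2)] by (simp add: b_def norm_mult)
    then show ?thesis
      using iterated_partial_le_ev_seminorm[OF f N1 y'(1), of js "m + d"] js by (simp add: J_def)
  qed
  interpret square_integral_form "pointwise_scale (*) :: 'k \<Rightarrow> (real^'d \<Rightarrow> 'k) \<Rightarrow> _" "EV" cj
    J \<mu> b "EV_norm N (m + d)"
  proof (rule square_integral_form.intro[OF _ square_integral_form_axioms.intro])
    show "hermitian_carrier (pointwise_scale (*) :: 'k \<Rightarrow> (real^'d \<Rightarrow> 'k) \<Rightarrow> _) EV cj"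
      by unfold_locales
    show "finite J" by (simp add: J_def)
  qed (rule fin, erule lin, erule meas, erule (2) bound, rule ev_seminorm_seminorm[OF N1])
  have "hilbert_summing (EV_norm n m) (EV_norm N (m + d))"
  proof (rule hilbert_summingI[OF C])
    fix f :: "real^'d \<Rightarrow> 'k" assume f: "f \<in> EV"
    define R where "R = C * (\<Sum>js\<in>J. \<integral>y. norm (b js y f) \<partial>\<mu>)"
    have R0: "0 \<le> R" using C by (simp add: R_def sum_nonneg)
    have int: "integrable \<mu> (\<lambda>y. C * (\<Sum>js\<in>J. norm (b js y f)))"
      by (intro integrable_mult_right Bochner_Integration.integrable_sum integrable_norm_b f)
    show "EV_norm n m f \<le> C * (\<Sum>js\<in>J. \<integral>y. norm (b js y f) \<partial>\<mu>)"
      unfolding R_def[symmetric]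
    proof (rule ev_seminorm_leI[OF f n])
      fix js :: "'d list" and x assume js: "length js \<le> m" and x: "x \<in> \<Omega>n n"
      have x\<Omega>: "x \<in> \<Omega>" using x Omega_n_subset[OF n] by auto
      have "norm (iterated_partial js f x) \<le> derivative_sum m f x"
        unfolding derivative_sum_def using js by (intro member_le_sum) auto
      then have le: "norm (iterated_partial js f x) * \<nu> n x \<le> derivative_sum m f x * \<nu> n x"
        using weight_pos[OF n x\<Omega>] by (intro mult_right_mono) auto
      have "ennreal (derivative_sum m f x * \<nu> n x) \<le>
        (\<integral>\<^sup>+y. ennreal (\<psi> y) * ennreal (C * (derivative_sum (m + d) f y * \<nu> N y)) \<partial>lebesgue_on S)"
        by (rule est[rule_format, OF x ev_space_smooth[OF f]])
      also have "\<dots> = (\<integral>\<^sup>+y. ennreal (\<psi> y) * ennreal (C * (\<Sum>js\<in>J. norm (b js y f))) \<partial>lebesgue_on S)"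
      proof (rule nn_integral_cong)
        fix y assume "y \<in> space (lebesgue_on S)"
        then have "0 < \<nu> N y" using weight_pos[OF N1] S(2) by (auto simp: space_restrict_space)
        then have "derivative_sum (m + d) f y * \<nu> N y = (\<Sum>js\<in>J. norm (b js y f))"
          by (simp add: derivative_sum_def J_def b_def norm_mult sum_distrib_right)
        then show "ennreal (\<psi> y) * ennreal (C * (derivative_sum (m + d) f y * \<nu> N y))
          = ennreal (\<psi> y) * ennreal (C * (\<Sum>js\<in>J. norm (b js y f)))" by simp
      qed
      also have "\<dots> = (\<integral>\<^sup>+y. ennreal (C * (\<Sum>js\<in>J. norm (b js y f))) \<partial>\<mu>)"
      proof -
        have "(\<lambda>y. C * (\<Sum>js\<in>J. norm (b js y f))) \<in> borel_measurable (lebesgue_on S)"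
          using borel_measurable_integrable[OF int] by (simp add: \<mu>_def)
        then show ?thesis unfolding \<mu>_def by (intro nn_integral_density[symmetric]) auto
      qed
      also have "\<dots> = ennreal (\<integral>y. C * (\<Sum>js\<in>J. norm (b js y f)) \<partial>\<mu>)"
        using C by (intro nn_integral_eq_integral int AE_I2) (auto intro!: mult_nonneg_nonneg sum_nonneg)
      also have "(\<integral>y. C * (\<Sum>js\<in>J. norm (b js y f)) \<partial>\<mu>) = R"
        using integrable_norm_b[OF _ f]
        by (subst integral_mult_right_zero) (simp add: R_def Bochner_Integration.integral_sum)
      finally have "derivative_sum m f x * \<nu> n x \<le> R" using R0 by simp
      then show "norm (iterated_partial js f x) * \<nu> n x \<le> R" using le by linarith
    qed
  qed
  then show ?thesis using N1 unfolding d_def by blast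
qed

theorem nuclear_ev_topology:
  assumes "conjugation (cj :: 'k::{real_normed_field, banach, second_countable_topology} \<Rightarrow> 'k)"
  shows "nuclear_space (pointwise_scale (*)) (ev_topology \<Omega> \<Omega>n \<nu> :: (real^'d \<Rightarrow> 'k) topology)"
proof -
  interpret conjugation cj by (rule assms(1))
  interpret seminorm_system "pointwise_scale (*) :: 'k \<Rightarrow> (real^'d \<Rightarrow> 'k) \<Rightarrow> _" "EV"
    "{EV_norm n m | n m. 1 \<le> n}"
    by (rule ev_seminorm_system)
  interpret hermitian_seminorm_system "pointwise_scale (*) :: 'k \<Rightarrow> (real^'d \<Rightarrow> 'k) \<Rightarrow> _" "EV"
    "{EV_norm n m | n m. 1 \<le> n}" cj ..
  show ?thesis
    unfolding ev_topology_def
  proof (rule nuclear_space_criterion)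
    fix p :: "(real^'d \<Rightarrow> 'k) \<Rightarrow> real" assume "p \<in> {EV_norm n m | n m. 1 \<le> n}"
    then obtain n m where p: "p = EV_norm n m" and n: "1 \<le> n" by blast
    obtain N where N: "1 \<le> N" "hilbert_summing p (EV_norm N (m + CARD('d)))"
      using ev_seminorm_hilbert_summing[OF assms n, of m] unfolding p by blast
    show "\<exists>q\<in>{EV_norm n m | n m. 1 \<le> n}. hilbert_summing p q"
      using N by (intro bexI[of _ "EV_norm N (m + CARD('d))"]) auto
  qed
qed

end

section \<open>Nuclearity\<close>

lemma conjugation_real: "conjugation (\<lambda>x :: real. x)"
  by unfold_locales (auto simp: power2_eq_square)

lemma conjugation_complex: "conjugation cnj"
  by unfold_locales (auto simp: complex_norm_square simp del: of_real_power)

theorem theorem3p1: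
  fixes \<Omega> :: "(real^'d::finite) set"
    and \<Omega>n :: "nat \<Rightarrow> (real^'d) set"
    and \<nu> :: "nat \<Rightarrow> real^'d \<Rightarrow> real"
    and r :: "nat \<Rightarrow> real^'d \<Rightarrow> real"
  assumes "open \<Omega>"
    and "\<forall>n\<ge>1. \<Omega>n n \<noteq> {} \<and> \<Omega>n n \<in> sets lebesgue \<and> \<Omega>n n \<subseteq> \<Omega>n (n + 1)"
    and "\<Omega> = (\<Union>n\<in>{1..}. \<Omega>n n)"
    and "\<forall>n\<ge>1. continuous_on \<Omega> (\<nu> n) \<and> (\<forall>x\<in>\<Omega>. 0 < \<nu> n x \<and> \<nu> n x \<le> \<nu> (n + 1) x)"
    and "\<forall>k\<ge>1. \<forall>x\<in>\<Omega>n k. 0 < r k x \<and> r k x \<le> 1 \<and> ereal (r k x) < boundary_dist (\<Omega>n (k + 1)) x"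
    and "\<forall>k\<ge>1. \<forall>n\<ge>1. \<exists>(\<psi> :: real^'d \<Rightarrow> real) (I1::nat) (I2::nat) (I3::nat) (A1::real) (A2::real) (A3::real).
           integrable (lebesgue_on (\<Omega>n k)) \<psi> \<and> (\<forall>x\<in>\<Omega>n k. 0 < \<psi> x) \<and>
           n \<le> I1 \<and> n \<le> I2 \<and> n \<le> I3 \<and> 0 < A1 \<and> 0 < A2 \<and> 0 < A3 \<and>
           (\<forall>x\<in>\<Omega>n k.
              (SUP \<zeta>\<in>{\<zeta>. infnorm \<zeta> \<le> r k x}. \<nu> n (x + \<zeta>))
                \<le> A1 * (INF \<zeta>\<in>{\<zeta>. infnorm \<zeta> \<le> r k x}. \<nu> I1 (x + \<zeta>)) \<and>
              \<nu> n x \<le> A2 * \<psi> x * \<nu> I2 x \<and>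
              \<nu> n x \<le> A3 * r k x * \<nu> I3 x)"
    and "(\<forall>n\<ge>1. 0 < (INF x\<in>\<Omega>n n. r n x)) \<or>
         (\<forall>n\<ge>1. closed (\<Omega>n n)) \<or>
         (\<forall>n\<ge>1. \<Omega>n n = \<Omega> \<and> continuous_on (\<Omega>n n) (r n))"
  shows "nuclear_space (pointwise_scale (*)) (ev_topology \<Omega> \<Omega>n \<nu> :: (real^'d \<Rightarrow> real) topology) \<and>
         nuclear_space (pointwise_scale (*)) (ev_topology \<Omega> \<Omega>n \<nu> :: (real^'d \<Rightarrow> complex) topology)"
proof -
  interpret growth_weight_system \<Omega> \<Omega>n \<nu> r
  proof
    show "open \<Omega>" by fact
    show "\<Omega> = (\<Union>n\<in>{1..}. \<Omega>n n)" by fact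
  qed (erule assms(2,4,5,6)[rule_format]; assumption)+
  show ?thesis
    using nuclear_ev_topology[OF conjugation_real] nuclear_ev_topology[OF conjugation_complex] by blast
qed

end
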